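(* Let $1\le s<2$, let $\Omega:S^1\to\mathbb{R}$ be smooth, strictly positive, with $\Omega(\theta+\pi)=\Omega(\theta)$, and let $W(\mathbf{x})=|\mathbf{x}|^{-s}\Omega(\theta)+|\mathbf{x}|^2$ on $\mathbb{R}^2$. Then $$\hat W(\xi)>0,\quad\forall\xi\neq0,$$ i.e., $W$ has the LIC (linear interpolation convexity) property.
   Context: $S^1=[-\pi,\pi)$ is the set of angles (mod $2\pi$); $\theta$ is the angle of $\mathbf{x}\in\mathbb{R}^2\setminus\{0\}$, i.e. $\mathbf{x}/|\mathbf{x}|=(\cos\theta,\sin\theta)$. $\hat W$ is the Fourier transform of $W$ as a tempered distribution, with convention $\hat f(\xi)=\int_{\mathbb{R}^2}f(\mathbf{x})e^{-2\pi i\mathbf{x}\cdot\xi}\,\mathrm{d}\mathbf{x}$; away from $\xi=0$ it is a continuous function (the quadratic term contributes only at $\xi=0$), and $\hat W(\xi)$ for $\xi\ne0$ denotes the value of this function. The energy is $E[\rho]=\frac12\int_{\mathbb{R}^2}\int_{\mathbb{R}^2}W(\mathbf{x}-\mathbf{y})\rho(\mathbf{y})\,\mathrm{d}\mathbf{y}\,\rho(\mathbf{x})\,\mathrm{d}\mathbf{x}$. $W$ has the LIC property if for any two compactly supported probability measures $\rho_0\neq\rho_1$ on $\mathbb{R}^2$ with finite energy and with the same center of mass, the function $t\mapsto E[(1-t)\rho_0+t\rho_1]$, $t\in[0,1]$, is strictly convex (equivalently $E[\rho_0-\rho_1]>0$). *)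

theory Defs
  imports "HOL-Probability.Probability"
begin

section \<open>Smooth functions\<close>

text \<open>
  Iterated directional derivatives. A function is $C^\infty$ if and only if all its iterated
  partial derivatives exist and are differentiable everywhere. For \<^typ>\<open>real\<close> the only
  basis vector is 1, so this is the usual notion of a smooth function of one variable.
\<close>

fun iter_deriv ::
  "'a list \<Rightarrow> ('a::real_normed_vector \<Rightarrow> 'b::real_normed_vector) \<Rightarrow> 'a \<Rightarrow> 'b" where
  "iter_deriv [] f = f"
| "iter_deriv (b # bs) f = (\<lambda>x. frechet_derivative (iter_deriv bs f) (at x) b)"

definition smooth :: "('a::euclidean_space \<Rightarrow> 'b::real_normed_vector) \<Rightarrow> bool" where
  "smooth f \<longleftrightarrow> (\<forall>bs. set bs \<subseteq> Basis \<longrightarrow> iter_deriv bs f differentiable_on UNIV)"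

section \<open>Fourier transform of a potential away from the origin\<close>

definition fourier :: "(real^2 \<Rightarrow> complex) \<Rightarrow> real^2 \<Rightarrow> complex" where
  "fourier f \<xi> = (LINT x|lborel. f x * exp (- (2 * of_real pi * \<i> * of_real (x \<bullet> \<xi>))))"

definition test_function_on :: "(real^2) set \<Rightarrow> (real^2 \<Rightarrow> complex) \<Rightarrow> bool" where
  "test_function_on U \<phi> \<longleftrightarrow>
     smooth \<phi> \<and> (\<exists>K. compact K \<and> K \<subseteq> U \<and> (\<forall>x. x \<notin> K \<longrightarrow> \<phi> x = 0))"

text \<open>
  The Fourier transform of a tempered distribution \<open>T\<close> is \<open>\<phi> \<mapsto> T (fourier \<phi>)\<close>. The predicate
  says that the Fourier transform of the distribution \<open>\<phi> \<mapsto> \<integral> W \<phi>\<close>, restricted to the open set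
  \<open>- {0}\<close>, is the continuous function \<open>g\<close>. This determines \<open>g\<close> uniquely on \<open>- {0}\<close>; its value
  at 0 is unconstrained. The integrability clauses exclude the default value 0 that the
  Bochner integral assigns to non-integrable functions.
\<close>

definition has_fourier_off_origin :: "(real^2 \<Rightarrow> real) \<Rightarrow> (real^2 \<Rightarrow> complex) \<Rightarrow> bool" where
  "has_fourier_off_origin W g \<longleftrightarrow>
     continuous_on (- {0}) g \<and>
     (\<forall>\<phi>. test_function_on (- {0}) \<phi> \<longrightarrow>
        integrable lborel (\<lambda>x. of_real (W x) * fourier \<phi> x) \<and>
        integrable lborel (\<lambda>\<xi>. g \<xi> * \<phi> \<xi>) \<and>
        (LINT x|lborel. of_real (W x) * fourier \<phi> x) = (LINT \<xi>|lborel. g \<xi> * \<phi> \<xi>))"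

section \<open>Interaction energy and linear interpolation convexity\<close>

text \<open>
  Potentials enter the energy as kernels with values in \<open>[0, \<infinity>]\<close>, so that the energy of every
  measure is defined, possibly infinite.
\<close>

definition energy :: "(real^2 \<Rightarrow> ennreal) \<Rightarrow> (real^2) measure \<Rightarrow> ennreal" where
  "energy W \<rho> = (1 / 2) * (\<integral>\<^sup>+x. (\<integral>\<^sup>+y. W (x - y) \<partial>\<rho>) \<partial>\<rho>)"

definition compactly_supported_prob :: "(real^2) measure \<Rightarrow> bool" where
  "compactly_supported_prob \<rho> \<longleftrightarrow>
     prob_space \<rho> \<and> sets \<rho> = sets borel \<and> (\<exists>K. compact K \<and> emeasure \<rho> (- K) = 0)"

definition center_of_mass :: "(real^2) measure \<Rightarrow> real^2" where
  "center_of_mass \<rho> = (LINT x|\<rho>. x)"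

definition interpolation :: "(real^2) measure \<Rightarrow> (real^2) measure \<Rightarrow> real \<Rightarrow> (real^2) measure" where
  "interpolation \<rho>\<^sub>0 \<rho>\<^sub>1 t =
     measure_of UNIV (sets borel)
       (\<lambda>A. ennreal (1 - t) * emeasure \<rho>\<^sub>0 A + ennreal t * emeasure \<rho>\<^sub>1 A)"

text \<open>
  The strict inequality forces \<open>f\<close> to be finite at every point strictly between two points of \<open>S\<close>.
\<close>

definition strictly_convex_on :: "real set \<Rightarrow> (real \<Rightarrow> ennreal) \<Rightarrow> bool" where
  "strictly_convex_on S f \<longleftrightarrow>
     convex S \<and>
     (\<forall>a\<in>S. \<forall>b\<in>S. \<forall>u. a \<noteq> b \<and> 0 < u \<and> u < 1 \<longrightarrow>
        f ((1 - u) * a + u * b) < ennreal (1 - u) * f a + ennreal u * f b)"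

definition LIC :: "(real^2 \<Rightarrow> ennreal) \<Rightarrow> bool" where
  "LIC W \<longleftrightarrow>
     (\<forall>\<rho>\<^sub>0 \<rho>\<^sub>1. compactly_supported_prob \<rho>\<^sub>0 \<and> compactly_supported_prob \<rho>\<^sub>1 \<and> \<rho>\<^sub>0 \<noteq> \<rho>\<^sub>1 \<and>
        energy W \<rho>\<^sub>0 < \<infinity> \<and> energy W \<rho>\<^sub>1 < \<infinity> \<and> center_of_mass \<rho>\<^sub>0 = center_of_mass \<rho>\<^sub>1 \<longrightarrow>
        strictly_convex_on {0..1} (\<lambda>t. energy W (interpolation \<rho>\<^sub>0 \<rho>\<^sub>1 t)))"

section \<open>The anisotropic potential\<close>

text \<open>
  \<^const>\<open>Arg\<close> takes values in \<open>(-\<pi>, \<pi>]\<close> rather than \<open>[-\<pi>, \<pi>)\<close>; for the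
  periodic profiles considered here the choice of representative is immaterial.
\<close>

definition angle :: "real^2 \<Rightarrow> real" where
  "angle x = Arg (Complex (x $ 1) (x $ 2))"

definition aniso_potential :: "real \<Rightarrow> (real \<Rightarrow> real) \<Rightarrow> real^2 \<Rightarrow> real" where
  "aniso_potential s \<Omega> x = norm x powr (- s) * \<Omega> (angle x) + (norm x)\<^sup>2"

text \<open>
  \<open>0 powr (- s) = 0\<close> in HOL, whereas \<open>|x| powr (- s)\<close> tends to infinity at 0. The value at 0
  is irrelevant for the Fourier transform, but not for the energy of measures that are not
  absolutely continuous: the kernel must be infinite at 0, so that measures with atoms have
  infinite energy.
\<close>

definition singular_kernel :: "(real^2 \<Rightarrow> real) \<Rightarrow> real^2 \<Rightarrow> ennreal" where
  "singular_kernel W x = (if x = 0 then \<infinity> else ennreal (W x))"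

end

theory Submission
  imports Defs
begin

text \<open>
  Write \<open>V(x) = |x|^{-s} \<Omega>(\<theta>)\<close>. Both claims rest on one approximation of \<open>V\<close> by superpositions of
  isotropic Riesz kernels seen through linear maps. For \<open>0 < e \<le> 1\<close> let \<open>A\<^sub>\<alpha>\<close> (\<open>stretch\<close>) rotate the plane
  by \<open>-\<alpha>\<close> and then multiply the first coordinate by \<open>e\<close>. Then
  \<open>|A\<^sub>\<alpha> x|^{-s} = |x|^{-s} \<kappa>(\<theta> - \<alpha>)^{-s/2}\<close> with \<open>\<kappa> = e\<^sup>2 cos\<^sup>2 + sin\<^sup>2\<close> (\<open>stretch_factor\<close>), so the
  average of these kernels over \<open>\<alpha>\<close>, weighted by \<open>\<Omega>\<close>, is again homogeneous of degree \<open>-s\<close>, and its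
  angular profile is a convolution mean of \<open>\<Omega>\<close> (\<open>direction_mean\<close>). Since \<open>s \<ge> 1\<close>, the total mass of
  \<open>\<kappa>^{-s/2}\<close> tends to infinity as \<open>e \<rightarrow> 0\<close>, while the mass away from \<open>\<beta> = 0\<close> stays bounded. So the
  normalized means tend to \<open>\<Omega>\<close> uniformly (\<open>direction_mean_approximates\<close>). This is what the hypothesis
  \<open>s \<ge> 1\<close> is for.

  Convexity. The kernel \<open>|x|^{-s}\<close> is a superposition of Gaussians, and a Gaussian kernel in \<open>x - y\<close> is an
  integral of products of a Gaussian in \<open>x - z\<close> and one in \<open>y - z\<close>. Hence the interaction energy
  satisfies \<open>2 I(\<mu>, \<nu>) \<le> I(\<mu>, \<mu>) + I(\<nu>, \<nu>)\<close>, and if the right side is finite, equality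
  holds only for \<open>\<mu> = \<nu>\<close> (\<open>energy_definite_riesz\<close>). Composing the kernel with a linear map amounts to pushing the measures
  forward, and averaging preserves the inequality. Uniformly close positive profiles give kernels with
  ratio close to 1, so the inequality passes to the limit \<open>e \<rightarrow> 0\<close> although the kernels are unbounded
  (\<open>energy_positive_closure\<close>). It becomes strict for \<open>V\<close> because \<open>V\<close> is the sum of a small multiple of
  \<open>|x|^{-s}\<close> and of a kernel of the same form, with profile \<open>\<Omega> - m/2\<close>, where \<open>m\<close> is a positive lower
  bound of \<open>\<Omega>\<close> (\<open>energy_definite_angular\<close>). The term \<open>|x|\<^sup>2\<close> contributes an equality when the centers of
  mass agree (\<open>mutual_energy_quadratic\<close>). Finally the energy of an interpolation is a quadratic
  polynomial in the parameter, whose leading coefficient is half the difference of the two sides.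

  Fourier transform. The same Gaussians show that \<open>|x|^{-s}\<close> has the transform \<open>c |\<xi>|^{s-2}\<close> with
  \<open>c > 0\<close> (\<open>fourier_riesz\<close>). A linear change of variables and averaging over \<open>\<alpha>\<close> turn this into: the
  potential with profile the mean of \<open>\<Omega>\<close> with exponent \<open>s/2\<close> has the transform \<open>c |\<xi>|^{s-2}\<close> times
  the mean of \<open>\<Omega>\<close> with exponent \<open>1 - s/2\<close>, taken around the direction orthogonal to \<open>\<xi>\<close>
  (\<open>fourier_direction_mean\<close>). As \<open>e \<rightarrow> 0\<close> the left side tends to \<open>V\<close>. On the right side the exponent is at
  most 1/2: for \<open>s = 1\<close> it is 1/2 and the limit is \<open>\<Omega>\<close> again; for \<open>s > 1\<close> the kernels converge to the
  integrable function \<open>|sin|^{s-2}\<close> (\<open>direction_mean_limit\<close>). In both cases the limit is a mean of \<open>\<Omega>\<close> and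
  therefore positive. The term \<open>|x|\<^sup>2\<close> does not contribute away from \<open>\<xi> = 0\<close>, because
  \<open>|x|\<^sup>2 fourier \<phi>\<close> is a multiple of the transform of the Laplacian of \<open>\<phi>\<close>, whose integral is the value of
  the Laplacian at 0 (\<open>integral_norm_sq_fourier_eq_0\<close>).
\<close>

abbreviation wave :: "real \<Rightarrow> complex" where
  "wave r \<equiv> exp (- (2 * of_real pi * \<i> * of_real r))"

section \<open>The plane as a product, and Gaussians\<close>

definition vec2 :: "real \<Rightarrow> real \<Rightarrow> real^2" where
  "vec2 a b = (\<chi> i. if i = 1 then a else b)"

lemma vec2_nth [simp]: "vec2 a b $ 1 = a" "vec2 a b $ 2 = b"
  by (simp_all add: vec2_def)

lemma inner_real2: "(x::real^2) \<bullet> y = x $ 1 * y $ 1 + x $ 2 * y $ 2"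
  by (simp add: inner_vec_def sum_2)

lemma norm_real2_sq: "(norm (x::real^2))\<^sup>2 = (x $ 1)\<^sup>2 + (x $ 2)\<^sup>2"
  unfolding power2_norm_eq_inner by (simp add: inner_real2 power2_eq_square)

lemma vec2_measurable [measurable]: "(\<lambda>p. vec2 (fst p) (snd p)) \<in> borel_measurable borel"
proof (rule borel_measurable_continuous_onI)
  have "continuous_on UNIV (\<lambda>p::real\<times>real. if i = 1 then fst p else snd p)" for i :: 2
    by (cases "i = 1") (auto intro!: continuous_intros)
  then show "continuous_on UNIV (\<lambda>p. vec2 (fst p) (snd p))"
    unfolding vec2_def by (intro continuous_on_vec_lambda)
qed

lemma Basis_real2: "(Basis :: (real^2) set) = {axis 1 1, axis 2 1}"
  by (auto simp: Basis_vec_def UNIV_2)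

text \<open>
  Lebesgue measure on \<^typ>\<open>real^2\<close> is the image of the product measure. This makes products of functions
  of one coordinate accessible to Fubini.
\<close>

lemma lborel_real2: "(lborel :: (real^2) measure) = distr (lborel \<Otimes>\<^sub>M lborel) borel (\<lambda>p. vec2 (fst p) (snd p))"
proof (rule lborel_eqI)
  fix l u :: "real^2" assume lu: "\<And>b. b \<in> Basis \<Longrightarrow> l \<bullet> b \<le> u \<bullet> b"
  have le: "l $ 1 \<le> u $ 1" "l $ 2 \<le> u $ 2"
    using lu[of "axis 1 1"] lu[of "axis 2 1"] by (auto simp: Basis_real2 inner_axis)
  have ne: "axis 1 1 \<noteq> (axis 2 1 :: real^2)" by (simp add: axis_eq_axis)
  have vim: "(\<lambda>p. vec2 (fst p) (snd p)) -` box l u = {l$1<..<u$1} \<times> {l$2<..<u$2}"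
    by (auto simp: mem_box_cart forall_2)
  have "emeasure (distr (lborel \<Otimes>\<^sub>M lborel) borel (\<lambda>p. vec2 (fst p) (snd p))) (box l u)
    = emeasure (lborel \<Otimes>\<^sub>M lborel) ({l$1<..<u$1} \<times> {l$2<..<u$2})"
    by (subst emeasure_distr) (auto simp: vim space_pair_measure lborel_prod)
  also have "\<dots> = ennreal (u$1 - l$1) * ennreal (u$2 - l$2)"
    using le by (subst lborel.emeasure_pair_measure_Times) auto
  also have "\<dots> = ennreal (\<Prod>b\<in>Basis. (u - l) \<bullet> b)"
    using le ne by (simp add: Basis_real2 inner_axis ennreal_mult)
  finally show "emeasure (distr (lborel \<Otimes>\<^sub>M lborel) borel (\<lambda>p. vec2 (fst p) (snd p))) (box l u) = ennreal (\<Prod>b\<in>Basis. (u - l) \<bullet> b)" .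
qed simp

lemma vec2_measurable' [measurable]: "(\<lambda>p. vec2 (fst p) (snd p)) \<in> borel_measurable (lborel \<Otimes>\<^sub>M lborel)"
  unfolding lborel_prod using vec2_measurable by simp

lemma integrable_real2_prod:
  fixes f g :: "real \<Rightarrow> 'a::{real_normed_field,banach,second_countable_topology}"
  assumes "integrable lborel f" "integrable lborel g"
  shows "integrable lborel (\<lambda>x::real^2. f (x $ 1) * g (x $ 2))"
    and "(LINT x|lborel. f ((x::real^2) $ 1) * g (x $ 2)) = (LINT x|lborel. f x) * (LINT x|lborel. g x)"
proof -
  have [measurable]: "f \<in> borel_measurable borel" "g \<in> borel_measurable borel"
    using assms by (auto dest: borel_measurable_integrable)
  have i: "integrable (lborel \<Otimes>\<^sub>M lborel) (\<lambda>p. f (fst p) * g (snd p))"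
  proof (rule lborel_pair.Fubini_integrable)
    show "integrable lborel (\<lambda>x. \<integral>y. norm (f (fst (x, y)) * g (snd (x, y))) \<partial>lborel)"
      using assms by (simp add: norm_mult)
  qed (use assms in auto)
  have m: "(\<lambda>x::real^2. f (x $ 1) * g (x $ 2)) \<in> borel_measurable borel" by measurable
  show "integrable lborel (\<lambda>x::real^2. f (x $ 1) * g (x $ 2))"
    using i by (simp add: lborel_real2 integrable_distr_eq m)
  have "(LINT x|lborel. f ((x::real^2) $ 1) * g (x $ 2)) = (\<integral>p. f (fst p) * g (snd p) \<partial>(lborel \<Otimes>\<^sub>M lborel))"
    by (simp add: lborel_real2 integral_distr m)
  also have "\<dots> = (\<integral>x. \<integral>y. f x * g y \<partial>lborel \<partial>lborel)"
    using lborel_pair.integral_fst'[OF i] by simp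
  finally show "(LINT x|lborel. f ((x::real^2) $ 1) * g (x $ 2)) = (LINT x|lborel. f x) * (LINT x|lborel. g x)"
    using assms by simp
qed

text \<open>
  The characteristic function of the standard normal distribution, rescaled by \<open>1 / sqrt (2 t)\<close>.
\<close>

lemma fourier_gaussian_1d:
  fixes t u :: real
  assumes t: "t > 0"
  shows "integrable lborel (\<lambda>x. of_real (exp (- (t * x\<^sup>2))) * wave (x * u))"
    and "(LINT x|lborel. of_real (exp (- (t * x\<^sup>2))) * wave (x * u))
      = complex_of_real (sqrt (pi / t) * exp (- (pi\<^sup>2 * u\<^sup>2 / t)))"
proof -
  define c where "c = 1 / sqrt (2 * t)"
  have c: "c > 0" "c \<noteq> 0" and c2: "c\<^sup>2 = 1 / (2 * t)" using t by (auto simp: c_def power_divide)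
  let ?f = "\<lambda>x. of_real (exp (- (t * x\<^sup>2))) * wave (x * u)"
  have int1: "integrable lborel (\<lambda>x. std_normal_density x *\<^sub>R iexp (v * x))" for v
    by (rule Bochner_Integration.integrable_bound[of lborel std_normal_density])
       (use integrable_normal_density[of 1 0] in \<open>auto simp: normal_density_nonneg\<close>)
  have val: "(LINT x|lborel. std_normal_density x *\<^sub>R iexp (v * x)) = exp (- (v\<^sup>2) / 2)" for v
  proof -
    have "(LINT x|lborel. std_normal_density x *\<^sub>R iexp (v * x)) = char std_normal_distribution v"
      unfolding char_def by (subst integral_density) (auto simp: normal_density_nonneg)
    then show ?thesis by (simp add: char_std_normal_distribution exp_of_real)
  qed
  define v where "v = - 2 * pi * u * c"
  have eq: "?f (0 + c * x) = of_real (sqrt (2*pi)) * (std_normal_density x *\<^sub>R iexp (v * x))" for x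
  proof -
    have "t * (c * x)\<^sup>2 = x\<^sup>2 / 2" using t by (simp add: power_mult_distrib c2)
    then show ?thesis
      by (simp add: std_normal_density_def v_def mult_ac scaleR_conv_of_real)
  qed
  have i2: "integrable lborel (\<lambda>x. ?f (0 + c * x))" unfolding eq by (rule integrable_mult_right[OF int1[of v]])
  show "integrable lborel ?f"
    using i2 by (simp only: lborel_integrable_real_affine_iff[OF c(2), where f="?f" and t=0])
  have "integral\<^sup>L lborel ?f = \<bar>c\<bar> *\<^sub>R (LINT x|lborel. ?f (0 + c * x))"
    by (rule lborel_integral_real_affine[OF c(2)])
  also have "\<dots> = of_real (c * sqrt (2 * pi) * exp (- (v\<^sup>2) / 2))"
    unfolding eq integral_mult_right_zero val using c by (simp add: scaleR_conv_of_real exp_of_real)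
  also have "c * sqrt (2 * pi) = sqrt (pi / t)"
    unfolding c_def using t by (simp add: real_sqrt_mult real_sqrt_divide)
  also have "- (v\<^sup>2) / 2 = - (pi\<^sup>2 * u\<^sup>2 / t)"
    by (simp add: v_def power_mult_distrib c2)
  finally show "integral\<^sup>L lborel ?f = of_real (sqrt (pi / t) * exp (- (pi\<^sup>2 * u\<^sup>2 / t)))" .
qed

lemma fourier_gaussian:
  fixes t :: real
  assumes t: "t > 0"
  shows "fourier (\<lambda>x. of_real (exp (- (t * (norm x)\<^sup>2)))) \<xi> = of_real (pi / t * exp (- (pi\<^sup>2 * (norm \<xi>)\<^sup>2 / t)))"
proof -
  have "fourier (\<lambda>x. of_real (exp (- (t * (norm x)\<^sup>2)))) \<xi> 
    = (LINT x::real^2|lborel. (of_real (exp (- (t * (x$1)\<^sup>2))) * wave ((x $1 * \<xi> $ 1))) *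
        (of_real (exp (- (t * (x$2)\<^sup>2))) * wave ((x $2 * \<xi> $ 2))))"
    unfolding fourier_def by (intro Bochner_Integration.integral_cong)
      (simp_all add: inner_real2 norm_real2_sq exp_add[symmetric] exp_of_real[symmetric] algebra_simps)
  also have "\<dots> = of_real (sqrt (pi / t) * exp (- (pi\<^sup>2 * (\<xi>$1)\<^sup>2 / t))) * of_real (sqrt (pi / t) * exp (- (pi\<^sup>2 * (\<xi>$2)\<^sup>2 / t)))"
    by (subst integrable_real2_prod(2)[OF fourier_gaussian_1d(1)[OF t] fourier_gaussian_1d(1)[OF t]])
       (simp only: fourier_gaussian_1d(2)[OF t])
  also have "\<dots> = of_real ((sqrt (pi / t) * sqrt (pi / t)) * exp (- (pi\<^sup>2 * (\<xi>$1)\<^sup>2 / t) - (pi\<^sup>2 * (\<xi>$2)\<^sup>2 / t)))"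
    unfolding diff_conv_add_uminus exp_add of_real_mult by (simp only: mult_ac)
  also have "sqrt (pi / t) * sqrt (pi / t) = pi / t" using t by simp
  also have "(- (pi\<^sup>2 * (\<xi>$1)\<^sup>2 / t) - (pi\<^sup>2 * (\<xi>$2)\<^sup>2 / t)) = - (pi\<^sup>2 * (norm \<xi>)\<^sup>2 / t)"
    by (simp add: norm_real2_sq algebra_simps add_divide_distrib)
  finally show ?thesis .
qed

lemma integrable_gaussian:
  fixes t :: real
  assumes t: "t > 0"
  shows "integrable lborel (\<lambda>x::real^2. exp (- (t * (norm x)\<^sup>2)))"
proof -
  have 1: "integrable lborel (\<lambda>x. exp (- (t * x\<^sup>2)))"
    using integrable_norm[OF fourier_gaussian_1d(1)[OF t, of 0]] by (simp add: norm_mult)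
  have "integrable lborel (\<lambda>x::real^2. exp (- (t * (x$1)\<^sup>2)) * exp (- (t * (x$2)\<^sup>2)))"
    by (rule integrable_real2_prod[OF 1 1])
  then show ?thesis by (simp add: exp_add[symmetric] norm_real2_sq algebra_simps)
qed

text \<open>
  The linear change of variables as an identity of measures, which serves Bochner and nonnegative
  integrals alike.
\<close>

lemma lborel_distr_linear:
  fixes A :: "real^2 \<Rightarrow> real^2"
  assumes A: "linear A" and B: "linear B" and BA: "\<And>x. B (A x) = x" and AB: "\<And>x. A (B x) = x"
  shows "lborel = density (distr lborel borel A) (\<lambda>_. ennreal \<bar>det (matrix A)\<bar>)"
proof (rule lborel_eqI)
  have [measurable]: "A \<in> borel_measurable borel"
    using A by (intro borel_measurable_continuous_onI linear_continuous_on) (simp add: linear_conv_bounded_linear)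
  have "matrix A ** matrix B = matrix (A \<circ> B)" using matrix_compose[OF B A] by simp
  also have "A \<circ> B = id" using AB by auto
  finally have "det (matrix A) * det (matrix B) = 1"
    by (metis det_mul det_I matrix_id_mat_1)
  then have dd: "\<bar>det (matrix A)\<bar> * \<bar>det (matrix B)\<bar> = 1" by (simp add: abs_mult[symmetric])
  fix l u :: "real^2" assume lu: "\<And>b. b \<in> Basis \<Longrightarrow> l \<bullet> b \<le> u \<bullet> b"
  have vim: "A -` box l u = B ` box l u" using AB BA by (auto simp: image_iff) metis
  have m: "B ` box l u \<in> lmeasurable" "measure lebesgue (B ` box l u) = \<bar>det (matrix B)\<bar> * measure lebesgue (box l u)"
    using measure_linear_image[OF B, of "box l u"] measurable_linear_image[OF B, of "box l u"] by auto
  have s: "B ` box l u \<in> sets borel" unfolding vim[symmetric] 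
    using measurable_sets[of A borel borel "box l u"] by simp
  have "emeasure (density (distr lborel borel A) (\<lambda>_. ennreal \<bar>det (matrix A)\<bar>)) (box l u) = ennreal \<bar>det (matrix A)\<bar> * emeasure lborel (B ` box l u)"
    by (simp add: emeasure_density nn_integral_cmult_indicator emeasure_distr vim)
  also have "emeasure lborel (B ` box l u) = emeasure lebesgue (B ` box l u)" using s by simp
  also have "\<dots> = ennreal (\<bar>det (matrix B)\<bar> * measure lebesgue (box l u))"
    unfolding m(2)[symmetric] by (rule emeasure_eq_measure2[OF m(1)])
  also have "ennreal \<bar>det (matrix A)\<bar> * \<dots> = ennreal (measure lebesgue (box l u))"
    by (simp add: ennreal_mult[symmetric] dd mult.assoc[symmetric])
  also have "measure lebesgue (box l u) = (\<Prod>b\<in>Basis. (u - l) \<bullet> b)"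
    using lu by (simp add: measure_lborel_box_eq)
  finally show "emeasure (density (distr lborel borel A) (\<lambda>_. ennreal \<bar>det (matrix A)\<bar>)) (box l u) = ennreal (\<Prod>b\<in>Basis. (u - l) \<bullet> b)" .
qed simp

section \<open>Mutual energies\<close>

definition mutual_energy :: "(real^2 \<Rightarrow> ennreal) \<Rightarrow> (real^2) measure \<Rightarrow> (real^2) measure \<Rightarrow> ennreal" where
  "mutual_energy k \<mu> \<nu> = (\<integral>\<^sup>+x. \<integral>\<^sup>+y. k (x - y) \<partial>\<nu> \<partial>\<mu>)"

text \<open>
  The inequality \<open>2 I(\<mu>, \<nu>) \<le> I(\<mu>, \<mu>) + I(\<nu>, \<nu>)\<close> in \<open>[0, \<infinity>]\<close>. It expresses \<open>I(\<mu> - \<nu>, \<mu> - \<nu>) \<ge> 0\<close> without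
  subtracting possibly infinite energies; the two mixed terms avoid an evenness assumption on \<open>k\<close>.
\<close>

definition energy_positive :: "(real^2 \<Rightarrow> ennreal) \<Rightarrow> bool" where
  "energy_positive k \<longleftrightarrow> (\<forall>\<mu> \<nu>. compactly_supported_prob \<mu> \<longrightarrow> compactly_supported_prob \<nu> \<longrightarrow>
     mutual_energy k \<mu> \<nu> + mutual_energy k \<nu> \<mu> \<le> mutual_energy k \<mu> \<mu> + mutual_energy k \<nu> \<nu>)"

definition energy_definite :: "(real^2 \<Rightarrow> ennreal) \<Rightarrow> bool" where
  "energy_definite k \<longleftrightarrow> (\<forall>\<mu> \<nu>. compactly_supported_prob \<mu> \<longrightarrow> compactly_supported_prob \<nu> \<longrightarrow> \<mu> \<noteq> \<nu> \<longrightarrow>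
     mutual_energy k \<mu> \<mu> + mutual_energy k \<nu> \<nu> < \<infinity> \<longrightarrow>
     mutual_energy k \<mu> \<nu> + mutual_energy k \<nu> \<mu> < mutual_energy k \<mu> \<mu> + mutual_energy k \<nu> \<nu>)"

lemma compactly_supported_probD:
  assumes "compactly_supported_prob \<mu>"
  shows "prob_space \<mu>" "sigma_finite_measure \<mu>" "sets \<mu> = sets borel" "space \<mu> = UNIV"
  using assms prob_space_imp_sigma_finite sets_eq_imp_space_eq[of \<mu> borel]
  by (auto simp: compactly_supported_prob_def)

lemma compactly_supported_prob_common_compact:
  assumes "compactly_supported_prob \<mu>" "compactly_supported_prob \<nu>"
  obtains K where "compact K" "AE x in \<mu>. x \<in> K" "AE x in \<nu>. x \<in> K"
proof -
  obtain K L where K: "compact K" "emeasure \<mu> (- K) = 0" and L: "compact L" "emeasure \<nu> (- L) = 0"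
    using assms by (auto simp: compactly_supported_prob_def)
  note D = compactly_supported_probD[OF assms(1)] compactly_supported_probD[OF assms(2)]
  have "- K \<in> sets \<mu>" "- L \<in> sets \<nu>" using K(1) L(1) by (auto simp: D compact_imp_closed borel_closed)
  then have "AE x in \<mu>. x \<in> K" "AE x in \<nu>. x \<in> L"
    using AE_I[of \<mu> "\<lambda>x. x \<in> K" "- K"] AE_I[of \<nu> "\<lambda>x. x \<in> L" "- L"] K(2) L(2) by (auto simp: D)
  then have "AE x in \<mu>. x \<in> K \<union> L" "AE x in \<nu>. x \<in> K \<union> L" by (auto elim: eventually_mono)
  then show ?thesis using compact_Un[OF K(1) L(1)] that[of "K \<union> L"] by blast
qed

section \<open>Gaussian averages determine a compactly supported measure\<close>

text \<open>
  The linear span of the exponentials \<open>x \<mapsto> exp (x \<bullet> w)\<close>. It is an algebra that separates points, so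
  the Stone-Weierstrass theorem applies to it on compact sets.
\<close>

inductive_set exp_span :: "(real^2 \<Rightarrow> real) set" where
  exp_span_exp: "(\<lambda>x. c * exp (x \<bullet> w)) \<in> exp_span"
| exp_span_add: "f \<in> exp_span \<Longrightarrow> g \<in> exp_span \<Longrightarrow> (\<lambda>x. f x + g x) \<in> exp_span"

lemma exp_span_mult:
  assumes "f \<in> exp_span" "g \<in> exp_span"
  shows "(\<lambda>x. f x * g x) \<in> exp_span"
  using assms(1)
proof induction
  case (exp_span_exp c w)
  from assms(2) show ?case
  proof induction
    case (exp_span_exp d v)
    show ?case using exp_span.exp_span_exp[of "c * d" "w + v"]
      by (simp add: inner_add_right exp_add mult_ac)
  qed (auto simp: distrib_left intro: exp_span.exp_span_add)
qed (auto simp: distrib_right intro: exp_span.exp_span_add)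

lemma exp_span_continuous: "f \<in> exp_span \<Longrightarrow> continuous_on S f"
  by (induction rule: exp_span.induct) (auto intro!: continuous_intros)

lemma function_ring_exp_span: "compact K \<Longrightarrow> function_ring_on exp_span K"
proof
  show "(\<lambda>_. c) \<in> exp_span" for c using exp_span_exp[of c 0] by simp
  show "\<exists>f\<in>exp_span. f x \<noteq> f y" if "x \<noteq> y" for x y
  proof -
    have "(x - y) \<bullet> (x - y) \<noteq> 0" using that by simp
    then have "x \<bullet> (x - y) \<noteq> y \<bullet> (x - y)" by (simp add: inner_diff_left)
    then show ?thesis by (intro bexI[OF _ exp_span_exp[of 1 "x - y"]]) auto
  qed
qed (auto intro: exp_span_continuous exp_span_add exp_span_mult)

lemma integrable_continuous_AE_compact:
  fixes f :: "real^2 \<Rightarrow> 'b::euclidean_space"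
  assumes "compactly_supported_prob \<mu>" and K: "compact K" "AE x in \<mu>. x \<in> K" and f: "continuous_on UNIV f"
  shows "integrable \<mu> f"
proof -
  interpret prob_space \<mu> using compactly_supported_probD[OF assms(1)] by simp
  have "bounded (f ` K)" using f K by (meson compact_continuous_image compact_imp_bounded continuous_on_subset subset_UNIV)
  then obtain B where "\<And>x. x \<in> K \<Longrightarrow> norm (f x) \<le> B" by (auto simp: bounded_iff)
  moreover have "f \<in> borel_measurable \<mu>"
    using borel_measurable_continuous_onI[OF f] compactly_supported_probD(3)[OF assms(1)] by (simp cong: measurable_cong_sets)
  ultimately show ?thesis using K(2) by (intro integrable_const_bound[of f B]) auto
qed

text \<open>
  The indicator of an open set is the increasing limit of the continuous functions
  \<open>min 1 (n * infdist x (- U))\<close>.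
\<close>

lemma measure_eq_if_integrals_eq:
  assumes \<mu>: "compactly_supported_prob \<mu>" and \<nu>: "compactly_supported_prob \<nu>"
    and eq: "\<And>F::real^2\<Rightarrow>real. continuous_on UNIV F \<Longrightarrow> (LINT x|\<mu>. F x) = (LINT x|\<nu>. F x)"
  shows "\<mu> = \<nu>"
proof -
  note D = compactly_supported_probD[OF \<mu>] compactly_supported_probD[OF \<nu>]
  interpret \<mu>: prob_space \<mu> by fact
  interpret \<nu>: prob_space \<nu> by fact
  note [measurable_cong] = D(3) D(7)
  have op: "emeasure \<mu> U = emeasure \<nu> U" if U: "open U" for U
  proof (cases "U = UNIV")
    case True then show ?thesis using \<mu>.emeasure_space_1 \<nu>.emeasure_space_1 D by simp
  next
    case False
    define F where "F n x = min 1 (real n * infdist x (- U))" for n x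
    have cont: "continuous_on UNIV (F n)" for n unfolding F_def by (intro continuous_intros)
    have [measurable]: "F n \<in> borel_measurable borel" for n using cont by (rule borel_measurable_continuous_onI)
    have lim: "(\<lambda>n. F n x) \<longlonglongrightarrow> indicator U x" for x
    proof (cases "x \<in> U")
      case True
      have "closed (- U)" "- U \<noteq> {}" using U False by auto
      then have p: "infdist x (- U) > 0" using True
        by (metis Compl_iff in_closed_iff_infdist_zero infdist_nonneg less_eq_real_def)
      obtain N where N: "real N * infdist x (- U) \<ge> 1"
        using reals_Archimedean3[OF p] by (metis less_imp_le)
      have "F n x = 1" if "n \<ge> N" for n
      proof -
        have "real N * infdist x (- U) \<le> real n * infdist x (- U)" using p that by (intro mult_right_mono) auto
        then show ?thesis using N by (simp add: F_def)
      qed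
      then show ?thesis using True by (intro tendsto_eventually) (auto simp: eventually_sequentially)
    qed (simp add: F_def)
    have [measurable]: "U \<in> sets borel" using U by simp
    have b: "\<bar>F n x\<bar> \<le> 1" for n x by (auto simp: F_def infdist_nonneg)
    have "(\<lambda>n. LINT x|\<mu>. F n x) \<longlonglongrightarrow> (LINT x|\<mu>. indicator U x)"
      using lim b U by (intro integral_dominated_convergence[where w="\<lambda>_. 1"]) auto
    moreover have "(\<lambda>n. LINT x|\<nu>. F n x) \<longlonglongrightarrow> (LINT x|\<nu>. indicator U x)"
      using lim b U by (intro integral_dominated_convergence[where w="\<lambda>_. 1"]) auto
    ultimately have "(LINT x|\<mu>. indicator U x) = (LINT x|\<nu>. indicator U x :: real)"
      unfolding eq[OF cont] by (rule LIMSEQ_unique)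
    then show ?thesis using U by (simp add: D \<mu>.emeasure_eq_measure \<nu>.emeasure_eq_measure)
  qed
  show ?thesis
  proof (rule measure_eqI_generator_eq[where E="{U. open U}" and \<Omega>=UNIV and A="\<lambda>_. UNIV"])
    show "Int_stable {U::(real^2) set. open U}" by (auto simp: Int_stable_def)
    show "sets \<mu> = sigma_sets UNIV {U. open U}" "sets \<nu> = sigma_sets UNIV {U. open U}"
      by (auto simp: D borel_def)
    show "emeasure \<mu> UNIV \<noteq> \<infinity>" using \<mu>.emeasure_space_1 D by simp
  qed (use op in auto)
qed

text \<open>
  Expanding the square, \<open>exp (- t |x - z|\<^sup>2)\<close> is up to a constant \<open>exp (2 t x \<bullet> z)\<close> times
  \<open>h x = exp (- t |x|\<^sup>2)\<close>. So the hypothesis says that \<open>h \<mu>\<close> and \<open>h \<nu>\<close> have the same integrals of all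
  exponentials, and by Stone-Weierstrass on a common compact support the same integrals of all
  continuous functions. Division by \<open>h > 0\<close> gives the claim.
\<close>

lemma measure_eq_if_gaussian_averages_eq:
  fixes t :: real
  assumes \<mu>: "compactly_supported_prob \<mu>" and \<nu>: "compactly_supported_prob \<nu>" and t: "t > 0"
    and eq: "\<And>z. (LINT x|\<mu>. exp (- (t * (norm (x - z))\<^sup>2))) = (LINT x|\<nu>. exp (- (t * (norm (x - z))\<^sup>2)))"
  shows "\<mu> = \<nu>"
proof (rule measure_eq_if_integrals_eq[OF \<mu> \<nu>])
  fix F :: "real^2 \<Rightarrow> real" assume F: "continuous_on UNIV F"
  obtain K where K: "compact K" "AE x in \<mu>. x \<in> K" "AE x in \<nu>. x \<in> K"
    using compactly_supported_prob_common_compact[OF \<mu> \<nu>] .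
  interpret \<mu>: prob_space \<mu> using compactly_supported_probD[OF \<mu>] by simp
  interpret \<nu>: prob_space \<nu> using compactly_supported_probD[OF \<nu>] by simp
  note int\<mu> = integrable_continuous_AE_compact[OF \<mu> K(1,2)]
  note int\<nu> = integrable_continuous_AE_compact[OF \<nu> K(1,3)]
  define h where "h x = exp (- (t * (norm x)\<^sup>2))" for x :: "real^2"
  have h_cont: "continuous_on UNIV h" unfolding h_def by (intro continuous_intros)
  have h01: "0 < h x" "h x \<le> 1" for x using t by (auto simp: h_def)
  have exp_eq: "(LINT x|\<mu>. exp (x \<bullet> w) * h x) = (LINT x|\<nu>. exp (x \<bullet> w) * h x)" for w
  proof -
    \<comment> \<open>Completing the square: the exponent \<open>x \<bullet> w - t |x|\<^sup>2\<close> is maximal at \<open>z\<close>.\<close>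
    define z where "z = (1 / (2 * t)) *\<^sub>R w"
    have "exp (x \<bullet> w) * h x = exp (t * (norm z)\<^sup>2) * exp (- (t * (norm (x - z))\<^sup>2))" for x
    proof -
      have "x \<bullet> w - t * (norm x)\<^sup>2 = t * (norm z)\<^sup>2 - t * (norm (x - z))\<^sup>2"
        using t unfolding power2_norm_eq_inner z_def
        by (simp add: inner_diff_left inner_diff_right inner_commute algebra_simps)
      then show ?thesis by (simp add: h_def exp_add[symmetric])
    qed
    then show ?thesis using eq[of z] by simp
  qed
  have span_eq: "(LINT x|\<mu>. f x * h x) = (LINT x|\<nu>. f x * h x)" if "f \<in> exp_span" for f
    using that
  proof induction
    case (exp_span_exp c w) then show ?case using exp_eq[of w] by (simp add: mult.assoc)
  next
    case (exp_span_add f g)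
    have c: "continuous_on UNIV (\<lambda>x. f x * h x)" "continuous_on UNIV (\<lambda>x. g x * h x)"
      using exp_span_add.hyps exp_span_continuous h_cont by (auto intro!: continuous_intros)
    show ?case unfolding distrib_right
      using exp_span_add.IH int\<mu>[OF c(1)] int\<mu>[OF c(2)] int\<nu>[OF c(1)] int\<nu>[OF c(2)] by simp
  qed
  interpret function_ring_on exp_span K by (rule function_ring_exp_span[OF K(1)])
  have "\<bar>(LINT x|\<mu>. F x) - (LINT x|\<nu>. F x)\<bar> \<le> 2 * e" if e: "e > 0" for e
  proof -
    have Fh: "continuous_on UNIV (\<lambda>x. F x / h x)"
      using F h_cont h01 by (intro continuous_intros) (auto simp: less_imp_neq[symmetric])
    obtain f where f: "f \<in> exp_span" "\<And>x. x \<in> K \<Longrightarrow> \<bar>F x / h x - f x\<bar> < e"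
      using Stone_Weierstrass_basic[OF continuous_on_subset[OF Fh] e] by auto
    have fh: "continuous_on UNIV (\<lambda>x. f x * h x)"
      using exp_span_continuous[OF f(1)] h_cont by (intro continuous_intros)
    have close: "\<bar>F x - f x * h x\<bar> \<le> e" if "x \<in> K" for x
    proof -
      have "\<bar>F x - f x * h x\<bar> = \<bar>F x / h x - f x\<bar> * h x"
        using h01[of x] by (simp add: abs_mult[symmetric] field_simps abs_if)
      also have "\<dots> \<le> e * 1" using f(2)[OF that] h01[of x] by (intro mult_mono) auto
      finally show ?thesis by simp
    qed
    have "\<bar>(LINT x|\<rho>. F x) - (LINT x|\<rho>. f x * h x)\<bar> \<le> e" 
      if \<rho>: "prob_space \<rho>" "integrable \<rho> F" "integrable \<rho> (\<lambda>x. f x * h x)" "AE x in \<rho>. x \<in> K" for \<rho>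
    proof -
      interpret \<rho>: prob_space \<rho> by fact
      have "\<bar>(LINT x|\<rho>. F x) - (LINT x|\<rho>. f x * h x)\<bar> = \<bar>LINT x|\<rho>. F x - f x * h x\<bar>"
        using \<rho> by simp
      also have "\<dots> \<le> (LINT x|\<rho>. \<bar>F x - f x * h x\<bar>)" by (rule integral_abs_bound)
      also have "\<dots> \<le> (LINT x|\<rho>. e)"
        using \<rho> close by (intro integral_mono_AE) auto
      finally show ?thesis by (simp add: \<rho>.prob_space)
    qed
    from this[OF \<mu>.prob_space_axioms int\<mu>[OF F] int\<mu>[OF fh] K(2)]
      this[OF \<nu>.prob_space_axioms int\<nu>[OF F] int\<nu>[OF fh] K(3)] span_eq[OF f(1)]
    show ?thesis by linarith
  qed
  from this[of "\<bar>(LINT x|\<mu>. F x) - (LINT x|\<nu>. F x)\<bar> / 4"] show "(LINT x|\<mu>. F x) = (LINT x|\<nu>. F x)"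
    by (cases "(LINT x|\<mu>. F x) = (LINT x|\<nu>. F x)") auto
qed

section \<open>Gaussian kernels are definite\<close>

definition gaussian_kernel :: "real \<Rightarrow> real^2 \<Rightarrow> ennreal" where
  "gaussian_kernel t x = ennreal (exp (- (t * (norm x)\<^sup>2)))"

lemma gaussian_kernel_measurable [measurable]: "(\<lambda>p. gaussian_kernel (fst p) (snd p)) \<in> borel_measurable (borel \<Otimes>\<^sub>M borel)"
  unfolding gaussian_kernel_def by measurable

lemma gaussian_kernel_measurable_snd [measurable]: "gaussian_kernel t \<in> borel_measurable borel"
  unfolding gaussian_kernel_def by measurable

text \<open>
  The parallelogram law for \<open>x - z\<close> and \<open>y - z\<close>. It writes a Gaussian in \<open>x - y\<close> as the
  integral over \<open>z\<close> of a product of nonnegative functions of \<open>x\<close> and of \<open>y\<close>.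
\<close>

lemma gaussian_kernel_factorization:
  fixes x y z :: "real^2"
  shows "exp (- (2 * t * (norm (x - z))\<^sup>2)) * exp (- (2 * t * (norm (y - z))\<^sup>2))
    = exp (- (t * (norm (x - y))\<^sup>2)) * exp (- (4 * t * (norm (z - (1/2) *\<^sub>R (x + y)))\<^sup>2))"
proof -
  have "2 * (norm (x - z))\<^sup>2 + 2 * (norm (y - z))\<^sup>2 = (norm (x - y))\<^sup>2 + 4 * (norm (z - (1/2) *\<^sub>R (x + y)))\<^sup>2"
    unfolding power2_norm_eq_inner
    by (simp add: inner_diff_left inner_diff_right inner_add_left inner_add_right inner_commute algebra_simps)
  then have "t * (2 * (norm (x - z))\<^sup>2 + 2 * (norm (y - z))\<^sup>2) = t * ((norm (x - y))\<^sup>2 + 4 * (norm (z - (1/2) *\<^sub>R (x + y)))\<^sup>2)"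
    by simp
  then show ?thesis by (simp add: exp_add[symmetric] algebra_simps)
qed

text \<open>
  Up to a positive constant the Gaussian mutual energy is the \<open>L\<^sup>2\<close> inner product of the Gaussian averages
  of the two measures. This is the source of all positivity below.
\<close>

lemma gaussian_kernel_mutual_energy:
  assumes \<mu>: "compactly_supported_prob \<mu>" and \<nu>: "compactly_supported_prob \<nu>"
  shows "mutual_energy (gaussian_kernel t) \<mu> \<nu> * (\<integral>\<^sup>+z. gaussian_kernel (4 * t) z \<partial>lborel)
    = (\<integral>\<^sup>+z. (\<integral>\<^sup>+x. gaussian_kernel (2 * t) (x - z) \<partial>\<mu>) * (\<integral>\<^sup>+y. gaussian_kernel (2 * t) (y - z) \<partial>\<nu>) \<partial>lborel)"
proof -
  note D = compactly_supported_probD[OF \<mu>] compactly_supported_probD[OF \<nu>]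
  interpret \<mu>: prob_space \<mu> by fact
  interpret \<nu>: prob_space \<nu> by fact
  note [measurable_cong] = D(3) D(7)
  interpret P: pair_sigma_finite \<mu> "lborel :: (real^2) measure" by unfold_locales
  interpret Q: pair_sigma_finite \<nu> "lborel :: (real^2) measure" by unfold_locales
  let ?G = "gaussian_kernel (2 * t)"
  have gm[measurable]: "(\<lambda>p. ?G (fst p - snd p)) \<in> borel_measurable (borel \<Otimes>\<^sub>M borel)" by measurable
  have shift: "(\<integral>\<^sup>+z. gaussian_kernel (4 * t) (z - w) \<partial>lborel) = (\<integral>\<^sup>+z. gaussian_kernel (4 * t) z \<partial>lborel)" for w
  proof -
    have "(\<integral>\<^sup>+z. gaussian_kernel (4 * t) z \<partial>lborel) = (\<integral>\<^sup>+z. gaussian_kernel (4 * t) z \<partial>(distr lborel borel ((+) (- w))))"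
      by (simp only: lborel_distr_plus)
    also have "\<dots> = (\<integral>\<^sup>+z. gaussian_kernel (4 * t) (- w + z) \<partial>lborel)"
      by (subst nn_integral_distr) auto
    finally show ?thesis by simp
  qed
  have "(\<integral>\<^sup>+z. (\<integral>\<^sup>+x. ?G (x - z) \<partial>\<mu>) * (\<integral>\<^sup>+y. ?G (y - z) \<partial>\<nu>) \<partial>lborel)
    = (\<integral>\<^sup>+z. \<integral>\<^sup>+x. \<integral>\<^sup>+y. ?G (x - z) * ?G (y - z) \<partial>\<nu> \<partial>\<mu> \<partial>lborel)"
    by (simp add: nn_integral_cmult nn_integral_multc)
  also have "\<dots> = (\<integral>\<^sup>+x. \<integral>\<^sup>+z. \<integral>\<^sup>+y. ?G (x - z) * ?G (y - z) \<partial>\<nu> \<partial>lborel \<partial>\<mu>)"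
    by (rule P.Fubini') measurable
  also have "\<dots> = (\<integral>\<^sup>+x. \<integral>\<^sup>+y. \<integral>\<^sup>+z. ?G (x - z) * ?G (y - z) \<partial>lborel \<partial>\<nu> \<partial>\<mu>)"
    by (intro nn_integral_cong Q.Fubini') measurable
  also have "\<dots> = (\<integral>\<^sup>+x. \<integral>\<^sup>+y. gaussian_kernel t (x - y) * (\<integral>\<^sup>+z. gaussian_kernel (4 * t) z \<partial>lborel) \<partial>\<nu> \<partial>\<mu>)"
  proof (intro nn_integral_cong)
    fix x y
    have "(\<integral>\<^sup>+z. ?G (x - z) * ?G (y - z) \<partial>lborel) = (\<integral>\<^sup>+z. gaussian_kernel t (x - y) * gaussian_kernel (4 * t) (z - (1/2) *\<^sub>R (x + y)) \<partial>lborel)"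
      unfolding gaussian_kernel_def ennreal_mult[symmetric, OF exp_ge_zero exp_ge_zero] gaussian_kernel_factorization ..
    also have "\<dots> = gaussian_kernel t (x - y) * (\<integral>\<^sup>+z. gaussian_kernel (4 * t) (z - (1/2) *\<^sub>R (x + y)) \<partial>lborel)"
      by (rule nn_integral_cmult) measurable
    finally show "(\<integral>\<^sup>+z. ?G (x - z) * ?G (y - z) \<partial>lborel) = gaussian_kernel t (x - y) * (\<integral>\<^sup>+z. gaussian_kernel (4 * t) z \<partial>lborel)"
      by (simp only: shift)
  qed
  finally show ?thesis
    by (simp add: mutual_energy_def nn_integral_multc)
qed

lemma gaussian_kernel_nn_integral:
  assumes "t > 0"
  shows "0 < (\<integral>\<^sup>+z. gaussian_kernel t z \<partial>lborel)" "(\<integral>\<^sup>+z. gaussian_kernel t z \<partial>lborel) < \<infinity>"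
proof -
  have "\<not> (AE z in (lborel :: (real^2) measure). gaussian_kernel t z = 0)"
  proof
    assume "AE z in (lborel :: (real^2) measure). gaussian_kernel t z = 0"
    then have "AE z in (lborel :: (real^2) measure). False" by eventually_elim (auto simp: gaussian_kernel_def)
    then have "(\<exists>N::(real^2) set. N \<in> null_sets lborel \<and> UNIV \<subseteq> N)" by (auto simp: eventually_ae_filter)
    then show False by (auto simp: top.extremum_unique)
  qed
  then show "0 < (\<integral>\<^sup>+z. gaussian_kernel t z \<partial>lborel)"
    by (simp add: nn_integral_0_iff_AE zero_less_iff_neq_zero)
  show "(\<integral>\<^sup>+z. gaussian_kernel t z \<partial>lborel) < \<infinity>"
    using integrable_gaussian[OF assms] unfolding gaussian_kernel_def integrable_iff_bounded by simp
qed

lemma ennreal_amgm: 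
  assumes "0 \<le> a" "0 \<le> b"
  shows "ennreal a * ennreal b + ennreal b * ennreal a + ennreal ((a - b)\<^sup>2) = ennreal a * ennreal a + ennreal b * ennreal b"
proof -
  have "ennreal a * ennreal b + ennreal b * ennreal a + ennreal ((a - b)\<^sup>2) = ennreal (a * b + b * a + (a - b)\<^sup>2)"
    using assms by (simp add: ennreal_mult mult.commute flip: mult_2)
  also have "a * b + b * a + (a - b)\<^sup>2 = a * a + b * b" by (simp add: power2_eq_square algebra_simps)
  finally show ?thesis using assms by (simp add: ennreal_mult)
qed

lemma gaussian_average:
  assumes \<mu>: "compactly_supported_prob \<mu>" and t: "t > 0"
  shows "(\<integral>\<^sup>+x. gaussian_kernel t (x - z) \<partial>\<mu>) = ennreal (LINT x|\<mu>. exp (- (t * (norm (x - z))\<^sup>2)))"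
    and "continuous_on UNIV (\<lambda>z. LINT x|\<mu>. exp (- (t * (norm (x - z))\<^sup>2)))"
proof -
  note D = compactly_supported_probD[OF \<mu>]
  interpret \<mu>: prob_space \<mu> by fact
  note [measurable_cong] = D(3)
  have i: "integrable \<mu> (\<lambda>x. exp (- (t * (norm (x - z))\<^sup>2)))" for z
    using t by (intro \<mu>.integrable_const_bound[of _ 1]) auto
  show "(\<integral>\<^sup>+x. gaussian_kernel t (x - z) \<partial>\<mu>) = ennreal (LINT x|\<mu>. exp (- (t * (norm (x - z))\<^sup>2)))"
    unfolding gaussian_kernel_def by (rule nn_integral_eq_integral[OF i]) auto
  show "continuous_on UNIV (\<lambda>z. LINT x|\<mu>. exp (- (t * (norm (x - z))\<^sup>2)))"
    unfolding continuous_on_sequentially comp_def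
  proof safe
    fix X and z :: "real^2" assume X: "X \<longlonglongrightarrow> z"
    show "(\<lambda>n. LINT x|\<mu>. exp (- (t * (norm (x - X n))\<^sup>2))) \<longlonglongrightarrow> (LINT x|\<mu>. exp (- (t * (norm (x - z))\<^sup>2)))"
      using t by (intro integral_dominated_convergence[where w="\<lambda>_. 1"]) (auto intro!: tendsto_intros X)
  qed
qed

text \<open>
  With \<open>u\<close> and \<open>v\<close> the Gaussian averages of \<open>\<mu>\<close> and \<open>\<nu>\<close>, the difference of the two sides is a
  positive multiple of the integral of \<open>(u - v)\<^sup>2\<close>. If it vanishes, then \<open>u = v\<close> almost everywhere, hence everywhere by continuity, and the
  averages determine the measures.
\<close>

lemma gaussian_kernel_energy:
  assumes \<mu>: "compactly_supported_prob \<mu>" and \<nu>: "compactly_supported_prob \<nu>" and t: "t > 0"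
  shows "mutual_energy (gaussian_kernel t) \<mu> \<nu> + mutual_energy (gaussian_kernel t) \<nu> \<mu>
      \<le> mutual_energy (gaussian_kernel t) \<mu> \<mu> + mutual_energy (gaussian_kernel t) \<nu> \<nu>" (is "?L \<le> ?R")
    and "\<mu> \<noteq> \<nu> \<Longrightarrow> mutual_energy (gaussian_kernel t) \<mu> \<nu> + mutual_energy (gaussian_kernel t) \<nu> \<mu>
      < mutual_energy (gaussian_kernel t) \<mu> \<mu> + mutual_energy (gaussian_kernel t) \<nu> \<nu>"
proof -
  let ?C = "\<integral>\<^sup>+z. gaussian_kernel (4 * t) z \<partial>lborel"
  define u where "u z = (LINT x|\<mu>. exp (- (2 * t * (norm (x - z))\<^sup>2)))" for z
  define v where "v z = (LINT x|\<nu>. exp (- (2 * t * (norm (x - z))\<^sup>2)))" for z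
  have t2: "2 * t > 0" using t by simp
  have U: "(\<integral>\<^sup>+x. gaussian_kernel (2 * t) (x - z) \<partial>\<mu>) = ennreal (u z)"
    and V: "(\<integral>\<^sup>+x. gaussian_kernel (2 * t) (x - z) \<partial>\<nu>) = ennreal (v z)" for z
    using gaussian_average(1)[OF \<mu> t2] gaussian_average(1)[OF \<nu> t2] by (simp_all add: u_def v_def)
  have cont: "continuous_on UNIV u" "continuous_on UNIV v"
    using gaussian_average(2)[OF \<mu> t2] gaussian_average(2)[OF \<nu> t2] by (simp_all add: u_def[abs_def] v_def[abs_def])
  have [measurable]: "u \<in> borel_measurable borel" "v \<in> borel_measurable borel"
    using cont by (auto intro: borel_measurable_continuous_onI)
  have nn: "0 \<le> u z" "0 \<le> v z" for z by (auto simp: u_def v_def)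
  let ?D = "\<integral>\<^sup>+z. ennreal ((u z - v z)\<^sup>2) \<partial>lborel"
  have fact_C: "?L * ?C + ?D = ?R * ?C"
    unfolding distrib_right gaussian_kernel_mutual_energy[OF \<mu> \<mu>] gaussian_kernel_mutual_energy[OF \<mu> \<nu>]
      gaussian_kernel_mutual_energy[OF \<nu> \<mu>] gaussian_kernel_mutual_energy[OF \<nu> \<nu>] U V
    by (simp add: nn_integral_add[symmetric] ennreal_amgm nn)
  have C: "0 < ?C" "?C < \<infinity>" using gaussian_kernel_nn_integral[of "4 * t"] t by auto
  have fin: "?R < \<infinity>"
  proof -
    have "mutual_energy (gaussian_kernel t) \<rho> \<rho> \<le> 1" if "compactly_supported_prob \<rho>" for \<rho>
    proof -
      interpret \<rho>: prob_space \<rho> using compactly_supported_probD[OF that] by simp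
      have "mutual_energy (gaussian_kernel t) \<rho> \<rho> \<le> (\<integral>\<^sup>+x. \<integral>\<^sup>+y. 1 \<partial>\<rho> \<partial>\<rho>)"
        unfolding mutual_energy_def gaussian_kernel_def using t by (intro nn_integral_mono) auto
      then show ?thesis by (simp add: \<rho>.emeasure_space_1)
    qed
    from this[OF \<mu>] this[OF \<nu>] have "?R \<le> 1 + 1" by (rule add_mono)
    then show ?thesis by (auto simp: less_top[symmetric] top_unique)
  qed
  have le: "?L * ?C \<le> ?R * ?C" unfolding fact_C[symmetric] by simp
  then show le': "?L \<le> ?R"
    using C ennreal_mult_le_mult_iff[of ?C ?L ?R] by (auto simp only: mult.commute[of _ ?C] zero_less_iff_neq_zero infinity_ennreal_def less_top)
  show "?L < ?R" if "\<mu> \<noteq> \<nu>"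
  proof (rule ccontr)
    assume "\<not> ?L < ?R"
    then have LR: "?L = ?R" using le' by simp
    have "?R * ?C < \<infinity>" using fin C by (simp add: ennreal_mult_less_top)
    then have "?L * ?C \<noteq> \<infinity>" using LR by auto
    moreover have "?L * ?C + ?D = ?L * ?C + 0" using fact_C unfolding LR by simp
    ultimately have "?D = 0" unfolding ennreal_add_left_cancel by blast
    then have "AE z in lborel. ennreal ((u z - v z)\<^sup>2) = 0"
      by (subst (asm) nn_integral_0_iff_AE) auto
    then have ae: "AE z in lborel. z \<in> {z. u z = v z}" by eventually_elim auto
    have cl: "closed {z. u z = v z}" using cont by (intro closed_Collect_eq)
    have "u z = v z" for z
      using mem_closed_if_AE_lebesgue[OF cl, of z] AE_completion[OF ae] by blast
    then have "\<mu> = \<nu>" by (intro measure_eq_if_gaussian_averages_eq[OF \<mu> \<nu> t2]) (simp add: u_def v_def)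
    then show False using that by simp
  qed
qed

section \<open>Riesz kernels are definite\<close>

lemma singular_kernel_measurable [measurable]:
  assumes [measurable]: "W \<in> borel_measurable borel"
  shows "singular_kernel W \<in> borel_measurable borel"
  unfolding singular_kernel_def by measurable

lemma nn_integral_Gamma_scaled:
  fixes a c :: real
  assumes a: "a > 0" and c: "c > 0"
  shows "(\<integral>\<^sup>+t. ennreal (indicator {0<..} t * t powr (a - 1) * exp (- (t * c))) \<partial>lborel) = ennreal (Gamma a * c powr (- a))"
proof -
  let ?I = "\<integral>\<^sup>+t. ennreal (indicator {0<..} t * t powr (a - 1) * exp (- (t * c))) \<partial>lborel"
  have "ennreal (Gamma a) = (\<integral>\<^sup>+t. ennreal (indicator {0..} t * t powr (a - 1) / exp t) \<partial>lborel)"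
    by (rule Gamma_conv_nn_integral_real[OF a])
  also have "\<dots> = ennreal \<bar>c\<bar> * (\<integral>\<^sup>+t. ennreal (indicator {0..} (0 + c * t) * (0 + c * t) powr (a - 1) / exp (0 + c * t)) \<partial>lborel)"
    using c by (intro nn_integral_real_affine) auto
  also have "(\<integral>\<^sup>+t. ennreal (indicator {0..} (0 + c * t) * (0 + c * t) powr (a - 1) / exp (0 + c * t)) \<partial>lborel)
     = (\<integral>\<^sup>+t. ennreal (c powr (a - 1)) * ennreal (indicator {0<..} t * t powr (a - 1) * exp (- (t * c))) \<partial>lborel)"
    using c by (intro nn_integral_cong)
      (auto simp: indicator_def ennreal_mult[symmetric] powr_mult exp_minus field_simps zero_le_mult_iff)
  also have "\<dots> = ennreal (c powr (a - 1)) * ?I" by (rule nn_integral_cmult) auto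
  also have "ennreal \<bar>c\<bar> * \<dots> = ennreal (c powr a) * ?I"
    using c by (simp add: mult.assoc[symmetric] ennreal_mult[symmetric] powr_mult_base)
  finally have G: "ennreal (Gamma a) = ennreal (c powr a) * ?I" .
  have "ennreal (Gamma a * c powr (- a)) = ennreal (c powr (-a)) * ennreal (Gamma a)"
    using a by (simp add: ennreal_mult[symmetric] Gamma_real_nonneg mult.commute)
  also have "\<dots> = ennreal (c powr (-a) * c powr a) * ?I"
    unfolding G by (simp add: ennreal_mult mult.assoc)
  also have "c powr (-a) * c powr a = 1" using c by (simp add: powr_minus)
  finally show ?thesis by simp
qed

text \<open>
  The integral dominates \<open>\<Gamma>(a) c^{-a}\<close> for every \<open>c > 0\<close>.
\<close>

lemma nn_integral_powr_infinite:
  fixes a :: real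
  assumes a: "a > 0"
  shows "(\<integral>\<^sup>+t. ennreal (indicator {0<..} t * t powr (a - 1)) \<partial>lborel) = \<infinity>" (is "?I = _")
proof (rule ccontr)
  assume "?I \<noteq> \<infinity>"
  then obtain r where r: "r \<ge> 0" "?I = ennreal r" by (cases ?I) (auto simp: top_ennreal.rep_eq)
  \<comment> \<open>The solution of \<open>Gamma a * c powr (- a) = r + 1\<close>.\<close>
  define c where "c = ((r + 1) / Gamma a) powr (- 1 / a)"
  have G: "Gamma a > 0" using a by (rule Gamma_real_pos)
  have c: "c > 0" using r G by (simp add: c_def)
  have "c powr (- a) = (r + 1) / Gamma a" using r G a by (simp add: c_def powr_powr)
  then have "ennreal (r + 1) = (\<integral>\<^sup>+t. ennreal (indicator {0<..} t * t powr (a - 1) * exp (- (t * c))) \<partial>lborel)"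
    using nn_integral_Gamma_scaled[OF a c] G by simp
  also have "\<dots> \<le> ?I" using c by (intro nn_integral_mono) (auto simp: indicator_def)
  finally show False using r by simp
qed

text \<open>
  The identity includes \<open>x = 0\<close>, where both sides are infinite. This is essential for measures that may
  charge the diagonal.
\<close>

lemma riesz_gaussian_mixture:
  fixes s :: real
  assumes s: "s > 0"
  shows "(\<integral>\<^sup>+t. ennreal (indicator {0<..} t * t powr (s / 2 - 1)) * gaussian_kernel t x \<partial>lborel)
     = ennreal (Gamma (s / 2)) * singular_kernel (\<lambda>x. norm x powr (- s)) x"
proof (cases "x = 0")
  case True
  have "Gamma (s / 2) > 0" using s by (intro Gamma_real_pos) simp
  then show ?thesis using nn_integral_powr_infinite[of "s / 2"] s True
    by (simp add: gaussian_kernel_def singular_kernel_def ennreal_mult_top less_imp_neq[symmetric])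
next
  case False
  have "((norm x)\<^sup>2) powr (- (s / 2)) = norm x powr (- s)"
    using False by (simp add: powr_powr flip: powr_numeral)
  then show ?thesis using nn_integral_Gamma_scaled[of "s / 2" "(norm x)\<^sup>2"] s False
    by (simp add: gaussian_kernel_def singular_kernel_def ennreal_mult[symmetric] Gamma_real_nonneg)
qed

lemma mutual_energy_mixture:
  assumes \<mu>: "compactly_supported_prob \<mu>" and \<nu>: "compactly_supported_prob \<nu>" and M: "sigma_finite_measure M"
    and [measurable]: "(\<lambda>p. k (fst p) (snd p)) \<in> borel_measurable (M \<Otimes>\<^sub>M borel)"
  shows "mutual_energy (\<lambda>x. \<integral>\<^sup>+\<alpha>. k \<alpha> x \<partial>M) \<mu> \<nu> = (\<integral>\<^sup>+\<alpha>. mutual_energy (k \<alpha>) \<mu> \<nu> \<partial>M)"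
    and "(\<lambda>\<alpha>. mutual_energy (k \<alpha>) \<mu> \<nu>) \<in> borel_measurable M"
proof -
  note D = compactly_supported_probD[OF \<mu>] compactly_supported_probD[OF \<nu>]
  interpret \<mu>: prob_space \<mu> by fact
  interpret \<nu>: prob_space \<nu> by fact
  interpret M: sigma_finite_measure M by fact
  note [measurable_cong] = D(3) D(7)
  interpret P: pair_sigma_finite \<mu> M by unfold_locales
  interpret Q: pair_sigma_finite \<nu> M by unfold_locales
  have [measurable (raw)]: "(\<lambda>p. k (g p) (h p)) \<in> borel_measurable N" if "g \<in> measurable N M" "h \<in> measurable N borel" for g h N
    using measurable_compose[OF measurable_Pair[OF that] assms(4)] by simp
  have "mutual_energy (\<lambda>x. \<integral>\<^sup>+\<alpha>. k \<alpha> x \<partial>M) \<mu> \<nu> = (\<integral>\<^sup>+x. \<integral>\<^sup>+\<alpha>. \<integral>\<^sup>+y. k \<alpha> (x - y) \<partial>\<nu> \<partial>M \<partial>\<mu>)"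
    unfolding mutual_energy_def by (intro nn_integral_cong Q.Fubini'[symmetric]) measurable
  also have "\<dots> = (\<integral>\<^sup>+\<alpha>. mutual_energy (k \<alpha>) \<mu> \<nu> \<partial>M)"
    unfolding mutual_energy_def by (intro P.Fubini'[symmetric]) measurable
  finally show "mutual_energy (\<lambda>x. \<integral>\<^sup>+\<alpha>. k \<alpha> x \<partial>M) \<mu> \<nu> = (\<integral>\<^sup>+\<alpha>. mutual_energy (k \<alpha>) \<mu> \<nu> \<partial>M)" .
  show "(\<lambda>\<alpha>. mutual_energy (k \<alpha>) \<mu> \<nu>) \<in> borel_measurable M"
    unfolding mutual_energy_def by measurable
qed

section \<open>Operations that preserve positivity of the energy\<close>

lemma mutual_energy_cmult:
  assumes \<mu>: "compactly_supported_prob \<mu>" and \<nu>: "compactly_supported_prob \<nu>" and [measurable]: "k \<in> borel_measurable borel"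
  shows "mutual_energy (\<lambda>x. c * k x) \<mu> \<nu> = c * mutual_energy k \<mu> \<nu>"
proof -
  note D = compactly_supported_probD[OF \<mu>] compactly_supported_probD[OF \<nu>]
  interpret \<nu>: prob_space \<nu> by fact
  note [measurable_cong] = D(3) D(7)
  show ?thesis unfolding mutual_energy_def
    by (subst nn_integral_cmult[symmetric]; (measurable; fail)?) (intro nn_integral_cong nn_integral_cmult; measurable)
qed

lemma mutual_energy_add:
  assumes \<mu>: "compactly_supported_prob \<mu>" and \<nu>: "compactly_supported_prob \<nu>"
    and [measurable]: "k \<in> borel_measurable borel" "k' \<in> borel_measurable borel"
  shows "mutual_energy (\<lambda>x. k x + k' x) \<mu> \<nu> = mutual_energy k \<mu> \<nu> + mutual_energy k' \<mu> \<nu>"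
proof -
  note D = compactly_supported_probD[OF \<mu>] compactly_supported_probD[OF \<nu>]
  interpret \<nu>: prob_space \<nu> by fact
  note [measurable_cong] = D(3) D(7)
  show ?thesis unfolding mutual_energy_def
    by (subst nn_integral_add[symmetric]; (measurable; fail)?) (intro nn_integral_cong nn_integral_add; measurable)
qed

lemma mutual_energy_mono: "(\<And>x. k x \<le> k' x) \<Longrightarrow> mutual_energy k \<mu> \<nu> \<le> mutual_energy k' \<mu> \<nu>"
  unfolding mutual_energy_def by (intro nn_integral_mono)

lemma energy_positive_cmult:
  assumes "energy_positive k" "k \<in> borel_measurable borel"
  shows "energy_positive (\<lambda>x. c * k x)"
  using assms unfolding energy_positive_def
  by (auto simp: mutual_energy_cmult distrib_left[symmetric] intro!: mult_left_mono)

lemma energy_positive_mixture: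
  assumes M: "sigma_finite_measure M" and k: "(\<lambda>p. k (fst p) (snd p)) \<in> borel_measurable (M \<Otimes>\<^sub>M borel)"
    and pos: "\<And>\<alpha>. energy_positive (k \<alpha>)"
  shows "energy_positive (\<lambda>x. \<integral>\<^sup>+\<alpha>. k \<alpha> x \<partial>M)"
  unfolding energy_positive_def
proof (intro allI impI)
  fix \<mu> \<nu> :: "(real^2) measure" assume \<mu>: "compactly_supported_prob \<mu>" and \<nu>: "compactly_supported_prob \<nu>"
  note m = mutual_energy_mixture[OF \<mu> \<nu> M k] mutual_energy_mixture[OF \<nu> \<mu> M k]
    mutual_energy_mixture[OF \<mu> \<mu> M k] mutual_energy_mixture[OF \<nu> \<nu> M k]
  show "mutual_energy (\<lambda>x. \<integral>\<^sup>+\<alpha>. k \<alpha> x \<partial>M) \<mu> \<nu> + mutual_energy (\<lambda>x. \<integral>\<^sup>+\<alpha>. k \<alpha> x \<partial>M) \<nu> \<mu>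
    \<le> mutual_energy (\<lambda>x. \<integral>\<^sup>+\<alpha>. k \<alpha> x \<partial>M) \<mu> \<mu> + mutual_energy (\<lambda>x. \<integral>\<^sup>+\<alpha>. k \<alpha> x \<partial>M) \<nu> \<nu>"
    unfolding m(1,3,5,7) nn_integral_add[OF m(2,4), symmetric] nn_integral_add[OF m(6,8), symmetric]
    using pos \<mu> \<nu> by (intro nn_integral_mono) (auto simp: energy_positive_def)
qed

text \<open>
  Strict inequality holds for every Gaussian in the mixture, and integration over \<open>t\<close> keeps it strict
  because the larger side is finite.
\<close>

lemma energy_definite_riesz:
  fixes s :: real
  assumes s: "s > 0"
  shows "energy_definite (singular_kernel (\<lambda>x. norm x powr (- s)))"
  unfolding energy_definite_def
proof (intro allI impI)
  fix \<mu> \<nu> :: "(real^2) measure" assume \<mu>: "compactly_supported_prob \<mu>" and \<nu>: "compactly_supported_prob \<nu>" and ne: "\<mu> \<noteq> \<nu>"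
  let ?r = "singular_kernel (\<lambda>x. norm x powr (- s))"
  assume fin: "mutual_energy ?r \<mu> \<mu> + mutual_energy ?r \<nu> \<nu> < \<infinity>"
  define w where "w t = ennreal (indicator {0<..} t * t powr (s / 2 - 1))" for t
  have [measurable]: "w \<in> borel_measurable borel" unfolding w_def by measurable
  let ?G = "ennreal (Gamma (s / 2))"
  have G: "0 < ?G" "?G < \<infinity>" using s by (auto simp: Gamma_real_pos)
  define J where "J \<mu> \<nu> t = mutual_energy (gaussian_kernel t) \<mu> \<nu>" for \<mu> \<nu> t
  have km: "(\<lambda>p. w (fst p) * gaussian_kernel (fst p) (snd p)) \<in> borel_measurable (lborel \<Otimes>\<^sub>M borel)" by measurable
  have mix: "?G * mutual_energy ?r \<rho> \<tau> = (\<integral>\<^sup>+t. w t * J \<rho> \<tau> t \<partial>lborel)"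
    and meas: "(\<lambda>t. w t * J \<rho> \<tau> t) \<in> borel_measurable lborel"
    if \<rho>: "compactly_supported_prob \<rho>" and \<tau>: "compactly_supported_prob \<tau>" for \<rho> \<tau>
  proof -
    have "?G * mutual_energy ?r \<rho> \<tau> = mutual_energy (\<lambda>x. ?G * ?r x) \<rho> \<tau>"
      by (rule mutual_energy_cmult[OF \<rho> \<tau>, symmetric]) measurable
    also have "\<dots> = mutual_energy (\<lambda>x. \<integral>\<^sup>+t. w t * gaussian_kernel t x \<partial>lborel) \<rho> \<tau>"
      unfolding w_def riesz_gaussian_mixture[OF s] ..
    also have "\<dots> = (\<integral>\<^sup>+t. mutual_energy (\<lambda>x. w t * gaussian_kernel t x) \<rho> \<tau> \<partial>lborel)"
      by (rule mutual_energy_mixture(1)[OF \<rho> \<tau> sigma_finite_lborel km])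
    finally show "?G * mutual_energy ?r \<rho> \<tau> = (\<integral>\<^sup>+t. w t * J \<rho> \<tau> t \<partial>lborel)"
      by (simp add: mutual_energy_cmult[OF \<rho> \<tau>] J_def)
    show "(\<lambda>t. w t * J \<rho> \<tau> t) \<in> borel_measurable lborel"
      using mutual_energy_mixture(2)[OF \<rho> \<tau> sigma_finite_lborel km]
      by (simp add: mutual_energy_cmult[OF \<rho> \<tau>] J_def)
  qed
  note [measurable] = meas[OF \<mu> \<mu>] meas[OF \<mu> \<nu>] meas[OF \<nu> \<mu>] meas[OF \<nu> \<nu>]
  let ?L = "\<lambda>t. w t * J \<mu> \<nu> t + w t * J \<nu> \<mu> t" and ?R = "\<lambda>t. w t * J \<mu> \<mu> t + w t * J \<nu> \<nu> t"
  have RL: "?G * (mutual_energy ?r \<mu> \<mu> + mutual_energy ?r \<nu> \<nu>) = (\<integral>\<^sup>+t. ?R t \<partial>lborel)"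
    "?G * (mutual_energy ?r \<mu> \<nu> + mutual_energy ?r \<nu> \<mu>) = (\<integral>\<^sup>+t. ?L t \<partial>lborel)"
    by (simp_all add: distrib_left mix \<mu> \<nu> nn_integral_add)
  have le: "?L t \<le> ?R t" and less: "t > 0 \<Longrightarrow> ?L t < ?R t" for t
  proof -
    have "?L t < ?R t" if "t > 0"
    proof -
      have "0 < w t" "w t < top" using that by (auto simp: w_def)
      then show ?thesis unfolding distrib_left[symmetric] J_def
        using gaussian_kernel_energy(2)[OF \<mu> \<nu> that ne] by (simp add: ennreal_mult_strict_left_mono)
    qed
    then show "t > 0 \<Longrightarrow> ?L t < ?R t" "?L t \<le> ?R t" by (auto simp: w_def less_imp_le indicator_def)
  qed
  have Rfin: "(\<integral>\<^sup>+t. ?R t \<partial>lborel) < \<infinity>" unfolding RL(1)[symmetric] using fin G by (auto simp: ennreal_mult_less_top)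
  have "(\<integral>\<^sup>+t. ?L t \<partial>lborel) < (\<integral>\<^sup>+t. ?R t \<partial>lborel)"
  proof (rule nn_integral_less)
    have "(\<integral>\<^sup>+t. ?L t \<partial>lborel) \<le> (\<integral>\<^sup>+t. ?R t \<partial>lborel)" using le by (intro nn_integral_mono) auto
    then show "(\<integral>\<^sup>+t. ?L t \<partial>lborel) \<noteq> \<infinity>" using Rfin by auto
    show "\<not> (AE t in lborel. ?R t \<le> ?L t)"
    proof
      assume "AE t in lborel. ?R t \<le> ?L t"
      then have "AE t in lborel. t \<notin> {0::real<..}" by (rule eventually_mono) (meson greaterThan_iff leD less)
      then have "emeasure lborel {0::real<..} = 0" by (subst (asm) AE_iff_measurable[OF _ refl]) (auto simp: greaterThan_def)
      moreover have "emeasure lborel {0<..<1::real} \<le> emeasure lborel {0::real<..}" by (rule emeasure_mono) auto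
      ultimately show False by simp
    qed
  qed (use le in auto)
  then have "?G * (mutual_energy ?r \<mu> \<nu> + mutual_energy ?r \<nu> \<mu>) < ?G * (mutual_energy ?r \<mu> \<mu> + mutual_energy ?r \<nu> \<nu>)"
    unfolding RL .
  then show "mutual_energy ?r \<mu> \<nu> + mutual_energy ?r \<nu> \<mu> < mutual_energy ?r \<mu> \<mu> + mutual_energy ?r \<nu> \<nu>"
    by (meson leD leI mult_left_mono zero_le)
qed

lemma energy_positive_riesz: 
  fixes s :: real
  assumes s: "s > 0"
  shows "energy_positive (singular_kernel (\<lambda>x. norm x powr (- s)))" (is "energy_positive ?r")
  unfolding energy_positive_def
proof (intro allI impI)
  fix \<mu> \<nu> :: "(real^2) measure" assume "compactly_supported_prob \<mu>" "compactly_supported_prob \<nu>"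
  then show "mutual_energy ?r \<mu> \<nu> + mutual_energy ?r \<nu> \<mu> \<le> mutual_energy ?r \<mu> \<mu> + mutual_energy ?r \<nu> \<nu>"
    using energy_definite_riesz[OF s] unfolding energy_definite_def
    by (cases "\<mu> = \<nu>"; cases "mutual_energy ?r \<mu> \<mu> + mutual_energy ?r \<nu> \<nu> < \<infinity>")
       (auto simp: less_top[symmetric] less_imp_le)
qed

text \<open>
  The energy of \<open>k \<circ> A\<close> is the energy of \<open>k\<close> for the measures pushed forward by \<open>A\<close>.
\<close>

lemma energy_positive_linear:
  assumes A: "linear A" and k: "energy_positive k" and [measurable]: "k \<in> borel_measurable borel"
  shows "energy_positive (\<lambda>x. k (A x))"
  unfolding energy_positive_def
proof (intro allI impI)
  have cont: "continuous_on S A" for S using A by (intro linear_continuous_on) (simp add: linear_conv_bounded_linear)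
  have [measurable]: "A \<in> borel_measurable borel" using cont by (intro borel_measurable_continuous_onI)
  have push: "compactly_supported_prob (distr \<rho> borel A)" if \<rho>: "compactly_supported_prob \<rho>" for \<rho>
  proof -
    note D = compactly_supported_probD[OF \<rho>]
    interpret prob_space \<rho> by fact
    note [measurable_cong] = D(3)
    obtain K where K: "compact K" "emeasure \<rho> (- K) = 0" using \<rho> by (auto simp: compactly_supported_prob_def)
    have cK: "compact (A ` K)" using K(1) cont by (intro compact_continuous_image)
    have "emeasure (distr \<rho> borel A) (- (A ` K)) = emeasure \<rho> (A -` (- (A ` K)) \<inter> space \<rho>)"
      using cK by (intro emeasure_distr) (auto simp: compact_imp_closed)
    also have "\<dots> \<le> emeasure \<rho> (- K)"
      using K(1) by (intro emeasure_mono) (auto simp: D compact_imp_closed)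
    finally show ?thesis using K(2) cK by (auto simp: compactly_supported_prob_def intro!: prob_space_distr)
  qed
  have en: "mutual_energy (\<lambda>x. k (A x)) \<rho> \<tau> = mutual_energy k (distr \<rho> borel A) (distr \<tau> borel A)"
    if \<rho>: "compactly_supported_prob \<rho>" and \<tau>: "compactly_supported_prob \<tau>" for \<rho> \<tau>
  proof -
    note D = compactly_supported_probD[OF \<rho>] compactly_supported_probD[OF \<tau>]
    interpret \<tau>: prob_space \<tau> by fact
    note [measurable_cong] = D(3) D(7)
    show ?thesis unfolding mutual_energy_def by (simp add: nn_integral_distr linear_diff[OF A])
  qed
  fix \<mu> \<nu> :: "(real^2) measure" assume "compactly_supported_prob \<mu>" "compactly_supported_prob \<nu>"
  then show "mutual_energy (\<lambda>x. k (A x)) \<mu> \<nu> + mutual_energy (\<lambda>x. k (A x)) \<nu> \<mu>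
    \<le> mutual_energy (\<lambda>x. k (A x)) \<mu> \<mu> + mutual_energy (\<lambda>x. k (A x)) \<nu> \<nu>"
    using k push by (simp add: en energy_positive_def)
qed

text \<open>
  Approximation up to factors close to 1 is the right notion of limit here: it survives
  integration against any pair of measures, although the kernels are unbounded.
\<close>

lemma energy_positive_closure:
  assumes close: "\<And>\<delta>. 0 < \<delta> \<Longrightarrow> \<delta> < 1 \<Longrightarrow> \<exists>k'. energy_positive k' \<and> k' \<in> borel_measurable borel \<and>
      (\<forall>x. ennreal (1 - \<delta>) * k' x \<le> k x \<and> k x \<le> ennreal (1 + \<delta>) * k' x)"
  shows "energy_positive k"
  unfolding energy_positive_def
proof (intro allI impI)
  fix \<mu> \<nu> :: "(real^2) measure" assume \<mu>: "compactly_supported_prob \<mu>" and \<nu>: "compactly_supported_prob \<nu>"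
  define L where "L k = mutual_energy k \<mu> \<nu> + mutual_energy k \<nu> \<mu>" for k
  define R where "R k = mutual_energy k \<mu> \<mu> + mutual_energy k \<nu> \<nu>" for k
  have bound: "ennreal (1 - \<delta>) * L k \<le> ennreal (1 + \<delta>) * R k" if \<delta>: "0 < \<delta>" "\<delta> < 1" for \<delta>
  proof -
    obtain k' where k': "energy_positive k'" and m: "k' \<in> borel_measurable borel"
      and b: "\<And>x. ennreal (1 - \<delta>) * k' x \<le> k x" "\<And>x. k x \<le> ennreal (1 + \<delta>) * k' x" using close[OF \<delta>] by auto
    have "L k \<le> ennreal (1 + \<delta>) * L k'"
      unfolding L_def distrib_left mutual_energy_cmult[OF \<mu> \<nu> m, symmetric] mutual_energy_cmult[OF \<nu> \<mu> m, symmetric]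
      by (intro add_mono mutual_energy_mono b)
    moreover have le: "ennreal (1 - \<delta>) * R k' \<le> R k"
      unfolding R_def distrib_left mutual_energy_cmult[OF \<mu> \<mu> m, symmetric] mutual_energy_cmult[OF \<nu> \<nu> m, symmetric]
      by (intro add_mono mutual_energy_mono b)
    moreover have "L k' \<le> R k'" using k' \<mu> \<nu> by (simp add: energy_positive_def L_def R_def)
    ultimately have "L k \<le> ennreal (1 + \<delta>) * R k'" by (meson mult_left_mono order_trans zero_le)
    then have "ennreal (1 - \<delta>) * L k \<le> ennreal (1 - \<delta>) * (ennreal (1 + \<delta>) * R k')"
      by (intro mult_left_mono) auto
    also have "\<dots> = ennreal (1 + \<delta>) * (ennreal (1 - \<delta>) * R k')" by (simp add: mult_ac)
    also have "\<dots> \<le> ennreal (1 + \<delta>) * R k"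
      using le by (intro mult_left_mono) auto
    finally show ?thesis .
  qed
  show "L k \<le> R k"
  proof (cases "R k = \<infinity>")
    case False
    then obtain r where r: "r \<ge> 0" "R k = ennreal r" by (cases "R k") auto
    have "L k \<noteq> \<infinity>" using bound[of "1/2"] r by (auto simp: ennreal_mult_top ennreal_mult[symmetric] top_unique)
    then obtain l where l: "l \<ge> 0" "L k = ennreal l" by (cases "L k") auto
    have "(1 - \<delta>) * l \<le> (1 + \<delta>) * r" if "0 < \<delta>" "\<delta> < 1" for \<delta>
      using bound[OF that] that r l by (simp add: ennreal_mult[symmetric] del: ennreal_plus)
    then have "\<forall>\<^sub>F \<delta> in at_right 0. (1 - \<delta>) * l \<le> (1 + \<delta>) * r"
      by (auto simp: eventually_at_right_field intro!: exI[of _ 1])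
    moreover have "((\<lambda>\<delta>. (1 - \<delta>) * l) \<longlongrightarrow> (1 - 0) * l) (at_right 0)" "((\<lambda>\<delta>. (1 + \<delta>) * r) \<longlongrightarrow> (1 + 0) * r) (at_right 0)"
      by (intro tendsto_intros)+
    ultimately have "(1 - 0) * l \<le> (1 + 0) * r" by (intro tendsto_le[of "at_right (0::real)"]) auto
    then show ?thesis using r l by simp
  qed simp
qed

lemma energy_definite_add:
  assumes "energy_positive k" "energy_definite k'" and [measurable]: "k \<in> borel_measurable borel" "k' \<in> borel_measurable borel"
  shows "energy_definite (\<lambda>x. k x + k' x)"
  unfolding energy_definite_def
proof (intro allI impI)
  fix \<mu> \<nu> :: "(real^2) measure" assume \<mu>: "compactly_supported_prob \<mu>" and \<nu>: "compactly_supported_prob \<nu>" and ne: "\<mu> \<noteq> \<nu>"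
  note add = mutual_energy_add[OF \<mu> \<nu> assms(3,4)] mutual_energy_add[OF \<nu> \<mu> assms(3,4)]
    mutual_energy_add[OF \<mu> \<mu> assms(3,4)] mutual_energy_add[OF \<nu> \<nu> assms(3,4)]
  define a where "a = mutual_energy k \<mu> \<nu> + mutual_energy k \<nu> \<mu>"
  define b where "b = mutual_energy k \<mu> \<mu> + mutual_energy k \<nu> \<nu>"
  define c where "c = mutual_energy k' \<mu> \<nu> + mutual_energy k' \<nu> \<mu>"
  define d where "d = mutual_energy k' \<mu> \<mu> + mutual_energy k' \<nu> \<nu>"
  assume "mutual_energy (\<lambda>x. k x + k' x) \<mu> \<mu> + mutual_energy (\<lambda>x. k x + k' x) \<nu> \<nu> < \<infinity>"
  then have fin: "b < \<infinity>" "d < \<infinity>" by (auto simp: add b_def d_def)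
  have "a \<le> b" "c < d" using assms(1,2) \<mu> \<nu> ne fin(2)
    by (auto simp: energy_positive_def energy_definite_def a_def b_def c_def d_def)
  then have "a + c < b + d" using fin(1) by (metis add_left_mono add.commute ennreal_add_left_cancel_less infinity_ennreal_def le_less_trans less_irrefl)
  then show "mutual_energy (\<lambda>x. k x + k' x) \<mu> \<nu> + mutual_energy (\<lambda>x. k x + k' x) \<nu> \<mu>
      < mutual_energy (\<lambda>x. k x + k' x) \<mu> \<mu> + mutual_energy (\<lambda>x. k x + k' x) \<nu> \<nu>"
    by (simp add: add a_def b_def c_def d_def ac_simps)
qed

section \<open>Means over directions\<close>

text \<open>
  For an antiderivative \<open>G\<close>, the function \<open>c \<mapsto> G (c + p) - G c\<close> has derivative zero.
\<close>

lemma integral_periodic: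
  fixes f :: "real \<Rightarrow> real"
  assumes f: "continuous_on UNIV f" and per: "\<And>x. f (x + p) = f x" and p: "p \<ge> 0"
  shows "integral {a..a + p} f = integral {b..b + p} f"
proof -
  have "continuous (at x) f" for x using f by (simp add: continuous_on_eq_continuous_at)
  then obtain G where G: "\<And>x. (G has_vector_derivative f x) (at x)"
    using einterval_antiderivative[of "-\<infinity>" "\<infinity>" f] by auto
  have Gd: "(G has_real_derivative f x) (at x)" for x
    using G[of x] by (simp add: has_real_derivative_iff_has_vector_derivative)
  have int: "integral {c..c + p} f = G (c + p) - G c" for c
    using p by (intro integral_unique fundamental_theorem_of_calculus) (auto intro: has_vector_derivative_at_within G)
  have "((\<lambda>c. G (c + p) - G c) has_real_derivative (f (x + p) * 1 - f x)) (at x)" for x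
    by (auto intro!: derivative_eq_intros DERIV_chain2[OF Gd] Gd)
  then have "\<forall>x. DERIV (\<lambda>c. G (c + p) - G c) x :> 0" using per by simp
  then show ?thesis unfolding int by (rule DERIV_isconst_all)
qed

text \<open>
  The squared length of the image of a unit vector at angle \<open>\<beta>\<close> under \<open>diag(e, 1)\<close>. For small \<open>e\<close> it is
  small only near multiples of \<open>\<pi>\<close>.
\<close>

definition stretch_factor :: "real \<Rightarrow> real \<Rightarrow> real" where
  "stretch_factor e \<beta> = e\<^sup>2 * (cos \<beta>)\<^sup>2 + (sin \<beta>)\<^sup>2"

lemma stretch_factor_pos: "e > 0 \<Longrightarrow> stretch_factor e \<beta> > 0"
proof -
  assume e: "e > 0"
  show ?thesis
  proof (cases "sin \<beta> = 0")
    case True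
    then have "(cos \<beta>)\<^sup>2 = 1" using sin_cos_squared_add[of \<beta>] by simp
    then show ?thesis using e True by (simp add: stretch_factor_def)
  next
    case False
    then show ?thesis unfolding stretch_factor_def by (intro add_nonneg_pos) auto
  qed
qed

lemma stretch_factor_le_1: 
  assumes "0 < e" "e \<le> 1" shows "stretch_factor e \<beta> \<le> 1"
proof -
  have "e\<^sup>2 * (cos \<beta>)\<^sup>2 \<le> 1 * (cos \<beta>)\<^sup>2" using assms by (intro mult_right_mono) (auto simp: power_le_one)
  then show ?thesis using sin_cos_squared_add[of \<beta>] unfolding stretch_factor_def by linarith
qed

lemma stretch_factor_periodic: "stretch_factor e (\<beta> + pi) = stretch_factor e \<beta>" "stretch_factor e (\<beta> - pi) = stretch_factor e \<beta>"
  by (simp_all add: stretch_factor_def)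

lemma stretch_factor_minus: "stretch_factor e (- \<beta>) = stretch_factor e \<beta>"
  by (simp add: stretch_factor_def)

lemma stretch_factor_cont [continuous_intros]: "continuous_on S (g :: real \<Rightarrow> real) \<Longrightarrow> continuous_on S (\<lambda>x. stretch_factor e (g x))"
  unfolding stretch_factor_def by (auto intro!: continuous_intros)

lemma stretch_factor_powr_cont: "e > 0 \<Longrightarrow> continuous_on S (g :: real \<Rightarrow> real) \<Longrightarrow> continuous_on S (\<lambda>x. stretch_factor e (g x) powr r)"
  by (intro continuous_on_powr continuous_intros) (auto simp: stretch_factor_pos less_imp_neq[symmetric])

definition direction_mass :: "real \<Rightarrow> real \<Rightarrow> real" where
  "direction_mass e a = integral {0..pi} (\<lambda>\<alpha>. stretch_factor e \<alpha> powr (- a))"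

text \<open>
  The mean of \<open>f\<close> over directions against the \<open>\<pi>\<close>-periodic kernel \<open>stretch_factor e powr (- a)\<close>, normalized
  to total mass 1 over a period.
\<close>

definition direction_mean :: "real \<Rightarrow> real \<Rightarrow> (real \<Rightarrow> real) \<Rightarrow> real \<Rightarrow> real" where
  "direction_mean e a f \<theta> = integral {0..pi} (\<lambda>\<alpha>. f \<alpha> * stretch_factor e (\<theta> - \<alpha>) powr (- a)) / direction_mass e a"

text \<open>
  All functions involved have period \<open>\<pi>\<close>, so the convolution may be written with the singularity of the
  kernel in the middle of the interval.
\<close>

lemma direction_mean_numerator:
  fixes f :: "real \<Rightarrow> real"
  assumes e: "e > 0" and f: "continuous_on UNIV f" and per: "\<And>x. f (x + pi) = f x"
  shows "integral {0..pi} (\<lambda>\<alpha>. f \<alpha> * stretch_factor e (\<theta> - \<alpha>) powr (- a))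
     = integral {- (pi / 2)..pi / 2} (\<lambda>\<beta>. f (\<theta> - \<beta>) * stretch_factor e \<beta> powr (- a))"
proof -
  define g where "g \<alpha> = f \<alpha> * stretch_factor e (\<theta> - \<alpha>) powr (- a)" for \<alpha>
  have kper: "stretch_factor e (\<theta> - (x + pi)) = stretch_factor e (\<theta> - x)" for x
    using stretch_factor_periodic(2)[of e "\<theta> - x"] by (simp add: algebra_simps)
  have g: "continuous_on S g" for S unfolding g_def
    by (intro continuous_intros stretch_factor_powr_cont e continuous_on_subset[OF f]) auto
  have "integral {0..0 + pi} g = integral {\<theta> - pi / 2..(\<theta> - pi / 2) + pi} g"
    by (intro integral_periodic g) (auto simp: g_def per kper)
  also have "{\<theta> - pi / 2..(\<theta> - pi / 2) + pi} = {- (pi / 2) + \<theta>..pi / 2 + \<theta>}" by auto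
  also have "integral \<dots> g = integral {- (pi / 2)..pi / 2} (g \<circ> (\<lambda>x. x + \<theta>))"
    by (rule integral_shift[symmetric, OF g])
  also have "\<dots> = integral {- (pi / 2).. - (- (pi / 2))} (\<lambda>x. (g \<circ> (\<lambda>x. x + \<theta>)) (- x))"
    by (rule Henstock_Kurzweil_Integration.integral_reflect_real[symmetric])
  also have "\<dots> = integral {- (pi / 2)..pi / 2} (\<lambda>\<beta>. f (\<theta> - \<beta>) * stretch_factor e \<beta> powr (- a))"
    by (simp add: g_def o_def add.commute)
  finally show ?thesis by (simp add: g_def[abs_def])
qed

lemma direction_mass_symmetric:
  assumes e: "e > 0"
  shows "direction_mass e a = integral {- (pi / 2)..pi / 2} (\<lambda>\<beta>. stretch_factor e \<beta> powr (- a))"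
  using direction_mean_numerator[OF e, of "\<lambda>_. 1" 0 a] by (simp add: direction_mass_def stretch_factor_minus)

lemma stretch_factor_powr_integrable: "e > 0 \<Longrightarrow> (\<lambda>\<beta>. stretch_factor e \<beta> powr r) integrable_on {c..d}"
  by (intro integrable_continuous_real stretch_factor_powr_cont continuous_intros)

lemma direction_mass_pos:
  assumes e: "0 < e" "e \<le> 1" and a: "a > 0"
  shows "direction_mass e a \<ge> pi"
proof -
  have "stretch_factor e \<beta> powr (- a) \<ge> 1" for \<beta>
    using powr_mono2'[of "-a" "stretch_factor e \<beta>" 1] stretch_factor_pos[OF e(1), of \<beta>] stretch_factor_le_1[OF e, of \<beta>] a by simp
  then have "integral {0..pi} (\<lambda>\<alpha>. 1) \<le> direction_mass e a" unfolding direction_mass_def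
    using e by (intro integral_le stretch_factor_powr_integrable) auto
  then show ?thesis by simp
qed

lemma direction_mean_bounds:
  fixes f :: "real \<Rightarrow> real"
  assumes e: "0 < e" "e \<le> 1" and a: "a > 0" and f: "continuous_on UNIV f"
  shows "(\<And>\<alpha>. f \<alpha> \<le> M) \<Longrightarrow> direction_mean e a f \<theta> \<le> M" and "(\<And>\<alpha>. m \<le> f \<alpha>) \<Longrightarrow> m \<le> direction_mean e a f \<theta>"
proof -
  have pos: "direction_mass e a > 0" using direction_mass_pos[OF e a] pi_gt_zero by linarith
  have i: "(\<lambda>\<alpha>. f \<alpha> * stretch_factor e (\<theta> - \<alpha>) powr (- a)) integrable_on {0..pi}"
    using e by (intro integrable_continuous_real continuous_intros stretch_factor_powr_cont continuous_on_subset[OF f]) auto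
  have i2: "(\<lambda>\<alpha>. c * stretch_factor e (\<theta> - \<alpha>) powr (- a)) integrable_on {0..pi}" for c
    using e by (intro integrable_continuous_real continuous_intros stretch_factor_powr_cont) auto
  have c: "integral {0..pi} (\<lambda>\<alpha>. c * stretch_factor e (\<theta> - \<alpha>) powr (- a)) = c * direction_mass e a" for c
    using direction_mean_numerator[OF e(1), of "\<lambda>_. c" \<theta> a] direction_mass_symmetric[OF e(1), of a] by simp
  show "direction_mean e a f \<theta> \<le> M" if "\<And>\<alpha>. f \<alpha> \<le> M"
  proof -
    have "integral {0..pi} (\<lambda>\<alpha>. f \<alpha> * stretch_factor e (\<theta> - \<alpha>) powr (- a)) \<le> integral {0..pi} (\<lambda>\<alpha>. M * stretch_factor e (\<theta> - \<alpha>) powr (- a))"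
      using that by (intro integral_le i i2 mult_right_mono) auto
    then show ?thesis unfolding c direction_mean_def using pos by (simp add: divide_le_eq)
  qed
  show "m \<le> direction_mean e a f \<theta>" if "\<And>\<alpha>. m \<le> f \<alpha>"
  proof -
    have "integral {0..pi} (\<lambda>\<alpha>. m * stretch_factor e (\<theta> - \<alpha>) powr (- a)) \<le> integral {0..pi} (\<lambda>\<alpha>. f \<alpha> * stretch_factor e (\<theta> - \<alpha>) powr (- a))"
      using that by (intro integral_le i i2 mult_right_mono) auto
    then show ?thesis unfolding c direction_mean_def using pos by (simp add: le_divide_eq)
  qed
qed

text \<open>
  Near 0 the kernel with exponent 1/2 dominates \<open>1 / (e + \<beta>)\<close>, whose integral diverges logarithmically as
  \<open>e \<rightarrow> 0\<close>. Larger exponents only increase the kernel, since \<open>stretch_factor e \<le> 1\<close>.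
\<close>

lemma direction_mass_ge_ln:
  assumes e: "0 < e" "e \<le> 1" and a: "a \<ge> 1 / 2"
  shows "direction_mass e a \<ge> - ln e"
proof -
  have low: "1 / (e + \<beta>) \<le> stretch_factor e \<beta> powr (- a)" if "\<beta> \<in> {0..1}" for \<beta>
  proof -
    have "(sin \<beta>)\<^sup>2 \<le> \<beta>\<^sup>2" using abs_sin_le_one abs_sin_x_le_abs_x[of \<beta>] by (simp add: abs_le_square_iff)
    moreover have "e\<^sup>2 * (cos \<beta>)\<^sup>2 \<le> e\<^sup>2 * 1" by (intro mult_left_mono) (auto simp: abs_square_le_1)
    moreover have "0 \<le> 2 * e * \<beta>" using e that by auto
    ultimately have "stretch_factor e \<beta> \<le> (e + \<beta>)\<^sup>2" unfolding stretch_factor_def power2_sum by linarith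
    then have "((e + \<beta>)\<^sup>2) powr (- (1 / 2)) \<le> stretch_factor e \<beta> powr (- (1 / 2))"
      using stretch_factor_pos[OF e(1), of \<beta>] by (intro powr_mono2') auto
    also have "\<dots> \<le> stretch_factor e \<beta> powr (- a)"
      using stretch_factor_pos[OF e(1), of \<beta>] stretch_factor_le_1[OF e, of \<beta>] a by (intro powr_mono') auto
    also have "((e + \<beta>)\<^sup>2) powr (- (1 / 2)) = 1 / (e + \<beta>)"
    proof -
      have "((e + \<beta>)\<^sup>2) powr (1 / 2) = e + \<beta>" using e that by (simp add: powr_half_sqrt)
      then show ?thesis by (simp only: powr_minus_divide)
    qed
    finally show ?thesis .
  qed
  have hi: "((\<lambda>\<beta>. 1 / (e + \<beta>)) has_integral ln (e + 1) - ln (e + 0)) {0..1}"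
  proof (rule fundamental_theorem_of_calculus)
    fix \<beta> :: real assume "\<beta> \<in> {0..1}"
    then have "e + \<beta> > 0" using e by simp
    then have "((\<lambda>\<beta>. ln (e + \<beta>)) has_real_derivative 1 / (e + \<beta>) * (0 + 1)) (at \<beta> within {0..1})"
      by (intro derivative_intros)
    then show "((\<lambda>\<beta>. ln (e + \<beta>)) has_vector_derivative 1 / (e + \<beta>)) (at \<beta> within {0..1})"
      by (simp only: has_real_derivative_iff_has_vector_derivative add_0 mult_1_right)
  qed simp
  have "- ln e \<le> ln (e + 1) - ln (e + 0)" using e by simp
  also have "\<dots> = integral {0..1} (\<lambda>\<beta>. 1 / (e + \<beta>))" using hi by (simp add: integral_unique)
  also have "\<dots> \<le> integral {0..1} (\<lambda>\<beta>. stretch_factor e \<beta> powr (- a))"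
    using hi low e by (intro integral_le stretch_factor_powr_integrable) auto
  also have "\<dots> \<le> direction_mass e a" unfolding direction_mass_def
    using e pi_gt3 by (intro integral_subset_le stretch_factor_powr_integrable) auto
  finally show ?thesis .
qed

lemma periodic_bounded_uniformly_continuous:
  fixes f :: "real \<Rightarrow> real"
  assumes f: "continuous_on UNIV f" and per: "\<And>x. f (x + pi) = f x"
  shows "\<exists>M. \<forall>x. \<bar>f x\<bar> \<le> M" and "uniformly_continuous_on UNIV f"
    and "(\<And>x. f x > 0) \<Longrightarrow> \<exists>m>0. \<forall>x. m \<le> f x"
proof -
  interpret periodic_fun_simple f pi by unfold_locales (rule per)
  have red: "\<exists>k::int. x + of_int k * pi \<in> {0..pi}" for x
  proof (intro exI)
    have "of_int \<lfloor>x / pi\<rfloor> * pi \<le> x" "x < (of_int \<lfloor>x / pi\<rfloor> + 1) * pi"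
      by (simp_all add: floor_divide_lower floor_divide_upper)
    then show "x + of_int (- \<lfloor>x / pi\<rfloor>) * pi \<in> {0..pi}" by (auto simp: algebra_simps)
  qed
  have comp: "compact (f ` {0..pi})" by (intro compact_continuous_image continuous_on_subset[OF f]) auto
  then obtain M where M: "\<And>x. x \<in> {0..pi} \<Longrightarrow> \<bar>f x\<bar> \<le> M"
    using compact_imp_bounded[OF comp] unfolding bounded_iff real_norm_def by blast
  show "\<exists>M. \<forall>x. \<bar>f x\<bar> \<le> M"
  proof (intro exI[of _ M] allI)
    fix x obtain k :: int where "x + of_int k * pi \<in> {0..pi}" using red by blast
    then show "\<bar>f x\<bar> \<le> M" using M[of "x + of_int k * pi"] plus_of_int[of x k] by simp
  qed
  show "\<exists>m>0. \<forall>x. m \<le> f x" if pos: "\<And>x. f x > 0"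
  proof -
    obtain x0 where x0: "\<forall>x\<in>{0..pi}. f x0 \<le> f x"
      using continuous_attains_inf[of "{0..pi}" f] continuous_on_subset[OF f] by auto
    have "f x0 \<le> f x" for x
    proof -
      obtain k :: int where "x + of_int k * pi \<in> {0..pi}" using red by blast
      then show ?thesis using x0[rule_format, of "x + of_int k * pi"] plus_of_int[of x k] by simp
    qed
    then show ?thesis using pos[of x0] by auto
  qed
  have uc: "uniformly_continuous_on {-1..pi + 1} f"
    by (intro compact_uniformly_continuous continuous_on_subset[OF f]) auto
  show "uniformly_continuous_on UNIV f"
    unfolding uniformly_continuous_on_def
  proof safe
    fix \<epsilon> :: real assume "\<epsilon> > 0"
    then obtain d where d: "d > 0" "\<And>x y. x \<in> {-1..pi + 1} \<Longrightarrow> y \<in> {-1..pi + 1} \<Longrightarrow> dist y x < d \<Longrightarrow> dist (f y) (f x) < \<epsilon>"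
      using uc unfolding uniformly_continuous_on_def by metis
    show "\<exists>d>0. \<forall>x\<in>UNIV. \<forall>y\<in>UNIV. dist y x < d \<longrightarrow> dist (f y) (f x) < \<epsilon>"
    proof (intro exI[of _ "min d 1"] conjI ballI impI)
      fix x y :: real assume xy: "dist y x < min d 1"
      obtain k :: int where k: "x + of_int k * pi \<in> {0..pi}" using red by blast
      have "y + of_int k * pi \<in> {-1..pi + 1}" "x + of_int k * pi \<in> {-1..pi + 1}"
        using k xy by (auto simp: dist_real_def)
      then show "dist (f y) (f x) < \<epsilon>"
        using d(2)[of "x + of_int k * pi" "y + of_int k * pi"] xy plus_of_int[of x k] plus_of_int[of y k]
        by (simp add: dist_real_def)
    qed (use d in auto)
  qed
qed

text \<open>
  Split the mean at \<open>|\<beta>| = d\<close>. Inside, uniform continuity bounds the contribution by \<open>\<epsilon>/2\<close>; outside, the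
  kernel is bounded independently of \<open>e\<close>, and the normalizing mass is as large as needed.
\<close>

lemma direction_mean_approximates:
  fixes f :: "real \<Rightarrow> real"
  assumes f: "continuous_on UNIV f" and per: "\<And>x. f (x + pi) = f x" and a: "a \<ge> 1 / 2" and \<epsilon>: "\<epsilon> > 0"
  shows "\<exists>e0>0. \<forall>e. 0 < e \<and> e < e0 \<longrightarrow> (\<forall>\<theta>. \<bar>direction_mean e a f \<theta> - f \<theta>\<bar> \<le> \<epsilon>)"
proof -
  obtain M where M: "\<And>x. \<bar>f x\<bar> \<le> M" using periodic_bounded_uniformly_continuous(1)[OF f per] by auto
  have M0: "M \<ge> 0" using M[of 0] by linarith
  obtain d0 where d0: "d0 > 0" "\<And>x y. \<bar>y - x\<bar> < d0 \<Longrightarrow> \<bar>f y - f x\<bar> < \<epsilon> / 2"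
    using periodic_bounded_uniformly_continuous(2)[OF f per] \<epsilon> unfolding uniformly_continuous_on_def dist_real_def
    by (metis half_gt_zero UNIV_I)
  define d where "d = min d0 (pi / 2)"
  have d: "0 < d" "d \<le> pi / 2" "d \<le> d0" using d0 by (auto simp: d_def)
  have sd: "sin d > 0" using d by (intro sin_gt_zero) auto
  define C where "C = 2 * M * ((sin d)\<^sup>2) powr (- a)"
  have C0: "C \<ge> 0" using M0 by (simp add: C_def)
  \<comment> \<open>By the logarithmic lower bound, the mass is at least \<open>2 C \<pi> / \<epsilon>\<close> for \<open>e < e0\<close>.\<close>
  define e0 where "e0 = min 1 (exp (- (2 * C * pi / \<epsilon>)))"
  show ?thesis
  proof (intro exI[of _ e0] conjI allI impI)
    show "e0 > 0" by (simp add: e0_def)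
    fix e \<theta> assume "0 < e \<and> e < e0"
    then have e: "0 < e" "e \<le> 1" "e < exp (- (2 * C * pi / \<epsilon>))" by (auto simp: e0_def)
    have pos: "direction_mass e a > 0" using direction_mass_pos[OF e(1,2)] a pi_gt_zero by (metis less_le_trans zero_less_divide_1_iff zero_less_numeral)
    have "ln e < - (2 * C * pi / \<epsilon>)" using e by (metis exp_gt_zero ln_exp ln_less_cancel_iff)
    then have large: "2 * C * pi / \<epsilon> \<le> direction_mass e a" using direction_mass_ge_ln[OF e(1,2) a] by linarith
    let ?S = "{- (pi / 2)..pi / 2}"
    have fc: "continuous_on S (\<lambda>\<beta>. f (\<theta> - \<beta>))" for S
      by (rule continuous_on_compose2[OF f]) (auto intro!: continuous_intros)
    have kc: "continuous_on S (\<lambda>\<beta>. stretch_factor e \<beta> powr (- a))" for S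
      by (intro stretch_factor_powr_cont e continuous_intros)
    have "direction_mass e a * (direction_mean e a f \<theta> - f \<theta>) = integral ?S (\<lambda>\<beta>. f (\<theta> - \<beta>) * stretch_factor e \<beta> powr (- a)) - f \<theta> * direction_mass e a"
      using pos by (simp add: direction_mean_def direction_mean_numerator[OF e(1) f per] field_simps)
    also have "\<dots> = integral ?S (\<lambda>\<beta>. f (\<theta> - \<beta>) * stretch_factor e \<beta> powr (- a) - f \<theta> * stretch_factor e \<beta> powr (- a))"
      unfolding direction_mass_symmetric[OF e(1)]
      by (subst integral_diff; (rule integrable_continuous_real)?) (auto intro!: continuous_intros fc kc)
    finally have eq: "direction_mass e a * (direction_mean e a f \<theta> - f \<theta>)
        = integral ?S (\<lambda>\<beta>. f (\<theta> - \<beta>) * stretch_factor e \<beta> powr (- a) - f \<theta> * stretch_factor e \<beta> powr (- a))" .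
    have ptw: "\<bar>f (\<theta> - \<beta>) * stretch_factor e \<beta> powr (- a) - f \<theta> * stretch_factor e \<beta> powr (- a)\<bar> \<le> \<epsilon> / 2 * stretch_factor e \<beta> powr (- a) + C"
      if \<beta>: "\<beta> \<in> ?S" for \<beta>
    proof -
      have "\<bar>f (\<theta> - \<beta>) * stretch_factor e \<beta> powr (- a) - f \<theta> * stretch_factor e \<beta> powr (- a)\<bar> = \<bar>f (\<theta> - \<beta>) - f \<theta>\<bar> * stretch_factor e \<beta> powr (- a)"
        by (simp add: abs_mult left_diff_distrib[symmetric])
      also have "\<dots> \<le> \<epsilon> / 2 * stretch_factor e \<beta> powr (- a) + C"
      proof (cases "\<bar>\<beta>\<bar> < d")
        case True
        then have "\<bar>f (\<theta> - \<beta>) - f \<theta>\<bar> * stretch_factor e \<beta> powr (- a) \<le> \<epsilon> / 2 * stretch_factor e \<beta> powr (- a)"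
          using d0(2)[of "\<theta> - \<beta>" \<theta>] d(3) by (intro mult_right_mono) auto
        then show ?thesis using C0 by linarith
      next
        case False
        have "sin d \<le> sin \<bar>\<beta>\<bar>" using False \<beta> d by (intro sin_monotone_2pi_le) auto
        then have "(sin d)\<^sup>2 \<le> (sin \<bar>\<beta>\<bar>)\<^sup>2" using sd by (intro power_mono) auto
        also have "(sin \<bar>\<beta>\<bar>)\<^sup>2 = (sin \<beta>)\<^sup>2" by (simp add: abs_if)
        also have "(sin \<beta>)\<^sup>2 \<le> stretch_factor e \<beta>" by (simp add: stretch_factor_def)
        finally have "stretch_factor e \<beta> powr (- a) \<le> ((sin d)\<^sup>2) powr (- a)"
          using sd a by (intro powr_mono2') auto
        moreover have "\<bar>f (\<theta> - \<beta>) - f \<theta>\<bar> \<le> 2 * M" using M[of "\<theta> - \<beta>"] M[of \<theta>] by linarith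
        ultimately have "\<bar>f (\<theta> - \<beta>) - f \<theta>\<bar> * stretch_factor e \<beta> powr (- a) \<le> C"
          unfolding C_def using M0 by (intro mult_mono) auto
        moreover have "0 \<le> \<epsilon> / 2 * stretch_factor e \<beta> powr (- a)" using \<epsilon> by simp
        ultimately show ?thesis by linarith
      qed
      finally show ?thesis .
    qed
    have "\<bar>direction_mass e a * (direction_mean e a f \<theta> - f \<theta>)\<bar> \<le> integral ?S (\<lambda>\<beta>. \<epsilon> / 2 * stretch_factor e \<beta> powr (- a) + C)"
    proof -
      have "norm (integral ?S (\<lambda>\<beta>. f (\<theta> - \<beta>) * stretch_factor e \<beta> powr (- a) - f \<theta> * stretch_factor e \<beta> powr (- a)))
          \<le> integral ?S (\<lambda>\<beta>. \<epsilon> / 2 * stretch_factor e \<beta> powr (- a) + C)"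
      proof (rule integral_norm_bound_integral)
        show "(\<lambda>\<beta>. f (\<theta> - \<beta>) * stretch_factor e \<beta> powr (- a) - f \<theta> * stretch_factor e \<beta> powr (- a)) integrable_on ?S"
          by (rule integrable_continuous_real) (intro continuous_intros fc kc)
        show "(\<lambda>\<beta>. \<epsilon> / 2 * stretch_factor e \<beta> powr (- a) + C) integrable_on ?S"
          by (rule integrable_continuous_real) (intro continuous_intros kc)
      qed (use ptw in simp)
      then show ?thesis unfolding eq real_norm_def .
    qed
    also have "\<dots> = \<epsilon> / 2 * direction_mass e a + C * pi"
      unfolding direction_mass_symmetric[OF e(1)]
      by (subst integral_add; (rule integrable_continuous_real)?) (auto intro!: continuous_intros kc)
    also have "\<dots> \<le> \<epsilon> / 2 * direction_mass e a + \<epsilon> / 2 * direction_mass e a"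
      using large \<epsilon> by (simp add: field_simps)
    finally have "direction_mass e a * \<bar>direction_mean e a f \<theta> - f \<theta>\<bar> \<le> direction_mass e a * \<epsilon>"
      using pos by (simp add: abs_mult mult.commute)
    then show "\<bar>direction_mean e a f \<theta> - f \<theta>\<bar> \<le> \<epsilon>" using pos by simp
  qed
qed

text \<open>
  From \<open>y cos y \<le> sin y\<close> at \<open>y = x / 2\<close> and the double angle formulas, using \<open>cos\<^sup>2 (x / 2) \<ge> 1/2\<close>.
\<close>

lemma sin_ge_half:
  fixes x :: real
  assumes "0 \<le> x" "x \<le> pi / 2"
  shows "x / 2 \<le> sin x"
proof -
  have mvt: "y * cos y \<le> sin y" if y: "0 \<le> y" "y \<le> pi" for y :: real
  proof (cases "y = 0")
    case False
    then obtain z where z: "0 < z" "z < y" "sin y - sin 0 = (y - 0) * cos z"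
      using MVT2[of 0 y sin cos] y by (auto intro: DERIV_sin)
    then have "cos y \<le> cos z" using y by (intro cos_monotone_0_pi_le) auto
    then have "y * cos y \<le> y * cos z" using y by (intro mult_left_mono) auto
    then show ?thesis using z(3) by simp
  qed simp
  have cx: "cos x \<ge> 0" using assms by (intro cos_ge_zero) auto
  have ch: "cos (x / 2) \<ge> 0" using assms by (intro cos_ge_zero) auto
  have "cos (2 * (x / 2)) = 2 * (cos (x / 2))\<^sup>2 - 1" by (rule cos_double_cos)
  then have "1 / 2 \<le> (cos (x / 2))\<^sup>2" using cx by simp
  then have "x * (1 / 2) \<le> x * (cos (x / 2))\<^sup>2" using assms by (intro mult_left_mono) auto
  also have "\<dots> = 2 * (x / 2 * cos (x / 2)) * cos (x / 2)" by (simp add: power2_eq_square)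
  also have "\<dots> \<le> 2 * sin (x / 2) * cos (x / 2)"
    using mvt[of "x / 2"] assms ch by (intro mult_right_mono) auto
  also have "\<dots> = sin (2 * (x / 2))" by (rule sin_double[symmetric])
  finally show ?thesis by simp
qed

lemma abs_powr_integrable:
  fixes r c :: real
  assumes "r > -1" "c \<ge> 0"
  shows "(\<lambda>x. \<bar>x\<bar> powr r) integrable_on {- c..c}"
proof -
  have 1: "(\<lambda>x. \<bar>x\<bar> powr r) integrable_on {0..c}"
    using integrable_on_powr_from_0[OF assms] by (rule integrable_eq) auto
  have "(\<lambda>x. (\<lambda>x. \<bar>x\<bar> powr r) (- x)) integrable_on {- c..- 0}"
    using 1 by (subst Henstock_Kurzweil_Integration.integrable_reflect_real)
  then show ?thesis using 1 assms by (intro Henstock_Kurzweil_Integration.integrable_combine[of "- c" 0 c]) auto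
qed

lemma direction_mean_tendsto:
  fixes f :: "real \<Rightarrow> real"
  assumes a: "a \<ge> 1 / 2" and f: "continuous_on UNIV f" and per: "\<And>x. f (x + pi) = f x"
  shows "(\<lambda>n. direction_mean (1 / (real n + 2)) a f \<theta>) \<longlonglongrightarrow> f \<theta>"
proof (rule LIMSEQ_I)
  fix r :: real assume "r > 0"
  then obtain e0 where e0: "e0 > 0" "\<And>e. 0 < e \<Longrightarrow> e < e0 \<Longrightarrow> \<bar>direction_mean e a f \<theta> - f \<theta>\<bar> \<le> r / 2"
    using direction_mean_approximates[OF f per a, of "r / 2"] by auto
  obtain N where N: "1 / (real N + 1) < e0" using e0(1) by (metis Suc_eq_plus1 nat_approx_posE of_nat_Suc add.commute)
  have "norm (direction_mean (1 / (real n + 2)) a f \<theta> - f \<theta>) < r" if "n \<ge> N" for n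
  proof -
    have "1 / (real n + 2) \<le> 1 / (real N + 1)" using that by (intro divide_left_mono) auto
    then show ?thesis using e0(2)[of "1 / (real n + 2)"] N \<open>r > 0\<close> by simp
  qed
  then show "\<exists>no. \<forall>n\<ge>no. norm (direction_mean (1 / (real n + 2)) a f \<theta> - f \<theta>) < r" by blast
qed

text \<open>
  For \<open>a \<ge> 1/2\<close> the limit is \<open>f\<close> itself. For \<open>a < 1/2\<close> the kernels increase to \<open>|sin|^{-2a}\<close>, which is
  integrable over a period, and dominated convergence applies to numerator and mass.
\<close>

lemma direction_mean_limit:
  fixes f :: "real \<Rightarrow> real" and a :: real
  assumes a: "a > 0" and f: "continuous_on UNIV f" and per: "\<And>x. f (x + pi) = f x"
  shows "\<exists>\<Psi>. continuous_on UNIV \<Psi> \<and> (\<forall>\<theta>. \<Psi> (\<theta> + pi) = \<Psi> \<theta>) \<and>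
     (\<forall>\<theta>. (\<lambda>n. direction_mean (1 / (real n + 2)) a f \<theta>) \<longlonglongrightarrow> \<Psi> \<theta>)"
proof (cases "a \<ge> 1 / 2")
  case True
  then show ?thesis using f per direction_mean_tendsto[OF True f per] by blast
next
  case False
  then have a2: "a < 1 / 2" by simp
  define S where "S = {- (pi / 2)..pi / 2}"
  \<comment> \<open>The kernels do not converge at \<open>\<beta> = 0\<close>, which is therefore removed.\<close>
  define T where "T = S - {0}"
  define K where "K \<beta> = ((sin \<beta>)\<^sup>2) powr (- a)" for \<beta> :: real
  define H where "H \<beta> = (\<bar>\<beta>\<bar> / 2) powr (- (2 * a))" for \<beta> :: real
  define e where "e n = 1 / (real n + 2)" for n :: nat
  define k where "k n \<beta> = stretch_factor (e n) \<beta> powr (- a)" for n \<beta>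
  have e: "0 < e n" "e n \<le> 1" for n by (auto simp: e_def)
  have e_lim: "e \<longlonglongrightarrow> 0" unfolding e_def by real_asymp
  have ST: "integral T g = integral S g" for g :: "real \<Rightarrow> real"
    by (rule integral_spike_set) (auto simp: T_def intro: negligible_subset[of "{0}"])
  have ST': "g integrable_on T \<longleftrightarrow> g integrable_on S" for g :: "real \<Rightarrow> real"
    by (rule integrable_spike_set_eq) (auto simp: T_def intro: negligible_subset[of "{0}"])
  have Hint: "(\<lambda>\<beta>. M * H \<beta>) integrable_on T" for M
  proof -
    have "(\<lambda>\<beta>. (2 powr (2 * a) * M) * \<bar>\<beta>\<bar> powr (- (2 * a))) integrable_on S"
      unfolding S_def using a a2 by (intro integrable_on_mult_right abs_powr_integrable) auto
    moreover have "(2 powr (2 * a) * M) * \<bar>\<beta>\<bar> powr (- (2 * a)) = M * H \<beta>" for \<beta>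
      by (simp add: H_def powr_divide powr_minus field_simps)
    ultimately show ?thesis by (simp add: ST')
  qed
  have sin_T: "\<bar>\<beta>\<bar> / 2 \<le> \<bar>sin \<beta>\<bar>" "sin \<beta> \<noteq> 0" if "\<beta> \<in> T" for \<beta>
  proof -
    have "\<bar>\<beta>\<bar> / 2 \<le> sin \<bar>\<beta>\<bar>" using that by (intro sin_ge_half) (auto simp: T_def S_def)
    also have "\<dots> \<le> \<bar>sin \<beta>\<bar>" by (auto simp: abs_if)
    finally show "\<bar>\<beta>\<bar> / 2 \<le> \<bar>sin \<beta>\<bar>" .
    then show "sin \<beta> \<noteq> 0" using that by (auto simp: T_def)
  qed
  have K_le: "K \<beta> \<le> H \<beta>" if "\<beta> \<in> T" for \<beta>
  proof -
    have "K \<beta> = \<bar>sin \<beta>\<bar> powr (- (2 * a))"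
    proof -
      have "(sin \<beta>)\<^sup>2 = \<bar>sin \<beta>\<bar> powr 2" using sin_T(2)[OF that] by (simp add: powr_numeral)
      then have "K \<beta> = (\<bar>sin \<beta>\<bar> powr 2) powr (- a)" unfolding K_def by (rule arg_cong)
      then show ?thesis unfolding powr_powr by simp
    qed
    also have "\<dots> \<le> H \<beta>" unfolding H_def using sin_T(1)[OF that] that a
      by (intro powr_mono2') (auto simp: T_def)
    finally show ?thesis .
  qed
  have k_le: "k n \<beta> \<le> K \<beta>" if "\<beta> \<in> T" for n \<beta>
    unfolding k_def K_def using sin_T(2)[OF that] a by (intro powr_mono2') (auto simp: stretch_factor_def)
  have k_lim: "(\<lambda>n. k n \<beta>) \<longlonglongrightarrow> K \<beta>" if "\<beta> \<in> T" for \<beta>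
  proof -
    have "(\<lambda>n. stretch_factor (e n) \<beta>) \<longlonglongrightarrow> 0\<^sup>2 * (cos \<beta>)\<^sup>2 + (sin \<beta>)\<^sup>2"
      unfolding stretch_factor_def by (intro tendsto_intros e_lim)
    then show ?thesis unfolding k_def K_def using sin_T(2)[OF that] by (intro tendsto_powr) auto
  qed
  have nn: "0 \<le> k n \<beta>" "0 \<le> K \<beta>" for n \<beta> by (auto simp: k_def K_def)
  have main: "(\<lambda>\<beta>. g (\<theta> - \<beta>) * K \<beta>) integrable_on T"
      "(\<lambda>n. integral T (\<lambda>\<beta>. g (\<theta> - \<beta>) * k n \<beta>)) \<longlonglongrightarrow> integral T (\<lambda>\<beta>. g (\<theta> - \<beta>) * K \<beta>)"
    if g: "continuous_on UNIV g" and M: "\<And>x. \<bar>g x\<bar> \<le> M" for g M \<theta>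
  proof -
    have gc: "continuous_on S (\<lambda>\<beta>. g (\<theta> - \<beta>))" for S
      by (rule continuous_on_compose2[OF g]) (auto intro!: continuous_intros)
    have i: "(\<lambda>\<beta>. g (\<theta> - \<beta>) * k n \<beta>) integrable_on T" for n
      unfolding ST' S_def k_def
      by (rule integrable_continuous_real) (intro continuous_intros gc stretch_factor_powr_cont e)
    have b: "norm (g (\<theta> - \<beta>) * k n \<beta>) \<le> M * H \<beta>" if "\<beta> \<in> T" for n \<beta>
    proof -
      have "\<bar>g (\<theta> - \<beta>)\<bar> * k n \<beta> \<le> M * H \<beta>"
        using M[of "\<theta> - \<beta>"] k_le[OF that, of n] K_le[OF that] nn(1)[of n \<beta>] nn(2)[of \<beta>] by (intro mult_mono) auto
      then show ?thesis using nn by (simp add: abs_mult)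
    qed
    have l: "\<And>\<beta>. \<beta> \<in> T \<Longrightarrow> (\<lambda>n. g (\<theta> - \<beta>) * k n \<beta>) \<longlonglongrightarrow> g (\<theta> - \<beta>) * K \<beta>"
      by (intro tendsto_intros k_lim)
    show "(\<lambda>\<beta>. g (\<theta> - \<beta>) * K \<beta>) integrable_on T"
      "(\<lambda>n. integral T (\<lambda>\<beta>. g (\<theta> - \<beta>) * k n \<beta>)) \<longlonglongrightarrow> integral T (\<lambda>\<beta>. g (\<theta> - \<beta>) * K \<beta>)"
      using dominated_convergence[OF i Hint b l] by auto
  qed
  obtain M where M: "\<And>x. \<bar>f x\<bar> \<le> M" using periodic_bounded_uniformly_continuous(1)[OF f per] by auto
  define N where "N = integral T K"
  have direction_mass_lim: "(\<lambda>n. direction_mass (e n) a) \<longlonglongrightarrow> N"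
    using main(2)[of "\<lambda>_. 1" 1 0] unfolding N_def ST direction_mass_symmetric[OF e(1)] k_def S_def by simp
  have "N \<ge> pi" using direction_mass_lim by (rule LIMSEQ_le_const) (use direction_mass_pos[OF e a] in auto)
  then have N: "N > 0" using pi_gt_zero by linarith
  define \<Psi> where "\<Psi> \<theta> = integral T (\<lambda>\<beta>. f (\<theta> - \<beta>) * K \<beta>) / N" for \<theta>
  have "continuous_on UNIV (\<lambda>\<theta>. integral T (\<lambda>\<beta>. f (\<theta> - \<beta>) * K \<beta>))"
    unfolding continuous_on_sequentially comp_def
  proof safe
    fix X and \<theta> :: real assume X: "X \<longlonglongrightarrow> \<theta>"
    show "(\<lambda>n. integral T (\<lambda>\<beta>. f (X n - \<beta>) * K \<beta>)) \<longlonglongrightarrow> integral T (\<lambda>\<beta>. f (\<theta> - \<beta>) * K \<beta>)"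
    proof (rule dominated_convergence(2)[OF main(1)[OF f M] Hint])
      show "norm (f (X n - \<beta>) * K \<beta>) \<le> M * H \<beta>" if "\<beta> \<in> T" for n \<beta>
      proof -
        have "\<bar>f (X n - \<beta>)\<bar> * K \<beta> \<le> M * H \<beta>"
          using M[of "X n - \<beta>"] K_le[OF that] nn(1)[of n \<beta>] nn(2)[of \<beta>] by (intro mult_mono) auto
        then show ?thesis using nn by (simp add: abs_mult)
      qed
      show "(\<lambda>n. f (X n - \<beta>) * K \<beta>) \<longlonglongrightarrow> f (\<theta> - \<beta>) * K \<beta>" for \<beta>
        by (intro tendsto_intros continuous_on_tendsto_compose[OF f] X) auto
    qed
  qed
  then have "continuous_on UNIV \<Psi>" unfolding \<Psi>_def using N by (intro continuous_intros) auto
  moreover have "\<Psi> (\<theta> + pi) = \<Psi> \<theta>" for \<theta>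
  proof -
    have "f (\<theta> + pi - \<beta>) = f (\<theta> - \<beta>)" for \<beta> using per[of "\<theta> - \<beta>"] by (simp add: algebra_simps)
    then show ?thesis by (simp add: \<Psi>_def)
  qed
  moreover have "(\<lambda>n. direction_mean (e n) a f \<theta>) \<longlonglongrightarrow> \<Psi> \<theta>" for \<theta>
  proof -
    have "direction_mean (e n) a f \<theta> = integral T (\<lambda>\<beta>. f (\<theta> - \<beta>) * k n \<beta>) / direction_mass (e n) a" for n
      unfolding direction_mean_def direction_mean_numerator[OF e(1) f per] ST by (simp add: S_def k_def)
    then show ?thesis unfolding \<Psi>_def using N by (simp add: tendsto_divide main(2)[OF f M] direction_mass_lim)
  qed
  ultimately show ?thesis unfolding e_def by blast
qed

section \<open>Polar coordinates and stretched kernels\<close>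

lemma polar_real2: "x $ 1 = norm x * cos (angle x)" "x $ 2 = norm x * sin (angle x)" for x :: "real^2"
proof -
  have n: "cmod (Complex (x $ 1) (x $ 2)) = norm x"
    by (simp add: cmod_def real_sqrt_unique norm_real2_sq flip: norm_real2_sq)
  show "x $ 1 = norm x * cos (angle x)" "x $ 2 = norm x * sin (angle x)"
    using cos_Arg[of "Complex (x $ 1) (x $ 2)"] sin_Arg[of "Complex (x $ 1) (x $ 2)"]
    unfolding angle_def n by (cases "x = 0"; force simp: complex_eq_iff vec_eq_iff forall_2)+
qed

text \<open>
  \<^const>\<open>Arg\<close> jumps across the negative real axis, but \<open>Arg z\<close> and \<open>Arg (- z)\<close> differ by \<open>\<plusminus>\<pi>\<close>, which \<open>f\<close> does
  not see; and near the negative axis \<open>Arg (- z)\<close> is continuous.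
\<close>

lemma continuous_on_angle:
  fixes f :: "real \<Rightarrow> real"
  assumes f: "continuous_on UNIV f" and per: "\<And>x. f (x + pi) = f x"
  shows "continuous_on (- {0}) (\<lambda>x. f (angle x))"
proof -
  have fc: "isCont f y" for y using f by (simp add: continuous_on_eq_continuous_at)
  have per': "f (x - pi) = f x" for x using per[of "x - pi"] by simp
  have A: "isCont (\<lambda>z. f (Arg z)) z" if "z \<noteq> 0" for z
  proof (cases "z \<in> \<real>\<^sub>\<le>\<^sub>0")
    case False
    then show ?thesis using continuous_at_Arg[of z] fc by (intro continuous_at_compose[of z Arg f, unfolded comp_def])
  next
    case True
    then have "- z \<notin> \<real>\<^sub>\<le>\<^sub>0" using that by (auto simp: complex_nonpos_Reals_iff complex_eq_iff)
    then have "isCont Arg (- z)" by (rule continuous_at_Arg)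
    then have "isCont (\<lambda>w. Arg (- w)) z"
      using continuous_at_compose[of z uminus Arg] by (simp add: comp_def)
    then have c: "isCont (\<lambda>w. f (Arg (- w))) z" 
      using fc by (intro continuous_at_compose[of z "\<lambda>w. Arg (- w)" f, unfolded comp_def])
    have "f (Arg (- w)) = f (Arg w)" if "w \<noteq> 0" for w
      using that per per' by (simp add: Arg_minus)
    then have ev: "\<forall>\<^sub>F w in nhds z. f (Arg (- w)) = f (Arg w)"
      using that by (intro eventually_mono[OF t1_space_nhds[of z 0]]) auto
    then show ?thesis using c isCont_cong[OF ev] by simp
  qed
  have "continuous_on (- {0}) ((\<lambda>z. f (Arg z)) \<circ> (\<lambda>x::real^2. Complex (x $ 1) (x $ 2)))"
  proof (rule continuous_on_compose)
    show "continuous_on (- {0}) (\<lambda>x::real^2. Complex (x $ 1) (x $ 2))"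
      unfolding Complex_eq by (intro continuous_intros)
    show "continuous_on ((\<lambda>x::real^2. Complex (x $ 1) (x $ 2)) ` (- {0})) (\<lambda>z. f (Arg z))"
    proof (intro continuous_at_imp_continuous_on ballI A)
      fix z assume "z \<in> (\<lambda>x::real^2. Complex (x $ 1) (x $ 2)) ` (- {0})"
      then show "z \<noteq> 0" by (auto simp: complex_eq_iff vec_eq_iff forall_2)
    qed
  qed
  then show ?thesis by (simp add: comp_def angle_def)
qed

lemma angle_measurable [measurable]: "angle \<in> borel_measurable borel"
proof -
  have [measurable]: "Arg \<in> borel_measurable borel"
  proof -
    have A: "Arg z = indicator (- \<real>\<^sub>\<le>\<^sub>0) z *\<^sub>R Arg z + indicator (\<real>\<^sub>\<le>\<^sub>0 - {0}) z *\<^sub>R pi" for z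
    proof (cases "z \<in> \<real>\<^sub>\<le>\<^sub>0")
      case True
      then have "z = 0 \<or> Arg z = pi" using complex_nonpos_Reals_iff[of z] complex_eq_iff[of z 0] Arg_eq_pi[of z] by auto
      then show ?thesis using True Arg_zero by (cases "z = 0") (simp_all add: indicator_def)
    qed simp
    have "continuous_on (- \<real>\<^sub>\<le>\<^sub>0) Arg"
      by (intro continuous_at_imp_continuous_on ballI continuous_at_Arg) auto
    then have [measurable]: "(\<lambda>z. indicator (- \<real>\<^sub>\<le>\<^sub>0) z *\<^sub>R Arg z) \<in> borel_measurable borel"
      by (intro borel_measurable_continuous_on_indicator) auto
    have [measurable]: "(\<real>\<^sub>\<le>\<^sub>0 - {0} :: complex set) \<in> sets borel"
      by (intro sets.Diff borel_closed closed_nonpos_Reals_complex) auto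
    have "(\<lambda>z. indicator (- \<real>\<^sub>\<le>\<^sub>0) z *\<^sub>R Arg z + indicator (\<real>\<^sub>\<le>\<^sub>0 - {0}) z *\<^sub>R pi) \<in> borel_measurable borel"
      by measurable
    then show ?thesis by (simp only: A[symmetric])
  qed
  have [measurable]: "(\<lambda>x::real^2. Complex (x $ 1) (x $ 2)) \<in> borel_measurable borel"
    unfolding Complex_eq by measurable
  show ?thesis unfolding angle_def[abs_def] by measurable
qed

lemma measurable_angle:
  fixes f :: "real \<Rightarrow> real"
  assumes f: "continuous_on UNIV f"
  shows "(\<lambda>x. f (angle x)) \<in> borel_measurable borel"
  using borel_measurable_continuous_onI[OF f] by measurable

text \<open>
  Rotation by \<open>-\<alpha>\<close> followed by \<open>diag(e, 1)\<close>.
\<close>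

definition stretch :: "real \<Rightarrow> real \<Rightarrow> real^2 \<Rightarrow> real^2" where
  "stretch e \<alpha> x = vec2 (e * (x $ 1 * cos \<alpha> + x $ 2 * sin \<alpha>)) (x $ 2 * cos \<alpha> - x $ 1 * sin \<alpha>)"

lemma linear_stretch: "linear (stretch e \<alpha>)"
  by (rule linearI) (auto simp: stretch_def vec_eq_iff forall_2 algebra_simps)

lemma norm_stretch:
  "(norm (stretch e \<alpha> x))\<^sup>2 = (norm x)\<^sup>2 * stretch_factor e (angle x - \<alpha>)"
proof -
  define r where "r = norm x"
  have "(norm (stretch e \<alpha> x))\<^sup>2 = (e * (x $ 1 * cos \<alpha> + x $ 2 * sin \<alpha>))\<^sup>2 + (x $ 2 * cos \<alpha> - x $ 1 * sin \<alpha>)\<^sup>2"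
    unfolding norm_real2_sq stretch_def vec2_nth ..
  also have "\<dots> = r\<^sup>2 * stretch_factor e (angle x - \<alpha>)"
    unfolding polar_real2[of x, folded r_def] stretch_factor_def cos_diff sin_diff
    by (simp add: algebra_simps power2_eq_square)
  finally show ?thesis by (simp add: r_def)
qed

lemma stretch_eq_0: "e > 0 \<Longrightarrow> stretch e \<alpha> x = 0 \<longleftrightarrow> x = 0"
  using norm_stretch[of e \<alpha> x] stretch_factor_pos[of e "angle x - \<alpha>"] linear_0[OF linear_stretch] by auto

lemma norm_stretch_powr:
  assumes "e > 0"
  shows "norm (stretch e \<alpha> x) powr (- s) = norm x powr (- s) * stretch_factor e (angle x - \<alpha>) powr (- (s / 2))"
proof (cases "x = 0")
  case False
  have sq: "norm y powr (- s) = ((norm y)\<^sup>2) powr (- (s / 2))" if "y \<noteq> 0" for y :: "real^2"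
    using that by (simp add: powr_powr flip: powr_numeral)
  have "stretch e \<alpha> x \<noteq> 0" using False stretch_eq_0[OF assms] by simp
  then show ?thesis using False stretch_factor_pos[OF assms, of "angle x - \<alpha>"]
    by (simp add: sq norm_stretch powr_mult)
qed (simp add: linear_0[OF linear_stretch])

section \<open>Positivity for anisotropic kernels\<close>

lemma stretch_measurable [measurable]: "(\<lambda>p. stretch e (fst p) (snd p)) \<in> borel_measurable (borel \<Otimes>\<^sub>M borel)"
proof -
  have "vec2 a b = a *\<^sub>R axis 1 1 + b *\<^sub>R axis 2 1" for a b
    by (auto simp: vec_eq_iff forall_2 axis_def)
  then have "continuous_on UNIV (\<lambda>p. stretch e (fst p) (snd p))"
    unfolding stretch_def by (auto intro!: continuous_intros)
  then show ?thesis unfolding borel_prod by (rule borel_measurable_continuous_onI)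
qed

text \<open>
  The average of stretched Riesz kernels is the Riesz kernel with a mean of \<open>\<Omega>\<close> as angular profile. At
  \<open>x = 0\<close> both sides are infinite, since \<open>\<Omega>\<close> has a positive integral.
\<close>

lemma stretched_riesz_average:
  fixes \<Omega> :: "real \<Rightarrow> real"
  assumes e: "0 < e" "e \<le> 1" and s: "s > 0" and \<Omega>: "continuous_on UNIV \<Omega>" "\<And>\<theta>. 0 < \<Omega> \<theta>" "\<And>\<theta>. \<Omega> (\<theta> + pi) = \<Omega> \<theta>"
  shows "(\<integral>\<^sup>+\<alpha>. ennreal (indicator {0..pi} \<alpha> * (\<Omega> \<alpha> / direction_mass e (s / 2))) * singular_kernel (\<lambda>x. norm x powr (- s)) (stretch e \<alpha> x) \<partial>lborel)
    = singular_kernel (\<lambda>x. norm x powr (- s) * direction_mean e (s / 2) \<Omega> (angle x)) x"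
proof -
  have N: "direction_mass e (s / 2) > 0" using direction_mass_pos[OF e, of "s / 2"] s pi_gt_zero by linarith
  have \<Omega>c: "continuous_on S \<Omega>" for S using \<Omega>(1) continuous_on_subset by blast
  show ?thesis
  proof (cases "x = 0")
    case True
    obtain m where m: "m > 0" "\<And>\<theta>. m \<le> \<Omega> \<theta>"
      using periodic_bounded_uniformly_continuous(3)[OF \<Omega>(1,3,2)] by auto
    have "((\<lambda>\<alpha>. m / direction_mass e (s / 2)) has_integral pi *\<^sub>R (m / direction_mass e (s / 2))) {0..pi}"
      using has_integral_const_real[of "m / direction_mass e (s / 2)" 0 pi] by (simp only: content_real pi_ge_zero) simp
    then have "ennreal (pi *\<^sub>R (m / direction_mass e (s / 2))) = (\<integral>\<^sup>+\<alpha>. ennreal (indicator {0..pi} \<alpha> * (m / direction_mass e (s / 2))) \<partial>lborel)"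
      by (rule nn_integral_has_integral_lebesgue[symmetric, rotated]) (use m N in auto)
    also have "\<dots> \<le> (\<integral>\<^sup>+\<alpha>. ennreal (indicator {0..pi} \<alpha> * (\<Omega> \<alpha> / direction_mass e (s / 2))) \<partial>lborel)"
      using m N by (intro nn_integral_mono ennreal_leI mult_left_mono divide_right_mono) auto
    finally have le: "ennreal (pi *\<^sub>R (m / direction_mass e (s / 2))) \<le> (\<integral>\<^sup>+\<alpha>. ennreal (indicator {0..pi} \<alpha> * (\<Omega> \<alpha> / direction_mass e (s / 2))) \<partial>lborel)" .
    have "0 < ennreal (pi *\<^sub>R (m / direction_mass e (s / 2)))" using m N by simp
    from less_le_trans[OF this le]
    have pos: "(\<integral>\<^sup>+\<alpha>. ennreal (indicator {0..pi} \<alpha> * (\<Omega> \<alpha> / direction_mass e (s / 2))) \<partial>lborel) \<noteq> 0" by simp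
    have [measurable]: "\<Omega> \<in> borel_measurable borel" using \<Omega>(1) by (rule borel_measurable_continuous_onI)
    have "stretch e \<alpha> x = 0" for \<alpha> using True stretch_eq_0[OF e(1)] by simp
    then have "(\<integral>\<^sup>+\<alpha>. ennreal (indicator {0..pi} \<alpha> * (\<Omega> \<alpha> / direction_mass e (s / 2))) * singular_kernel (\<lambda>x. norm x powr (- s)) (stretch e \<alpha> x) \<partial>lborel)
      = (\<integral>\<^sup>+\<alpha>. ennreal (indicator {0..pi} \<alpha> * (\<Omega> \<alpha> / direction_mass e (s / 2))) * \<infinity> \<partial>lborel)"
      by (simp add: singular_kernel_def)
    also have "\<dots> = (\<integral>\<^sup>+\<alpha>. ennreal (indicator {0..pi} \<alpha> * (\<Omega> \<alpha> / direction_mass e (s / 2))) \<partial>lborel) * \<infinity>"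
      by (rule nn_integral_multc) measurable
    also have "\<dots> = \<infinity>" using pos by (simp add: ennreal_mult_eq_top_iff)
    finally show ?thesis using True by (simp add: singular_kernel_def)
  next
    case False
    have "(\<integral>\<^sup>+\<alpha>. ennreal (indicator {0..pi} \<alpha> * (\<Omega> \<alpha> / direction_mass e (s / 2))) * singular_kernel (\<lambda>x. norm x powr (- s)) (stretch e \<alpha> x) \<partial>lborel)
      = (\<integral>\<^sup>+\<alpha>. ennreal (indicator {0..pi} \<alpha> * (norm x powr (- s) / direction_mass e (s / 2) * (\<Omega> \<alpha> * stretch_factor e (angle x - \<alpha>) powr (- (s / 2))))) \<partial>lborel)"
    proof (intro nn_integral_cong)
      fix \<alpha>
      have "0 \<le> indicator {0..pi} \<alpha> * (\<Omega> \<alpha> / direction_mass e (s / 2))"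
        using N \<Omega>(2)[of \<alpha>] by (simp add: indicator_def)
      then show "ennreal (indicator {0..pi} \<alpha> * (\<Omega> \<alpha> / direction_mass e (s / 2))) * singular_kernel (\<lambda>x. norm x powr (- s)) (stretch e \<alpha> x)
        = ennreal (indicator {0..pi} \<alpha> * (norm x powr (- s) / direction_mass e (s / 2) * (\<Omega> \<alpha> * stretch_factor e (angle x - \<alpha>) powr (- (s / 2)))))"
        using False by (simp add: singular_kernel_def norm_stretch_powr[OF e(1)] stretch_eq_0[OF e(1)] ennreal_mult'[symmetric] mult_ac)
    qed
    also have "\<dots> = ennreal (norm x powr (- s) / direction_mass e (s / 2) * integral {0..pi} (\<lambda>\<alpha>. \<Omega> \<alpha> * stretch_factor e (angle x - \<alpha>) powr (- (s / 2))))"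
    proof (rule nn_integral_has_integral_lebesgue)
      show "((\<lambda>\<alpha>. norm x powr (- s) / direction_mass e (s / 2) * (\<Omega> \<alpha> * stretch_factor e (angle x - \<alpha>) powr (- (s / 2)))) has_integral
        norm x powr (- s) / direction_mass e (s / 2) * integral {0..pi} (\<lambda>\<alpha>. \<Omega> \<alpha> * stretch_factor e (angle x - \<alpha>) powr (- (s / 2)))) {0..pi}"
        by (intro has_integral_mult_right integrable_integral integrable_continuous_real continuous_intros stretch_factor_powr_cont e \<Omega>c)
    qed (use N \<Omega>(2)[THEN less_imp_le] in auto)
    finally show ?thesis using False by (simp add: singular_kernel_def direction_mean_def)
  qed
qed

lemma energy_positive_direction_mean:
  fixes \<Omega> :: "real \<Rightarrow> real"
  assumes e: "0 < e" "e \<le> 1" and s: "s > 0" and \<Omega>: "continuous_on UNIV \<Omega>" "\<And>\<theta>. 0 < \<Omega> \<theta>" "\<And>\<theta>. \<Omega> (\<theta> + pi) = \<Omega> \<theta>"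
  shows "energy_positive (singular_kernel (\<lambda>x. norm x powr (- s) * direction_mean e (s / 2) \<Omega> (angle x)))"
    and "singular_kernel (\<lambda>x. norm x powr (- s) * direction_mean e (s / 2) \<Omega> (angle x)) \<in> borel_measurable borel"
proof -
  let ?r = "singular_kernel (\<lambda>x. norm x powr (- s))"
  define k where "k \<alpha> x = ennreal (indicator {0..pi} \<alpha> * (\<Omega> \<alpha> / direction_mass e (s / 2))) * ?r (stretch e \<alpha> x)" for \<alpha> x
  have [measurable]: "\<Omega> \<in> borel_measurable borel" using \<Omega>(1) by (rule borel_measurable_continuous_onI)
  have r[measurable]: "?r \<in> borel_measurable borel" by measurable
  have km: "(\<lambda>p. k (fst p) (snd p)) \<in> borel_measurable (lborel \<Otimes>\<^sub>M borel)"
    unfolding k_def by measurable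
  have lin: "energy_positive (\<lambda>x. ?r (stretch e \<alpha> x))" for \<alpha>
    by (rule energy_positive_linear[OF linear_stretch energy_positive_riesz[OF s] r])
  have lm: "(\<lambda>x. ?r (stretch e \<alpha> x)) \<in> borel_measurable borel" for \<alpha>
    using measurable_compose[OF measurable_Pair1'[of \<alpha> borel borel] measurable_compose[OF stretch_measurable r]] by simp
  have "energy_positive (k \<alpha>)" for \<alpha>
    unfolding k_def by (rule energy_positive_cmult[OF lin lm])
  then have "energy_positive (\<lambda>x. \<integral>\<^sup>+\<alpha>. k \<alpha> x \<partial>lborel)"
    by (rule energy_positive_mixture[OF sigma_finite_lborel km])
  then show "energy_positive (singular_kernel (\<lambda>x. norm x powr (- s) * direction_mean e (s / 2) \<Omega> (angle x)))"
    unfolding k_def stretched_riesz_average[OF e s \<Omega>] .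
  have "(\<lambda>x. \<integral>\<^sup>+\<alpha>. k \<alpha> x \<partial>lborel) \<in> borel_measurable borel"
    using km by (intro lborel.borel_measurable_nn_integral) (simp add: case_prod_beta' measurable_pair_swap_iff[of "\<lambda>p. k (fst p) (snd p)"])
  then show "singular_kernel (\<lambda>x. norm x powr (- s) * direction_mean e (s / 2) \<Omega> (angle x)) \<in> borel_measurable borel"
    unfolding k_def stretched_riesz_average[OF e s \<Omega>] .
qed

text \<open>
  Since \<open>\<Omega>\<close> is bounded below by some \<open>m > 0\<close>, a mean within \<open>\<delta> m\<close> of \<open>\<Omega>\<close> is within a factor
  \<open>1 \<plusminus> \<delta>\<close> of it.
\<close>

lemma energy_positive_angular:
  fixes \<Omega> :: "real \<Rightarrow> real"
  assumes s: "1 \<le> s" and \<Omega>: "continuous_on UNIV \<Omega>" "\<And>\<theta>. 0 < \<Omega> \<theta>" "\<And>\<theta>. \<Omega> (\<theta> + pi) = \<Omega> \<theta>"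
  shows "energy_positive (singular_kernel (\<lambda>x. norm x powr (- s) * \<Omega> (angle x)))"
proof (rule energy_positive_closure)
  fix \<delta> :: real assume \<delta>: "0 < \<delta>" "\<delta> < 1"
  obtain m where m: "m > 0" "\<And>\<theta>. m \<le> \<Omega> \<theta>"
    using periodic_bounded_uniformly_continuous(3)[OF \<Omega>(1,3,2)] by auto
  obtain e0 where e0: "e0 > 0" "\<And>e \<theta>. 0 < e \<Longrightarrow> e < e0 \<Longrightarrow> \<bar>direction_mean e (s / 2) \<Omega> \<theta> - \<Omega> \<theta>\<bar> \<le> \<delta> * m"
    using direction_mean_approximates[OF \<Omega>(1,3), of "s / 2" "\<delta> * m"] s \<delta> m by auto
  define e where "e = min 1 (e0 / 2)"
  have e: "0 < e" "e \<le> 1" "e < e0" using e0(1) by (auto simp: e_def)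
  have s0: "s > 0" using s by simp
  let ?A = "direction_mean e (s / 2) \<Omega>"
  have A: "m \<le> ?A \<theta>" for \<theta> using direction_mean_bounds(2)[OF e(1,2) _ \<Omega>(1), of "s / 2" m] m s by simp
  have close: "(1 - \<delta>) * ?A \<theta> \<le> \<Omega> \<theta>" "\<Omega> \<theta> \<le> (1 + \<delta>) * ?A \<theta>" for \<theta>
  proof -
    have "\<delta> * m \<le> \<delta> * ?A \<theta>" using A \<delta> by (intro mult_left_mono) auto
    then show "(1 - \<delta>) * ?A \<theta> \<le> \<Omega> \<theta>" "\<Omega> \<theta> \<le> (1 + \<delta>) * ?A \<theta>"
      using e0(2)[OF e(1,3), of \<theta>] by (auto simp: algebra_simps abs_le_iff)
  qed
  have A0: "0 \<le> ?A \<theta>" for \<theta> using A[of \<theta>] m by linarith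
  let ?k' = "singular_kernel (\<lambda>x. norm x powr (- s) * ?A (angle x))"
  let ?k = "singular_kernel (\<lambda>x. norm x powr (- s) * \<Omega> (angle x))"
  have "ennreal (1 - \<delta>) * ?k' x \<le> ?k x \<and> ?k x \<le> ennreal (1 + \<delta>) * ?k' x" for x
  proof (cases "x = 0")
    case True then show ?thesis using \<delta> by (simp add: singular_kernel_def ennreal_mult_top del: ennreal_plus)
  next
    case False
    have "(1 - \<delta>) * (norm x powr (- s) * ?A (angle x)) \<le> norm x powr (- s) * \<Omega> (angle x)"
      using mult_left_mono[OF close(1)[of "angle x"], of "norm x powr (- s)"] by (simp add: mult_ac)
    moreover have "norm x powr (- s) * \<Omega> (angle x) \<le> (1 + \<delta>) * (norm x powr (- s) * ?A (angle x))"
      using mult_left_mono[OF close(2)[of "angle x"], of "norm x powr (- s)"] by (simp add: mult_ac)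
    ultimately show ?thesis using False \<delta> A0
      by (simp add: singular_kernel_def ennreal_mult[symmetric] del: ennreal_plus) (simp add: ennreal_leI)
  qed
  then show "\<exists>k'. energy_positive k' \<and> k' \<in> borel_measurable borel \<and>
      (\<forall>x. ennreal (1 - \<delta>) * k' x \<le> ?k x \<and> ?k x \<le> ennreal (1 + \<delta>) * k' x)"
    using energy_positive_direction_mean[OF e(1,2) s0 \<Omega>] by blast
qed

lemma energy_definite_cmult:
  assumes k: "energy_definite k" "k \<in> borel_measurable borel" and c: "0 < c" "c < \<infinity>"
  shows "energy_definite (\<lambda>x. c * k x)"
  unfolding energy_definite_def
proof (intro allI impI)
  fix \<mu> \<nu> :: "(real^2) measure" assume \<mu>: "compactly_supported_prob \<mu>" and \<nu>: "compactly_supported_prob \<nu>" and ne: "\<mu> \<noteq> \<nu>"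
  note eqs = mutual_energy_cmult[OF \<mu> \<mu> k(2)] mutual_energy_cmult[OF \<mu> \<nu> k(2)]
    mutual_energy_cmult[OF \<nu> \<mu> k(2)] mutual_energy_cmult[OF \<nu> \<nu> k(2)]
  assume "mutual_energy (\<lambda>x. c * k x) \<mu> \<mu> + mutual_energy (\<lambda>x. c * k x) \<nu> \<nu> < \<infinity>"
  then have "mutual_energy k \<mu> \<mu> + mutual_energy k \<nu> \<nu> < \<infinity>"
    unfolding eqs distrib_left[symmetric] using c by (auto simp: ennreal_mult_less_top)
  then have "mutual_energy k \<mu> \<nu> + mutual_energy k \<nu> \<mu> < mutual_energy k \<mu> \<mu> + mutual_energy k \<nu> \<nu>"
    using k(1) \<mu> \<nu> ne by (auto simp: energy_definite_def)
  then show "mutual_energy (\<lambda>x. c * k x) \<mu> \<nu> + mutual_energy (\<lambda>x. c * k x) \<nu> \<mu>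
      < mutual_energy (\<lambda>x. c * k x) \<mu> \<mu> + mutual_energy (\<lambda>x. c * k x) \<nu> \<nu>"
    unfolding eqs distrib_left[symmetric] using c by (intro ennreal_mult_strict_left_mono) auto
qed

text \<open>
  Split \<open>\<Omega> = (\<Omega> - m/2) + m/2\<close>: the first profile is still positive and gives a positive energy, the
  second one is isotropic and gives a definite energy.
\<close>

lemma energy_definite_angular:
  fixes \<Omega> :: "real \<Rightarrow> real"
  assumes s: "1 \<le> s" and \<Omega>: "continuous_on UNIV \<Omega>" "\<And>\<theta>. 0 < \<Omega> \<theta>" "\<And>\<theta>. \<Omega> (\<theta> + pi) = \<Omega> \<theta>"
  shows "energy_definite (singular_kernel (\<lambda>x. norm x powr (- s) * \<Omega> (angle x)))"
proof -
  obtain m where m: "m > 0" "\<And>\<theta>. m \<le> \<Omega> \<theta>"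
    using periodic_bounded_uniformly_continuous(3)[OF \<Omega>(1,3,2)] by auto
  define \<Omega>' where "\<Omega>' \<theta> = \<Omega> \<theta> - m / 2" for \<theta>
  have \<Omega>': "continuous_on UNIV \<Omega>'" "\<And>\<theta>. 0 < \<Omega>' \<theta>" "\<And>\<theta>. \<Omega>' (\<theta> + pi) = \<Omega>' \<theta>"
  proof -
    show "continuous_on UNIV \<Omega>'" unfolding \<Omega>'_def using \<Omega>(1) by (intro continuous_intros)
    show "0 < \<Omega>' \<theta>" "\<Omega>' (\<theta> + pi) = \<Omega>' \<theta>" for \<theta>
      using m(1) m(2)[of \<theta>] \<Omega>(3)[of \<theta>] by (auto simp: \<Omega>'_def)
  qed
  let ?k1 = "singular_kernel (\<lambda>x. norm x powr (- s) * \<Omega>' (angle x))"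
  let ?r = "singular_kernel (\<lambda>x. norm x powr (- s))"
  have [measurable]: "(\<lambda>x. \<Omega>' (angle x)) \<in> borel_measurable borel" by (rule measurable_angle[OF \<Omega>'(1)])
  have k1m: "?k1 \<in> borel_measurable borel" and rm: "?r \<in> borel_measurable borel" by measurable
  have rm': "(\<lambda>x. ennreal (m / 2) * ?r x) \<in> borel_measurable borel" using rm by measurable
  have "energy_definite ?r" using s by (intro energy_definite_riesz) simp
  then have "energy_definite (\<lambda>x. ennreal (m / 2) * ?r x)"
    using m by (intro energy_definite_cmult rm) auto
  then have "energy_definite (\<lambda>x. ?k1 x + ennreal (m / 2) * ?r x)"
    by (rule energy_definite_add[OF energy_positive_angular[OF s \<Omega>'] _ k1m rm'])
  also have "(\<lambda>x. ?k1 x + ennreal (m / 2) * ?r x) = singular_kernel (\<lambda>x. norm x powr (- s) * \<Omega> (angle x))"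
  proof
    fix x :: "real^2"
    have "ennreal (norm x powr (- s) * \<Omega>' (angle x)) + ennreal (m / 2) * ennreal (norm x powr (- s))
        = ennreal (norm x powr (- s) * \<Omega>' (angle x) + m / 2 * norm x powr (- s))"
      using m(1) \<Omega>'(2)[of "angle x"] ennreal_mult[of "m / 2" "norm x powr (- s)"]
      by (subst ennreal_plus) (auto simp: less_imp_le)
    also have "norm x powr (- s) * \<Omega>' (angle x) + m / 2 * norm x powr (- s) = norm x powr (- s) * \<Omega> (angle x)"
      by (simp add: \<Omega>'_def algebra_simps)
    finally show "?k1 x + ennreal (m / 2) * ?r x = singular_kernel (\<lambda>x. norm x powr (- s) * \<Omega> (angle x)) x"
      by (simp add: singular_kernel_def)
  qed
  finally show ?thesis .
qed

section \<open>From definiteness to linear interpolation convexity\<close>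

text \<open>
  From \<open>|x - y|\<^sup>2 = |x|\<^sup>2 + |y|\<^sup>2 - 2 x \<bullet> y\<close>. When the centers of mass coincide, this expression is
  additive in the two measures, which turns the energy inequality into an equality. The second
  statement is needed to compute with the right side in \<open>[0, \<infinity>]\<close>.
\<close>

lemma mutual_energy_quadratic:
  assumes \<mu>: "compactly_supported_prob \<mu>" and \<nu>: "compactly_supported_prob \<nu>"
  shows "mutual_energy (\<lambda>x. ennreal ((norm x)\<^sup>2)) \<mu> \<nu>
    = ennreal ((LINT x|\<mu>. (norm x)\<^sup>2) + (LINT x|\<nu>. (norm x)\<^sup>2) - 2 * (center_of_mass \<mu> \<bullet> center_of_mass \<nu>))"
    and "0 \<le> (LINT x|\<mu>. (norm x)\<^sup>2) + (LINT x|\<nu>. (norm x)\<^sup>2) - 2 * (center_of_mass \<mu> \<bullet> center_of_mass \<nu>)"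
proof -
  note D = compactly_supported_probD[OF \<mu>] compactly_supported_probD[OF \<nu>]
  interpret \<mu>: prob_space \<mu> by fact
  interpret \<nu>: prob_space \<nu> by fact
  note [measurable_cong] = D(3) D(7)
  obtain K where K: "compact K" "AE x in \<mu>. x \<in> K" "AE x in \<nu>. x \<in> K"
    using compactly_supported_prob_common_compact[OF \<mu> \<nu>] .
  have i\<mu>: "integrable \<mu> f" and i\<nu>: "integrable \<nu> f" if "continuous_on UNIV f" for f :: "real^2 \<Rightarrow> 'b::euclidean_space"
    using integrable_continuous_AE_compact[OF \<mu> K(1,2) that] integrable_continuous_AE_compact[OF \<nu> K(1,3) that] by auto
  let ?c = center_of_mass
  have inner: "(LINT y|\<nu>. (norm (x - y))\<^sup>2) = (norm x)\<^sup>2 + (LINT y|\<nu>. (norm y)\<^sup>2) - 2 * (x \<bullet> ?c \<nu>)" for x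
  proof -
    have "(LINT y|\<nu>. (norm (x - y))\<^sup>2) = (LINT y|\<nu>. ((norm x)\<^sup>2 + (norm y)\<^sup>2) - 2 * (x \<bullet> y))"
      by (rule Bochner_Integration.integral_cong) (auto simp: power2_norm_eq_inner inner_diff_left inner_diff_right inner_commute)
    also have "\<dots> = (LINT y|\<nu>. (norm x)\<^sup>2) + (LINT y|\<nu>. (norm y)\<^sup>2) - 2 * (LINT y|\<nu>. x \<bullet> y)"
      by (simp add: i\<nu> continuous_intros)
    also have "(LINT y|\<nu>. x \<bullet> y) = x \<bullet> ?c \<nu>"
      unfolding center_of_mass_def by (intro integral_inner_right) (simp add: i\<nu>)
    finally show ?thesis by (simp add: \<nu>.prob_space)
  qed
  have outer: "(LINT x|\<mu>. (norm x)\<^sup>2 + (LINT y|\<nu>. (norm y)\<^sup>2) - 2 * (x \<bullet> ?c \<nu>))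
     = (LINT x|\<mu>. (norm x)\<^sup>2) + (LINT x|\<nu>. (norm x)\<^sup>2) - 2 * (?c \<mu> \<bullet> ?c \<nu>)"
  proof -
    have "(LINT x|\<mu>. x \<bullet> ?c \<nu>) = ?c \<mu> \<bullet> ?c \<nu>"
      unfolding center_of_mass_def[of \<mu>] by (intro integral_inner_left) (simp add: i\<mu>)
    then show ?thesis by (simp add: i\<mu> continuous_intros \<mu>.prob_space)
  qed
  have "mutual_energy (\<lambda>x. ennreal ((norm x)\<^sup>2)) \<mu> \<nu> = (\<integral>\<^sup>+x. ennreal (LINT y|\<nu>. (norm (x - y))\<^sup>2) \<partial>\<mu>)"
    unfolding mutual_energy_def
    by (intro nn_integral_cong nn_integral_eq_integral i\<nu> continuous_intros) auto
  also have "\<dots> = ennreal (LINT x|\<mu>. (LINT y|\<nu>. (norm (x - y))\<^sup>2))"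
  proof (rule nn_integral_eq_integral)
    show "integrable \<mu> (\<lambda>x. LINT y|\<nu>. (norm (x - y))\<^sup>2)"
      unfolding inner by (intro i\<mu> continuous_intros)
  qed auto
  finally show "mutual_energy (\<lambda>x. ennreal ((norm x)\<^sup>2)) \<mu> \<nu>
    = ennreal ((LINT x|\<mu>. (norm x)\<^sup>2) + (LINT x|\<nu>. (norm x)\<^sup>2) - 2 * (?c \<mu> \<bullet> ?c \<nu>))"
    unfolding inner outer .
  show "0 \<le> (LINT x|\<mu>. (norm x)\<^sup>2) + (LINT x|\<nu>. (norm x)\<^sup>2) - 2 * (?c \<mu> \<bullet> ?c \<nu>)"
    unfolding outer[symmetric] inner[symmetric] by simp
qed

lemma sets_interpolation [measurable_cong]: "sets (interpolation \<rho>\<^sub>0 \<rho>\<^sub>1 t) = sets borel"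
  unfolding interpolation_def using sets.sets_measure_of_eq[of "borel :: (real^2) measure"] by simp

lemma nn_integral_interpolation:
  assumes "sets \<rho>\<^sub>0 = sets borel" "sets \<rho>\<^sub>1 = sets borel" and f: "f \<in> borel_measurable borel"
  shows "(\<integral>\<^sup>+x. f x \<partial>(interpolation \<rho>\<^sub>0 \<rho>\<^sub>1 t)) = ennreal (1 - t) * (\<integral>\<^sup>+x. f x \<partial>\<rho>\<^sub>0) + ennreal t * (\<integral>\<^sup>+x. f x \<partial>\<rho>\<^sub>1)"
proof -
  let ?m = "\<lambda>A. ennreal (1 - t) * emeasure \<rho>\<^sub>0 A + ennreal t * emeasure \<rho>\<^sub>1 A"
  note [measurable_cong] = assms(1,2)
  have em: "emeasure (interpolation \<rho>\<^sub>0 \<rho>\<^sub>1 t) A = ?m A" if "A \<in> sets borel" for A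
    unfolding interpolation_def
  proof (rule emeasure_measure_of_sigma)
    show "sigma_algebra UNIV (sets borel)" using sets.sigma_algebra_axioms[of borel] by simp
    show "positive (sets borel) ?m" by (simp add: positive_def)
    show "countably_additive (sets borel) ?m"
    proof (rule countably_additiveI)
      fix A :: "nat \<Rightarrow> (real^2) set" assume A: "range A \<subseteq> sets borel" "disjoint_family A"
      have "(\<Sum>i. ?m (A i)) = (\<Sum>i. ennreal (1 - t) * emeasure \<rho>\<^sub>0 (A i)) + (\<Sum>i. ennreal t * emeasure \<rho>\<^sub>1 (A i))"
        by (rule suminf_add[symmetric]) auto
      also have "\<dots> = ennreal (1 - t) * (\<Sum>i. emeasure \<rho>\<^sub>0 (A i)) + ennreal t * (\<Sum>i. emeasure \<rho>\<^sub>1 (A i))"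
        by simp
      also have "\<dots> = ?m (\<Union>i. A i)" using A assms(1,2) by (simp add: suminf_emeasure)
      finally show "(\<Sum>i. ?m (A i)) = ?m (\<Union>i. A i)" .
    qed
  qed (use that in auto)
  from f show ?thesis
  proof induction
    case (cong f g) then show ?case by (simp cong: nn_integral_cong)
  next
    case (set A) then show ?case using assms(1,2) by (simp add: em sets_interpolation)
  next
    case (mult f c) then show ?case by (simp add: nn_integral_cmult distrib_left mult_ac)
  next
    case (add f g) then show ?case by (simp add: nn_integral_add distrib_left add_ac)
  next
    case (seq U)
    have sup: "(\<integral>\<^sup>+x. (SUP i. U i) x \<partial>N) = (SUP i. \<integral>\<^sup>+x. U i x \<partial>N)" if "sets N = sets borel" for N
    proof -
      have "U i \<in> borel_measurable N" for i using seq.hyps(1)[of i] that by (simp cong: measurable_cong_sets)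
      then show ?thesis using nn_integral_monotone_convergence_SUP[OF seq.hyps(3), of N] by (simp add: image_comp)
    qed
    have inc: "incseq (\<lambda>i. c * (\<integral>\<^sup>+x. U i x \<partial>N))" for c N
      using seq.hyps(3) by (auto simp: incseq_def le_fun_def intro!: mult_left_mono nn_integral_mono)
    have "(\<integral>\<^sup>+x. (SUP i. U i) x \<partial>(interpolation \<rho>\<^sub>0 \<rho>\<^sub>1 t))
      = (SUP i. ennreal (1 - t) * (\<integral>\<^sup>+x. U i x \<partial>\<rho>\<^sub>0) + ennreal t * (\<integral>\<^sup>+x. U i x \<partial>\<rho>\<^sub>1))"
      unfolding sup[OF sets_interpolation] using seq.IH by simp
    then show ?case
      unfolding ennreal_SUP_add[OF inc inc] sup[OF assms(1)] sup[OF assms(2)] SUP_mult_left_ennreal .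
  qed
qed

text \<open>
  Bilinearity of the mutual energy.
\<close>

lemma mutual_energy_interpolation:
  assumes "compactly_supported_prob \<rho>\<^sub>0" "compactly_supported_prob \<rho>\<^sub>1" and [measurable]: "k \<in> borel_measurable borel"
  shows "mutual_energy k (interpolation \<rho>\<^sub>0 \<rho>\<^sub>1 t) (interpolation \<rho>\<^sub>0 \<rho>\<^sub>1 t)
    = ennreal (1 - t) * (ennreal (1 - t) * mutual_energy k \<rho>\<^sub>0 \<rho>\<^sub>0 + ennreal t * mutual_energy k \<rho>\<^sub>0 \<rho>\<^sub>1)
    + ennreal t * (ennreal (1 - t) * mutual_energy k \<rho>\<^sub>1 \<rho>\<^sub>0 + ennreal t * mutual_energy k \<rho>\<^sub>1 \<rho>\<^sub>1)"
proof -
  note D = compactly_supported_probD[OF assms(1)] compactly_supported_probD[OF assms(2)]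
  interpret \<mu>: prob_space \<rho>\<^sub>0 by fact
  interpret \<nu>: prob_space \<rho>\<^sub>1 by fact
  note [measurable_cong] = D(3) D(7)
  note nni = nn_integral_interpolation[OF D(3) D(7)]
  have inner: "(\<integral>\<^sup>+y. k (x - y) \<partial>(interpolation \<rho>\<^sub>0 \<rho>\<^sub>1 t)) = ennreal (1 - t) * (\<integral>\<^sup>+y. k (x - y) \<partial>\<rho>\<^sub>0) + ennreal t * (\<integral>\<^sup>+y. k (x - y) \<partial>\<rho>\<^sub>1)" for x
    by (rule nni) measurable
  have m: "(\<lambda>x. \<integral>\<^sup>+y. k (x - y) \<partial>\<rho>\<^sub>0) \<in> borel_measurable borel" "(\<lambda>x. \<integral>\<^sup>+y. k (x - y) \<partial>\<rho>\<^sub>1) \<in> borel_measurable borel"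
    by measurable
  have lin: "(\<integral>\<^sup>+x. a * (\<integral>\<^sup>+y. k (x - y) \<partial>\<rho>\<^sub>0) + b * (\<integral>\<^sup>+y. k (x - y) \<partial>\<rho>\<^sub>1) \<partial>N)
     = a * mutual_energy k N \<rho>\<^sub>0 + b * mutual_energy k N \<rho>\<^sub>1" if N: "sets N = sets borel" for a b N
  proof -
    note [measurable_cong] = N
    note [measurable] = m
    show ?thesis unfolding mutual_energy_def by (simp add: nn_integral_add nn_integral_cmult)
  qed
  have "mutual_energy k (interpolation \<rho>\<^sub>0 \<rho>\<^sub>1 t) (interpolation \<rho>\<^sub>0 \<rho>\<^sub>1 t)
    = (\<integral>\<^sup>+x. ennreal (1 - t) * (\<integral>\<^sup>+y. k (x - y) \<partial>\<rho>\<^sub>0) + ennreal t * (\<integral>\<^sup>+y. k (x - y) \<partial>\<rho>\<^sub>1) \<partial>(interpolation \<rho>\<^sub>0 \<rho>\<^sub>1 t))"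
    unfolding mutual_energy_def inner ..
  also have "\<dots> = ennreal (1 - t) * (\<integral>\<^sup>+x. ennreal (1 - t) * (\<integral>\<^sup>+y. k (x - y) \<partial>\<rho>\<^sub>0) + ennreal t * (\<integral>\<^sup>+y. k (x - y) \<partial>\<rho>\<^sub>1) \<partial>\<rho>\<^sub>0)
     + ennreal t * (\<integral>\<^sup>+x. ennreal (1 - t) * (\<integral>\<^sup>+y. k (x - y) \<partial>\<rho>\<^sub>0) + ennreal t * (\<integral>\<^sup>+y. k (x - y) \<partial>\<rho>\<^sub>1) \<partial>\<rho>\<^sub>1)"
    by (rule nni) (use m in measurable)
  finally show ?thesis unfolding lin[OF D(3)] lin[OF D(7)] .
qed

lemma quadratic_strictly_convex:
  fixes p q r :: real
  assumes "q < p + r" "a \<noteq> b" "0 < u" "u < 1"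
  defines "f t \<equiv> (1 - t)\<^sup>2 * p + t * (1 - t) * q + t\<^sup>2 * r"
  shows "f ((1 - u) * a + u * b) < (1 - u) * f a + u * f b"
proof -
  have "(1 - u) * f a + u * f b - f ((1 - u) * a + u * b) = u * (1 - u) * (a - b)\<^sup>2 * (p + r - q)"
    unfolding f_def by (simp add: power2_eq_square algebra_simps)
  also have "\<dots> > 0" using assms by (intro mult_pos_pos) auto
  finally show ?thesis by simp
qed

text \<open>
  By the strict inequality all four mutual energies are finite, so along the interpolation the energy is
  a real quadratic polynomial with positive leading coefficient.
\<close>

lemma LIC_if_energy_definite_on_equal_centers:
  assumes k: "k \<in> borel_measurable borel"
    and strict: "\<And>\<mu> \<nu>. compactly_supported_prob \<mu> \<Longrightarrow> compactly_supported_prob \<nu> \<Longrightarrow> \<mu> \<noteq> \<nu> \<Longrightarrow>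
      center_of_mass \<mu> = center_of_mass \<nu> \<Longrightarrow> mutual_energy k \<mu> \<mu> + mutual_energy k \<nu> \<nu> < \<infinity> \<Longrightarrow>
      mutual_energy k \<mu> \<nu> + mutual_energy k \<nu> \<mu> < mutual_energy k \<mu> \<mu> + mutual_energy k \<nu> \<nu>"
  shows "LIC k"
  unfolding LIC_def
proof (intro allI impI, elim conjE)
  fix \<mu> \<nu> assume \<mu>: "compactly_supported_prob \<mu>" and \<nu>: "compactly_supported_prob \<nu>" and ne: "\<mu> \<noteq> \<nu>"
    and fin: "energy k \<mu> < \<infinity>" "energy k \<nu> < \<infinity>" and c: "center_of_mass \<mu> = center_of_mass \<nu>"
  have E: "energy k \<rho> = (1 / 2) * mutual_energy k \<rho> \<rho>" for \<rho> by (simp add: energy_def mutual_energy_def)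
  have half: "(1 / 2 :: ennreal) = ennreal (1 / 2)"
    using divide_ennreal[of 1 2] by simp
  have fin': "mutual_energy k \<mu> \<mu> < \<infinity>" "mutual_energy k \<nu> \<nu> < \<infinity>"
    using fin unfolding E half by (auto simp: ennreal_mult_less_top)
  then have lt: "mutual_energy k \<mu> \<nu> + mutual_energy k \<nu> \<mu> < mutual_energy k \<mu> \<mu> + mutual_energy k \<nu> \<nu>"
    using strict[OF \<mu> \<nu> ne c] by simp
  also have "\<dots> < \<infinity>" using fin' by simp
  finally have fin'': "mutual_energy k \<mu> \<nu> < \<infinity>" "mutual_energy k \<nu> \<mu> < \<infinity>" by auto
  obtain p where p: "p \<ge> 0" "mutual_energy k \<mu> \<mu> = ennreal p" using fin'(1) by (cases "mutual_energy k \<mu> \<mu>") auto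
  obtain r where r: "r \<ge> 0" "mutual_energy k \<nu> \<nu> = ennreal r" using fin'(2) by (cases "mutual_energy k \<nu> \<nu>") auto
  obtain q1 where q1: "q1 \<ge> 0" "mutual_energy k \<mu> \<nu> = ennreal q1" using fin''(1) by (cases "mutual_energy k \<mu> \<nu>") auto
  obtain q2 where q2: "q2 \<ge> 0" "mutual_energy k \<nu> \<mu> = ennreal q2" using fin''(2) by (cases "mutual_energy k \<nu> \<mu>") auto
  have less: "q1 + q2 < p + r"
    using lt p r q1 q2 by (simp add: ennreal_plus[symmetric] ennreal_less_iff del: ennreal_plus)
  define f where "f t = (1 - t)\<^sup>2 * p + t * (1 - t) * (q1 + q2) + t\<^sup>2 * r" for t
  have f: "energy k (interpolation \<mu> \<nu> t) = ennreal (f t / 2)" and f0: "0 \<le> f t" if t: "t \<in> {0..1}" for t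
  proof -
    have "mutual_energy k (interpolation \<mu> \<nu> t) (interpolation \<mu> \<nu> t)
      = ennreal ((1 - t) * ((1 - t) * p + t * q1) + t * ((1 - t) * q2 + t * r))"
      unfolding mutual_energy_interpolation[OF \<mu> \<nu> k] p(2) q1(2) q2(2) r(2)
      using t p(1) q1(1) q2(1) r(1) by (simp add: ennreal_mult)
    also have "(1 - t) * ((1 - t) * p + t * q1) + t * ((1 - t) * q2 + t * r) = f t"
      by (simp add: f_def power2_eq_square algebra_simps)
    finally have me: "mutual_energy k (interpolation \<mu> \<nu> t) (interpolation \<mu> \<nu> t) = ennreal (f t)" .
    have "ennreal (1 / 2) * ennreal (f t) = ennreal (1 / 2 * f t)" by (rule ennreal_mult'[symmetric]) simp
    then show "energy k (interpolation \<mu> \<nu> t) = ennreal (f t / 2)"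
      unfolding E half me by (simp only: times_divide_eq_left mult_1)
    show "0 \<le> f t" unfolding f_def using t p(1) q1(1) q2(1) r(1) by simp
  qed
  show "strictly_convex_on {0..1} (\<lambda>t. energy k (interpolation \<mu> \<nu> t))"
    unfolding strictly_convex_on_def
  proof (intro conjI ballI allI impI)
    fix a b u :: real assume ab: "a \<in> {0..1}" "b \<in> {0..1}" and u: "a \<noteq> b \<and> 0 < u \<and> u < 1"
    have m: "(1 - u) * a + u * b \<in> {0..1}"
      using convexD_alt[OF convex_real_interval(5)[of 0 1] ab, of u] u by simp
    have "f ((1 - u) * a + u * b) < (1 - u) * f a + u * f b"
      unfolding f_def using less u by (intro quadratic_strictly_convex) auto
    moreover have "ennreal (1 - u) * ennreal (f a / 2) + ennreal u * ennreal (f b / 2) = ennreal (((1 - u) * f a + u * f b) / 2)"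
      using u f0[OF ab(1)] f0[OF ab(2)] 
      by (simp add: ennreal_mult[symmetric] ennreal_plus[symmetric] add_divide_distrib del: ennreal_plus)
    ultimately show "energy k (interpolation \<mu> \<nu> ((1 - u) * a + u * b))
       < ennreal (1 - u) * energy k (interpolation \<mu> \<nu> a) + ennreal u * energy k (interpolation \<mu> \<nu> b)"
      unfolding f[OF m] f[OF ab(1)] f[OF ab(2)] using f0[OF m] by (simp add: ennreal_less_iff)
  qed (rule convex_real_interval)
qed

theorem LIC_aniso_potential:
  fixes \<Omega> :: "real \<Rightarrow> real"
  assumes s: "1 \<le> s" and \<Omega>: "continuous_on UNIV \<Omega>" "\<And>\<theta>. 0 < \<Omega> \<theta>" "\<And>\<theta>. \<Omega> (\<theta> + pi) = \<Omega> \<theta>"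
  shows "LIC (singular_kernel (aniso_potential s \<Omega>))"
proof -
  let ?k = "singular_kernel (\<lambda>x. norm x powr (- s) * \<Omega> (angle x))"
  let ?q = "\<lambda>x::real^2. ennreal ((norm x)\<^sup>2)"
  have [measurable]: "(\<lambda>x. \<Omega> (angle x)) \<in> borel_measurable borel" by (rule measurable_angle[OF \<Omega>(1)])
  have km: "?k \<in> borel_measurable borel" and qm: "?q \<in> borel_measurable borel" by measurable
  have split: "singular_kernel (aniso_potential s \<Omega>) = (\<lambda>x. ?k x + ?q x)"
    using \<Omega>(2)[THEN less_imp_le] by (auto simp: fun_eq_iff singular_kernel_def aniso_potential_def)
  show ?thesis unfolding split
  proof (rule LIC_if_energy_definite_on_equal_centers)
    fix \<mu> \<nu> assume \<mu>: "compactly_supported_prob \<mu>" and \<nu>: "compactly_supported_prob \<nu>" and ne: "\<mu> \<noteq> \<nu>"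
      and c: "center_of_mass \<mu> = center_of_mass \<nu>"
      and fin: "mutual_energy (\<lambda>x. ?k x + ?q x) \<mu> \<mu> + mutual_energy (\<lambda>x. ?k x + ?q x) \<nu> \<nu> < \<infinity>"
    note add = mutual_energy_add[OF \<mu> \<mu> km qm] mutual_energy_add[OF \<mu> \<nu> km qm]
      mutual_energy_add[OF \<nu> \<mu> km qm] mutual_energy_add[OF \<nu> \<nu> km qm]
    have "mutual_energy ?k \<mu> \<mu> + mutual_energy ?k \<nu> \<nu> < \<infinity>" using fin by (auto simp: add)
    then have less: "mutual_energy ?k \<mu> \<nu> + mutual_energy ?k \<nu> \<mu> < mutual_energy ?k \<mu> \<mu> + mutual_energy ?k \<nu> \<nu>"
      using energy_definite_angular[OF s \<Omega>] \<mu> \<nu> ne unfolding energy_definite_def by blast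
    have q: "mutual_energy ?q \<mu> \<nu> + mutual_energy ?q \<nu> \<mu> = mutual_energy ?q \<mu> \<mu> + mutual_energy ?q \<nu> \<nu>"
      using mutual_energy_quadratic(2)[OF \<mu> \<nu>] mutual_energy_quadratic(2)[OF \<nu> \<mu>]
        mutual_energy_quadratic(2)[OF \<mu> \<mu>] mutual_energy_quadratic(2)[OF \<nu> \<nu>] c
      unfolding mutual_energy_quadratic(1)[OF \<mu> \<nu>] mutual_energy_quadratic(1)[OF \<nu> \<mu>]
        mutual_energy_quadratic(1)[OF \<mu> \<mu>] mutual_energy_quadratic(1)[OF \<nu> \<nu>]
      by (simp add: ennreal_plus[symmetric] algebra_simps del: ennreal_plus)
    have "mutual_energy ?q \<mu> \<nu> + mutual_energy ?q \<nu> \<mu> \<noteq> \<infinity>"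
      by (simp add: mutual_energy_quadratic(1) \<mu> \<nu>)
    then have "(mutual_energy ?q \<mu> \<nu> + mutual_energy ?q \<nu> \<mu>) + (mutual_energy ?k \<mu> \<nu> + mutual_energy ?k \<nu> \<mu>)
      < (mutual_energy ?q \<mu> \<nu> + mutual_energy ?q \<nu> \<mu>) + (mutual_energy ?k \<mu> \<mu> + mutual_energy ?k \<nu> \<nu>)"
      using less by (simp add: ennreal_add_left_cancel_less)
    then have "(mutual_energy ?q \<mu> \<nu> + mutual_energy ?q \<nu> \<mu>) + (mutual_energy ?k \<mu> \<nu> + mutual_energy ?k \<nu> \<mu>)
      < (mutual_energy ?q \<mu> \<mu> + mutual_energy ?q \<nu> \<nu>) + (mutual_energy ?k \<mu> \<mu> + mutual_energy ?k \<nu> \<nu>)"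
      by (simp only: q)
    then show "mutual_energy (\<lambda>x. ?k x + ?q x) \<mu> \<nu> + mutual_energy (\<lambda>x. ?k x + ?q x) \<nu> \<mu>
       < mutual_energy (\<lambda>x. ?k x + ?q x) \<mu> \<mu> + mutual_energy (\<lambda>x. ?k x + ?q x) \<nu> \<nu>"
      unfolding add by (simp only: ac_simps)
  qed (use km qm in measurable)
qed

section \<open>The Fourier transform of a Riesz potential\<close>

lemma fourier_kernel_norm: "norm (wave r :: complex) = 1" for r :: real
  using norm_exp_i_times[of "- (2 * pi * r)"] by (simp add: mult_ac)

lemma fourier_measurable [measurable]:
  assumes [measurable]: "\<phi> \<in> borel_measurable borel"
  shows "fourier \<phi> \<in> borel_measurable borel"
  unfolding fourier_def[abs_def] by measurable

lemma fourier_norm_le: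
  assumes "integrable lborel \<phi>"
  shows "norm (fourier \<phi> \<xi>) \<le> (LINT x|lborel. norm (\<phi> x))"
proof -
  have "norm (fourier \<phi> \<xi>) \<le> (LINT x|lborel. norm (\<phi> x * wave (x \<bullet> \<xi>)))"
    unfolding fourier_def by (rule integral_norm_bound)
  then show ?thesis by (simp add: norm_mult fourier_kernel_norm)
qed

text \<open>
  The multiplication formula moves the transform from the potential to the test function.
\<close>

lemma fourier_multiplication:
  assumes f: "integrable lborel f" and g: "integrable lborel g"
  shows "(LINT x|lborel. f x * fourier g x) = (LINT x|lborel. fourier f x * g x)"
proof -
  have [measurable]: "f \<in> borel_measurable borel" "g \<in> borel_measurable borel"
    using f g by (auto dest: borel_measurable_integrable)
  let ?e = "\<lambda>r::real. wave r :: complex"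
  have int: "integrable (lborel \<Otimes>\<^sub>M lborel) (\<lambda>(x, y). f x * g y * ?e (x \<bullet> y))"
  proof (rule lborel_pair.Fubini_integrable)
    show "integrable lborel (\<lambda>x. \<integral>y. norm (case (x, y) of (x, y) \<Rightarrow> f x * g y * ?e (x \<bullet> y)) \<partial>lborel)"
      using f g by (simp add: norm_mult fourier_kernel_norm)
    show "AE x in lborel. integrable lborel (\<lambda>y. case (x, y) of (x, y) \<Rightarrow> f x * g y * ?e (x \<bullet> y))"
    proof (intro AE_I2)
      fix x
      show "integrable lborel (\<lambda>y. case (x, y) of (x, y) \<Rightarrow> f x * g y * ?e (x \<bullet> y))"
        by (rule Bochner_Integration.integrable_bound[OF integrable_mult_right[OF g, of "f x"]])
          (auto simp: norm_mult fourier_kernel_norm)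
    qed
  qed measurable
  have "(LINT x|lborel. f x * fourier g x) = (\<integral>x. \<integral>y. f x * g y * ?e (x \<bullet> y) \<partial>lborel \<partial>lborel)"
    unfolding fourier_def integral_mult_right_zero[symmetric] by (simp add: mult_ac inner_commute)
  also have "\<dots> = (\<integral>y. \<integral>x. f x * g y * ?e (x \<bullet> y) \<partial>lborel \<partial>lborel)"
    by (rule lborel_pair.Fubini_integral[OF int, symmetric])
  also have "\<dots> = (LINT y|lborel. fourier f y * g y)"
    unfolding fourier_def integral_mult_left_zero[symmetric] by (simp add: mult_ac)
  finally show ?thesis .
qed

text \<open>
  If \<open>K\<close> is a superposition of nonnegative functions \<open>k t\<close>, then pairing with \<open>\<psi>\<close> commutes with the
  superposition. The point 0 is excepted because the superpositions below are infinite there.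
\<close>

lemma mixture_Fubini:
  fixes k :: "real \<Rightarrow> real^2 \<Rightarrow> real" and \<psi> :: "real^2 \<Rightarrow> complex"
  assumes k[measurable]: "(\<lambda>p. k (fst p) (snd p)) \<in> borel_measurable (borel \<Otimes>\<^sub>M borel)" and k0: "\<And>t x. 0 \<le> k t x"
    and K: "\<And>x. x \<noteq> 0 \<Longrightarrow> (\<integral>\<^sup>+t. ennreal (k t x) \<partial>lborel) = ennreal (K x)" and K0: "\<And>x. 0 \<le> K x"
    and [measurable]: "\<psi> \<in> borel_measurable borel" and int: "integrable lborel (\<lambda>x. of_real (K x) * \<psi> x)"
  shows "(LINT x|lborel. of_real (K x) * \<psi> x) = (LINT t|lborel. (LINT x|lborel. of_real (k t x) * \<psi> x))"
proof -
  have [measurable (raw)]: "(\<lambda>p. k (g p) (h p)) \<in> borel_measurable N" if "g \<in> measurable N borel" "h \<in> measurable N borel" for g h N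
    using measurable_compose[OF measurable_Pair[OF that] k] by simp
  have kint: "integrable lborel (\<lambda>t. k t x)" "(LINT t|lborel. k t x) = K x" if "x \<noteq> 0" for x
  proof -
    have "has_bochner_integral lborel (\<lambda>t. k t x) (K x)"
      by (rule has_bochner_integral_nn_integral) (use K[OF that] K0 k0 in auto)
    then show "integrable lborel (\<lambda>t. k t x)" "(LINT t|lborel. k t x) = K x" by (auto simp: has_bochner_integral_iff)
  qed
  have ne: "AE x::real^2 in lborel. x \<noteq> 0" by (rule AE_lborel_singleton)
  have i2: "integrable (lborel \<Otimes>\<^sub>M lborel) (\<lambda>(x, t). of_real (k t x) * \<psi> x)"
  proof (rule lborel_pair.Fubini_integrable)
    have "AE x in lborel. (\<integral>t. norm (case (x, t) of (x, t) \<Rightarrow> of_real (k t x) * \<psi> x) \<partial>lborel) = norm (of_real (K x) * \<psi> x)"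
      using ne by eventually_elim (auto simp: norm_mult k0 kint K0)
    then show "integrable lborel (\<lambda>x. \<integral>t. norm (case (x, t) of (x, t) \<Rightarrow> of_real (k t x) * \<psi> x) \<partial>lborel)"
      by (subst integrable_cong_AE[OF _ _ \<open>AE x in lborel. _ x = _ x\<close>]) (use integrable_norm[OF int] int in \<open>auto dest: borel_measurable_integrable\<close>)
    show "AE x in lborel. integrable lborel (\<lambda>t. case (x, t) of (x, t) \<Rightarrow> of_real (k t x) * \<psi> x)"
      using ne by eventually_elim (auto simp: kint)
  qed measurable
  have "(LINT x|lborel. of_real (K x) * \<psi> x) = (\<integral>x. \<integral>t. of_real (k t x) * \<psi> x \<partial>lborel \<partial>lborel)"
  proof (rule integral_cong_AE)
    show "AE x in lborel. of_real (K x) * \<psi> x = (\<integral>t. of_real (k t x) * \<psi> x \<partial>lborel)"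
      using ne by eventually_elim (simp add: kint)
  qed (use int in \<open>auto dest: borel_measurable_integrable\<close>)
  also have "\<dots> = (LINT t|lborel. (LINT x|lborel. of_real (k t x) * \<psi> x))"
    by (rule lborel_pair.Fubini_integral[OF i2, symmetric])
  finally show ?thesis .
qed

text \<open>
  The integrability that makes both sides of the Fourier identity for \<open>|x|^{-s}\<close> converge absolutely.
  Besides test functions it admits the Gaussian, which serves to compare normalizing constants, and it
  is stable under invertible linear maps.
\<close>

definition fourier_admissible :: "real \<Rightarrow> (real^2 \<Rightarrow> complex) \<Rightarrow> bool" where
  "fourier_admissible s \<phi> \<longleftrightarrow> integrable lborel \<phi> \<and>
     integrable lborel (\<lambda>x. of_real (norm x powr (- s)) * fourier \<phi> x) \<and>
     integrable lborel (\<lambda>\<xi>. of_real (norm \<xi> powr (- (2 - s))) * \<phi> \<xi>)"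

text \<open>
  The transform of \<open>exp (- t |x|\<^sup>2)\<close> is \<open>(\<pi> / t) exp (- \<pi>\<^sup>2 |\<xi>|\<^sup>2 / t)\<close>. With the weight \<open>t powr (s/2 - 1)\<close> from
  the Gaussian mixture of \<open>|x|^{-s}\<close>, this is the value at \<open>|\<xi>| = 1\<close> of the superposition of these
  transforms.
\<close>

definition dual_mass :: "real \<Rightarrow> ennreal" where
  "dual_mass s = (\<integral>\<^sup>+t. ennreal (indicator {0<..} t * (pi * t powr (s / 2 - 2) * exp (- (pi\<^sup>2 / t)))) \<partial>lborel)"

lemma dual_mass_bounds:
  assumes s: "0 < s" "s < 2"
  shows "0 < dual_mass s" "dual_mass s < \<infinity>"
proof -
  \<comment> \<open>From \<open>exp u \<ge> u\<^sup>2 / 2\<close>. It makes the integrand bounded near 0.\<close>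
  have exp_le: "exp (- (pi\<^sup>2 / t)) \<le> 2 * t\<^sup>2" if "t > 0" for t :: real
  proof -
    have p: "pi\<^sup>2 \<ge> 1" using pi_gt3 by (simp add: one_le_power)
    define u where "u = pi\<^sup>2 / t"
    have u: "u \<ge> 1 / t" using p that by (simp add: u_def divide_right_mono)
    have "1 / (2 * t\<^sup>2) = (1 / t)\<^sup>2 / 2" by (simp add: power_divide)
    also have "\<dots> \<le> u\<^sup>2 / 2" using u that by (intro divide_right_mono power_mono) auto
    also have "\<dots> \<le> exp u" using exp_lower_Taylor_quadratic[of u] u that
      by (smt (verit) divide_pos_pos zero_le_divide_iff)
    finally have "1 / exp u \<le> 1 / (1 / (2 * t\<^sup>2))" using that by (intro divide_left_mono) auto
    then show ?thesis by (simp add: u_def exp_minus inverse_eq_divide)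
  qed
  let ?g = "\<lambda>t::real. indicator {0..1} t * (2 * pi) + indicator {1..} t * (pi * t powr (s / 2 - 2))"
  have le: "indicator {0<..} t * (pi * t powr (s / 2 - 2) * exp (- (pi\<^sup>2 / t))) \<le> ?g t" for t :: real
  proof (cases "0 < t")
    case True
    show ?thesis
    proof (cases "t \<le> 1")
      case True
      have "t powr (s / 2 - 2) * exp (- (pi\<^sup>2 / t)) \<le> t powr (s / 2 - 2) * (2 * t\<^sup>2)"
        using exp_le[OF \<open>0 < t\<close>] by (intro mult_left_mono) auto
      also have "\<dots> = 2 * t powr (s / 2)"
        using \<open>0 < t\<close> by (simp add: powr_diff powr_numeral)
      also have "\<dots> \<le> 2 * 1" using True \<open>0 < t\<close> s by (intro mult_left_mono powr_le1) auto
      finally have "pi * (t powr (s / 2 - 2) * exp (- (pi\<^sup>2 / t))) \<le> pi * 2" by (intro mult_left_mono) auto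
      then show ?thesis using True \<open>0 < t\<close> by (auto simp: indicator_def)
    next
      case False
      have "t powr (s / 2 - 2) * exp (- (pi\<^sup>2 / t)) \<le> t powr (s / 2 - 2) * 1"
        using \<open>0 < t\<close> by (intro mult_left_mono) auto
      then show ?thesis using False \<open>0 < t\<close> by (auto simp: indicator_def mult.assoc)
    qed
  qed (auto simp: indicator_def)
  have "((\<lambda>t. t powr (s / 2 - 2)) has_integral - (1 powr (s / 2 - 2 + 1)) / (s / 2 - 2 + 1)) {1..}"
    using s by (intro has_integral_powr_to_inf) auto
  from has_integral_mult_right[OF this, of pi]
  have "(\<integral>\<^sup>+t. ennreal (indicator {1..} t * (pi * t powr (s / 2 - 2))) \<partial>lborel) = ennreal (pi * (- (1 powr (s / 2 - 2 + 1)) / (s / 2 - 2 + 1)))"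
    by (intro nn_integral_has_integral_lebesgue) auto
  then have 1: "(\<integral>\<^sup>+t. ennreal (indicator {1..} t * (pi * t powr (s / 2 - 2))) \<partial>lborel) < \<infinity>" by simp
  have "(\<integral>\<^sup>+t. ennreal (indicator {0..1::real} t * (2 * pi)) \<partial>lborel) = ennreal (2 * pi) * emeasure lborel {0..1::real}"
    by (subst nn_integral_cmult_indicator[symmetric]) (auto simp: ennreal_mult' ennreal_indicator mult.commute intro!: nn_integral_cong)
  then have 2: "(\<integral>\<^sup>+t. ennreal (indicator {0..1::real} t * (2 * pi)) \<partial>lborel) < \<infinity>"
    by (simp add: ennreal_mult_less_top)
  have "dual_mass s \<le> (\<integral>\<^sup>+t. ennreal (?g t) \<partial>lborel)"
    unfolding dual_mass_def using le by (intro nn_integral_mono ennreal_leI)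
  also have "\<dots> = (\<integral>\<^sup>+t. ennreal (indicator {0..1::real} t * (2 * pi)) \<partial>lborel) + (\<integral>\<^sup>+t. ennreal (indicator {1..} t * (pi * t powr (s / 2 - 2))) \<partial>lborel)"
    by (subst nn_integral_add[symmetric]) (auto intro!: nn_integral_cong simp: ennreal_plus)
  also have "\<dots> < \<infinity>" using 1 2 by simp
  finally show "dual_mass s < \<infinity>" .
  have "\<not> (AE t in lborel. ennreal (indicator {0<..} t * (pi * t powr (s / 2 - 2) * exp (- (pi\<^sup>2 / t)))) = 0)"
  proof
    assume "AE t in lborel. ennreal (indicator {0<..} t * (pi * t powr (s / 2 - 2) * exp (- (pi\<^sup>2 / t)))) = 0"
    then have "AE t in lborel. t \<notin> {0::real<..}"
      by eventually_elim (use pi_gt_zero in \<open>auto simp: indicator_def ennreal_eq_0_iff mult_le_0_iff not_le[symmetric] split: if_splits split_of_bool_asm\<close>)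
    then have "emeasure lborel {0::real<..} = 0" by (subst (asm) AE_iff_measurable[OF _ refl]) (auto simp: greaterThan_def)
    moreover have "emeasure lborel {0<..<1::real} \<le> emeasure lborel {0::real<..}" by (rule emeasure_mono) auto
    ultimately show False by simp
  qed
  then show "0 < dual_mass s" unfolding dual_mass_def by (simp add: nn_integral_0_iff_AE zero_less_iff_neq_zero)
qed

text \<open>
  Substitution of \<open>c\<^sup>2 t\<close> for \<open>t\<close>; the homogeneity of the transform of \<open>|x|^{-s}\<close> comes from here.
\<close>

lemma dual_mass_scaled:
  assumes c: "c > 0"
  shows "(\<integral>\<^sup>+t. ennreal (indicator {0<..} t * (pi * t powr (s / 2 - 2) * exp (- (pi\<^sup>2 * c\<^sup>2 / t)))) \<partial>lborel)
    = ennreal (c powr (- (2 - s))) * dual_mass s"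
proof -
  have c2: "c\<^sup>2 > 0" using c by simp
  have "(\<integral>\<^sup>+t. ennreal (indicator {0<..} t * (pi * t powr (s / 2 - 2) * exp (- (pi\<^sup>2 * c\<^sup>2 / t)))) \<partial>lborel)
    = ennreal \<bar>c\<^sup>2\<bar> * (\<integral>\<^sup>+t. ennreal (indicator {0<..} (0 + c\<^sup>2 * t) * (pi * (0 + c\<^sup>2 * t) powr (s / 2 - 2) * exp (- (pi\<^sup>2 * c\<^sup>2 / (0 + c\<^sup>2 * t))))) \<partial>lborel)"
    using c2 by (intro nn_integral_real_affine) auto
  also have "(\<integral>\<^sup>+t. ennreal (indicator {0<..} (0 + c\<^sup>2 * t) * (pi * (0 + c\<^sup>2 * t) powr (s / 2 - 2) * exp (- (pi\<^sup>2 * c\<^sup>2 / (0 + c\<^sup>2 * t))))) \<partial>lborel)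
    = (\<integral>\<^sup>+t. ennreal ((c\<^sup>2) powr (s / 2 - 2)) * ennreal (indicator {0<..} t * (pi * t powr (s / 2 - 2) * exp (- (pi\<^sup>2 / t)))) \<partial>lborel)"
  proof (intro nn_integral_cong)
    fix t :: real
    show "ennreal (indicator {0<..} (0 + c\<^sup>2 * t) * (pi * (0 + c\<^sup>2 * t) powr (s / 2 - 2) * exp (- (pi\<^sup>2 * c\<^sup>2 / (0 + c\<^sup>2 * t)))))
      = ennreal ((c\<^sup>2) powr (s / 2 - 2)) * ennreal (indicator {0<..} t * (pi * t powr (s / 2 - 2) * exp (- (pi\<^sup>2 / t))))"
    proof (cases "0 < t")
      case True
      have "pi\<^sup>2 * c\<^sup>2 / (c\<^sup>2 * t) = pi\<^sup>2 / t" using c2 by simp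
      then show ?thesis using True c2 by (simp add: powr_mult ennreal_mult'[symmetric] mult_ac)
    qed (use c2 in \<open>auto simp: zero_less_mult_iff\<close>)
  qed
  also have "\<dots> = ennreal ((c\<^sup>2) powr (s / 2 - 2)) * dual_mass s"
    unfolding dual_mass_def by (rule nn_integral_cmult) auto
  also have "ennreal \<bar>c\<^sup>2\<bar> * \<dots> = ennreal (c\<^sup>2 * (c\<^sup>2) powr (s / 2 - 2)) * dual_mass s"
    by (simp add: mult.assoc[symmetric] ennreal_mult)
  also have "c\<^sup>2 * (c\<^sup>2) powr (s / 2 - 2) = c powr (- (2 - s))"
  proof -
    have "c\<^sup>2 * (c\<^sup>2) powr (s / 2 - 2) = (c\<^sup>2) powr (1 + (s / 2 - 2))" using c2 by (simp only: powr_mult_base)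
    also have "\<dots> = (c powr 2) powr (1 + (s / 2 - 2))" using c by (simp add: powr_numeral)
    also have "(c powr 2) powr (1 + (s / 2 - 2)) = c powr (2 * (1 + (s / 2 - 2)))" by (rule powr_powr)
    also have "2 * (1 + (s / 2 - 2)) = - (2 - s)" by (simp add: algebra_simps)
    finally show ?thesis .
  qed
  finally show ?thesis .
qed

definition riesz_const :: "real \<Rightarrow> real" where
  "riesz_const s = enn2real (dual_mass s) / Gamma (s / 2)"

lemma riesz_const_pos: "0 < s \<Longrightarrow> s < 2 \<Longrightarrow> riesz_const s > 0"
  using dual_mass_bounds[of s] Gamma_real_pos[of "s / 2"]
  by (auto simp: riesz_const_def enn2real_positive_iff less_top[symmetric] intro!: divide_pos_pos)

text \<open>
  Write \<open>|x|^{-s}\<close> as a Gaussian mixture, transform each Gaussian by the multiplication formula, and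
  recombine.
\<close>

lemma fourier_riesz:
  assumes s: "0 < s" "s < 2" and adm: "fourier_admissible s \<phi>"
  shows "(LINT x|lborel. of_real (norm x powr (- s)) * fourier \<phi> x)
     = of_real (riesz_const s) * (LINT \<xi>|lborel. of_real (norm \<xi> powr (- (2 - s))) * \<phi> \<xi>)"
proof -
  have \<phi>: "integrable lborel \<phi>" and i1: "integrable lborel (\<lambda>x. of_real (norm x powr (- s)) * fourier \<phi> x)"
    and i2: "integrable lborel (\<lambda>\<xi>. of_real (norm \<xi> powr (- (2 - s))) * \<phi> \<xi>)"
    using adm by (auto simp: fourier_admissible_def)
  have [measurable]: "\<phi> \<in> borel_measurable borel" using \<phi> by (auto dest: borel_measurable_integrable)
  have G: "Gamma (s / 2) > 0" using s by (intro Gamma_real_pos) simp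
  define D where "D = enn2real (dual_mass s)"
  have D: "dual_mass s = ennreal D" "D \<ge> 0" using dual_mass_bounds[OF s] by (auto simp: D_def less_top)
  let ?k = "\<lambda>t x. indicator {0<..} t * t powr (s / 2 - 1) * exp (- (t * (norm x)\<^sup>2))"
  let ?l = "\<lambda>t \<xi>. indicator {0<..} t * (pi * t powr (s / 2 - 2) * exp (- (pi\<^sup>2 * (norm \<xi>)\<^sup>2 / t)))"
  have "(LINT x|lborel. of_real (Gamma (s / 2) * norm x powr (- s)) * fourier \<phi> x)
    = (LINT t|lborel. (LINT x|lborel. of_real (?k t x) * fourier \<phi> x))"
  proof (rule mixture_Fubini)
    fix x :: "real^2" assume "x \<noteq> 0"
    then have "norm x powr (- s) = ((norm x)\<^sup>2) powr (- (s / 2))"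
      by (simp add: powr_powr flip: powr_numeral)
    then show "(\<integral>\<^sup>+t. ennreal (?k t x) \<partial>lborel) = ennreal (Gamma (s / 2) * norm x powr (- s))"
      using nn_integral_Gamma_scaled[of "s / 2" "(norm x)\<^sup>2"] s \<open>x \<noteq> 0\<close> by simp
  next
    show "integrable lborel (\<lambda>x. of_real (Gamma (s / 2) * norm x powr (- s)) * fourier \<phi> x)"
      using integrable_mult_right[OF i1, of "of_real (Gamma (s / 2))"] by (simp add: mult.assoc)
  qed (use G in \<open>auto intro!: mult_nonneg_nonneg\<close>)
  also have "\<dots> = (LINT t|lborel. (LINT \<xi>|lborel. of_real (?l t \<xi>) * \<phi> \<xi>))"
  proof (rule Bochner_Integration.integral_cong[OF refl])
    fix t :: real
    show "(LINT x|lborel. of_real (?k t x) * fourier \<phi> x) = (LINT \<xi>|lborel. of_real (?l t \<xi>) * \<phi> \<xi>)"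
    proof (cases "t > 0")
      case True
      have gi: "integrable lborel (\<lambda>x::real^2. complex_of_real (exp (- (t * (norm x)\<^sup>2))))"
        using integrable_gaussian[OF True] by (simp only: complex_of_real_integrable_eq)
      have "(LINT x|lborel. of_real (?k t x) * fourier \<phi> x)
        = of_real (t powr (s / 2 - 1)) * (LINT x|lborel. of_real (exp (- (t * (norm x)\<^sup>2))) * fourier \<phi> x)"
        unfolding integral_mult_right_zero[symmetric] using True by (simp add: mult_ac)
      also have "\<dots> = of_real (t powr (s / 2 - 1)) * (LINT \<xi>|lborel. of_real (pi / t * exp (- (pi\<^sup>2 * (norm \<xi>)\<^sup>2 / t))) * \<phi> \<xi>)"
        unfolding fourier_multiplication[OF gi \<phi>] fourier_gaussian[OF True] ..
      also have "\<dots> = (LINT \<xi>|lborel. of_real (?l t \<xi>) * \<phi> \<xi>)"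
        unfolding integral_mult_right_zero[symmetric]
      proof (rule Bochner_Integration.integral_cong[OF refl])
        fix \<xi> :: "real^2"
        have "t powr (s / 2 - 1) * (pi / t) = pi * t powr (s / 2 - 2)"
          using True powr_diff[of t "s / 2 - 1" 1] by simp
        then have "t powr (s / 2 - 1) * (pi / t) * exp (- (pi\<^sup>2 * (norm \<xi>)\<^sup>2 / t)) = ?l t \<xi>"
          using True by (simp only: indicator_simps greaterThan_iff mult_1)
        then have "t powr (s / 2 - 1) * (pi / t * exp (- (pi\<^sup>2 * (norm \<xi>)\<^sup>2 / t))) = ?l t \<xi>"
          by (simp only: mult.assoc)
        then show "complex_of_real (t powr (s / 2 - 1)) * (of_real (pi / t * exp (- (pi\<^sup>2 * (norm \<xi>)\<^sup>2 / t))) * \<phi> \<xi>)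
          = of_real (?l t \<xi>) * \<phi> \<xi>"
          by (simp only: mult.assoc[symmetric] of_real_mult[symmetric])
      qed
      finally show ?thesis .
    qed simp
  qed
  also have "\<dots> = (LINT \<xi>|lborel. of_real (D * norm \<xi> powr (- (2 - s))) * \<phi> \<xi>)"
  proof (rule mixture_Fubini[symmetric])
    fix \<xi> :: "real^2" assume "\<xi> \<noteq> 0"
    then show "(\<integral>\<^sup>+t. ennreal (?l t \<xi>) \<partial>lborel) = ennreal (D * norm \<xi> powr (- (2 - s)))"
      using dual_mass_scaled[of "norm \<xi>" s] D by (simp add: ennreal_mult'[symmetric] mult.commute)
  next
    show "integrable lborel (\<lambda>\<xi>. of_real (D * norm \<xi> powr (- (2 - s))) * \<phi> \<xi>)"
      using integrable_mult_right[OF i2, of "of_real D"] by (simp add: mult.assoc)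
  qed (use D in \<open>auto intro!: mult_nonneg_nonneg\<close>)
  finally have "of_real (Gamma (s / 2)) * (LINT x|lborel. of_real (norm x powr (- s)) * fourier \<phi> x)
    = of_real D * (LINT \<xi>|lborel. of_real (norm \<xi> powr (- (2 - s))) * \<phi> \<xi>)"
    by (simp add: mult.assoc)
  then have "of_real (Gamma (s / 2)) * (LINT x|lborel. of_real (norm x powr (- s)) * fourier \<phi> x) 
    = of_real (Gamma (s / 2)) * (of_real (riesz_const s) * (LINT \<xi>|lborel. of_real (norm \<xi> powr (- (2 - s))) * \<phi> \<xi>))"
    using G by (simp add: riesz_const_def D_def mult.assoc[symmetric])
  then show ?thesis using G by (simp add: less_imp_neq[symmetric] del: of_real_mult)
qed

section \<open>The Fourier transform of averaged stretched potentials\<close>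

definition unstretch :: "real \<Rightarrow> real \<Rightarrow> real^2 \<Rightarrow> real^2" where
  "unstretch e \<alpha> y = vec2 (y $ 1 / e * cos \<alpha> - y $ 2 * sin \<alpha>) (y $ 1 / e * sin \<alpha> + y $ 2 * cos \<alpha>)"

lemma rotate_back:
  fixes a b c s :: real
  assumes "s\<^sup>2 + c\<^sup>2 = 1"
  shows "(a * c + b * s) * c - (b * c - a * s) * s = a" "(a * c + b * s) * s + (b * c - a * s) * c = b"
    "(a * c - b * s) * c + (a * s + b * c) * s = a" "(a * s + b * c) * c - (a * c - b * s) * s = b"
proof -
  have "(a * c + b * s) * c - (b * c - a * s) * s = a * (s\<^sup>2 + c\<^sup>2)"
    "(a * c + b * s) * s + (b * c - a * s) * c = b * (s\<^sup>2 + c\<^sup>2)"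
    "(a * c - b * s) * c + (a * s + b * c) * s = a * (s\<^sup>2 + c\<^sup>2)"
    "(a * s + b * c) * c - (a * c - b * s) * s = b * (s\<^sup>2 + c\<^sup>2)"
    by (simp_all add: algebra_simps power2_eq_square)
  then show "(a * c + b * s) * c - (b * c - a * s) * s = a" "(a * c + b * s) * s + (b * c - a * s) * c = b"
    "(a * c - b * s) * c + (a * s + b * c) * s = a" "(a * s + b * c) * c - (a * c - b * s) * s = b"
    unfolding assms by simp_all
qed

lemma rotate_inner:
  fixes a b c d u v :: real
  shows "(a * v + b * u) * (c * v + d * u) + (b * v - a * u) * (d * v - c * u) = (a * c + b * d) * (u\<^sup>2 + v\<^sup>2)"
  by (simp add: algebra_simps power2_eq_square)

lemma linear_unstretch: "linear (unstretch e \<alpha>)"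
  by (rule linearI) (auto simp: unstretch_def vec_eq_iff forall_2 algebra_simps add_divide_distrib)

lemma unstretch_stretch: "e > 0 \<Longrightarrow> unstretch e \<alpha> (stretch e \<alpha> x) = x"
  by (simp add: unstretch_def stretch_def vec_eq_iff forall_2 rotate_back)

lemma stretch_unstretch: "e > 0 \<Longrightarrow> stretch e \<alpha> (unstretch e \<alpha> x) = x"
  by (simp add: unstretch_def stretch_def vec_eq_iff forall_2 rotate_back del: times_divide_eq_left)

lemma stretch_inner_dual:
  assumes "e > 0"
  shows "stretch e \<alpha> x \<bullet> stretch (1 / e) \<alpha> y = x \<bullet> y"
proof -
  have "stretch e \<alpha> x \<bullet> stretch (1 / e) \<alpha> y = (x $ 1 * y $ 1 + x $ 2 * y $ 2) * ((sin \<alpha>)\<^sup>2 + (cos \<alpha>)\<^sup>2)"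
    unfolding stretch_def inner_real2 vec2_nth rotate_inner[symmetric] using assms by simp
  then show ?thesis by (simp add: inner_real2)
qed

lemma det_stretch: "det (matrix (stretch e \<alpha>)) = e"
proof -
  have "det (matrix (stretch e \<alpha>)) = e * ((sin \<alpha>)\<^sup>2 + (cos \<alpha>)\<^sup>2)"
  proof -
    have "det (matrix (stretch e \<alpha>)) = e * cos \<alpha> * cos \<alpha> + e * sin \<alpha> * sin \<alpha>"
      unfolding det_2 matrix_def stretch_def by (simp add: axis_def)
    then show ?thesis by (simp only: power2_eq_square distrib_left add.commute mult.assoc)
  qed
  then show ?thesis by simp
qed

lemma stretch_borel [measurable]: "stretch e \<alpha> \<in> borel_measurable borel" "unstretch e \<alpha> \<in> borel_measurable borel"
  using linear_stretch[of e \<alpha>] linear_unstretch[of e \<alpha>]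
  by (auto intro!: borel_measurable_continuous_onI linear_continuous_on simp: linear_conv_bounded_linear)

lemma lborel_stretch: "e > 0 \<Longrightarrow> lborel = density (distr lborel borel (stretch e \<alpha>)) (\<lambda>_. ennreal e)"
  using lborel_distr_linear[OF linear_stretch[of e \<alpha>] linear_unstretch[of e \<alpha>] unstretch_stretch stretch_unstretch]
  by (simp add: det_stretch)

text \<open>
  The map has determinant \<open>e\<close>.
\<close>

lemma lborel_integral_stretch:
  fixes f :: "real^2 \<Rightarrow> 'b::{banach, second_countable_topology}"
  assumes e: "e > 0" and f[measurable]: "f \<in> borel_measurable borel"
  shows "integrable lborel (\<lambda>x. f (stretch e \<alpha> x)) \<longleftrightarrow> integrable lborel f"
    and "(LINT x|lborel. f x) = e *\<^sub>R (LINT x|lborel. f (stretch e \<alpha> x))"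
proof -
  have "integrable lborel f \<longleftrightarrow> integrable (density (distr lborel borel (stretch e \<alpha>)) (\<lambda>_. ennreal e)) f"
    by (subst lborel_stretch[OF e, of \<alpha>]) simp
  also have "\<dots> \<longleftrightarrow> integrable lborel (\<lambda>x. e *\<^sub>R f (stretch e \<alpha> x))"
    using e by (subst integrable_density) (auto simp: integrable_distr_eq)
  also have "\<dots> \<longleftrightarrow> integrable lborel (\<lambda>x. f (stretch e \<alpha> x))"
  proof
    assume "integrable lborel (\<lambda>x. e *\<^sub>R f (stretch e \<alpha> x))"
    from integrable_scaleR_right[OF this, of "1 / e"] show "integrable lborel (\<lambda>x. f (stretch e \<alpha> x))" using e by simp
  qed (rule integrable_scaleR_right)
  finally show "integrable lborel (\<lambda>x. f (stretch e \<alpha> x)) \<longleftrightarrow> integrable lborel f" by simp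
  have "(LINT x|lborel. f x) = (LINT x|density (distr lborel borel (stretch e \<alpha>)) (\<lambda>_. ennreal e). f x)"
    by (subst lborel_stretch[OF e, of \<alpha>]) simp
  also have "\<dots> = (LINT x|lborel. e *\<^sub>R f (stretch e \<alpha> x))"
    using e by (subst integral_density) (auto simp: integral_distr)
  finally show "(LINT x|lborel. f x) = e *\<^sub>R (LINT x|lborel. f (stretch e \<alpha> x))" by simp
qed

lemma stretch_factor_inverse: "e > 0 \<Longrightarrow> stretch_factor (1 / e) \<beta> = stretch_factor e (\<beta> + pi / 2) / e\<^sup>2"
proof -
  assume e: "e > 0"
  have "cos (\<beta> + pi / 2) = - sin \<beta>" "sin (\<beta> + pi / 2) = cos \<beta>" by (simp_all add: cos_add sin_add)
  then show ?thesis using e by (simp add: stretch_factor_def field_simps)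
qed

lemma norm_dual_stretch_powr:
  assumes e: "e > 0"
  shows "norm (stretch (1 / e) \<alpha> \<xi>) powr (- s) = e powr s * (norm \<xi> powr (- s) * stretch_factor e (angle \<xi> + pi / 2 - \<alpha>) powr (- (s / 2)))"
proof -
  have "stretch_factor (1 / e) (angle \<xi> - \<alpha>) powr (- (s / 2)) = (stretch_factor e (angle \<xi> + pi / 2 - \<alpha>) / e\<^sup>2) powr (- (s / 2))"
    using stretch_factor_inverse[OF e, of "angle \<xi> - \<alpha>"] by (simp add: algebra_simps)
  also have "\<dots> = stretch_factor e (angle \<xi> + pi / 2 - \<alpha>) powr (- (s / 2)) / (e\<^sup>2) powr (- (s / 2))"
    by (rule powr_divide)
  also have "(e\<^sup>2) powr (- (s / 2)) = e powr (- s)"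
    using e by (simp add: powr_powr flip: powr_numeral)
  finally have k: "stretch_factor (1 / e) (angle \<xi> - \<alpha>) powr (- (s / 2)) = stretch_factor e (angle \<xi> + pi / 2 - \<alpha>) powr (- (s / 2)) / e powr (- s)" .
  have "x / e powr (- s) = e powr s * x" for x by (simp add: powr_minus_divide)
  then show ?thesis using norm_stretch_powr[of "1 / e" \<alpha> \<xi> s] e unfolding k by (simp only: zero_less_divide_1_iff mult_ac)
qed

lemma stretch_factor_powr_le:
  assumes e: "0 < e" "e \<le> 1" and a: "a \<ge> 0"
  shows "stretch_factor e \<beta> powr (- a) \<le> (e\<^sup>2) powr (- a)"
proof -
  have e2: "0 < e\<^sup>2" using e by simp
  have "e\<^sup>2 * (sin \<beta>)\<^sup>2 \<le> 1 * (sin \<beta>)\<^sup>2" using e by (intro mult_right_mono) (auto simp: power_le_one)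
  moreover have "e\<^sup>2 * (sin \<beta>)\<^sup>2 + e\<^sup>2 * (cos \<beta>)\<^sup>2 = e\<^sup>2" by (simp flip: distrib_left)
  ultimately have "e\<^sup>2 \<le> stretch_factor e \<beta>" unfolding stretch_factor_def by linarith
  then show ?thesis using e2 a by (intro powr_mono2') auto
qed

lemma integrable_bounded_mult:
  fixes F G :: "real^2 \<Rightarrow> complex"
  assumes F: "integrable lborel F" and [measurable]: "g \<in> borel_measurable borel" and b: "\<And>x. \<bar>g x\<bar> \<le> C"
  shows "integrable lborel (\<lambda>x. of_real (g x) * F x)"
proof -
  have [measurable]: "F \<in> borel_measurable borel" using F by (auto dest: borel_measurable_integrable)
  show ?thesis
  proof (rule Bochner_Integration.integrable_bound[OF integrable_mult_right[OF F, of "of_real C"]])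
    show "AE x in lborel. norm (of_real (g x) * F x) \<le> norm (of_real C * F x)"
      using b by (auto simp: norm_mult intro!: mult_right_mono intro: order_trans[OF b abs_ge_self])
  qed measurable
qed

lemma stretch_factor_measurable [measurable]: "stretch_factor e \<in> borel_measurable borel"
  unfolding stretch_factor_def by measurable

text \<open>
  The linear change of variables. The transform of \<open>x \<mapsto> |A x|^{-s}\<close> involves the inverse transpose of
  \<open>A = stretch e \<alpha>\<close>, which is \<open>stretch (1 / e) \<alpha>\<close>. Up to the factor \<open>1 / e\<close> the latter stretches the
  orthogonal direction, whence the offset \<open>\<pi> / 2\<close> of the angle.
\<close>

lemma fourier_stretched_riesz:
  assumes s: "0 < s" "s < 2" and e: "0 < e" "e \<le> 1" and adm: "fourier_admissible s \<phi>"
  shows "(LINT x|lborel. of_real (norm x powr (- s) * stretch_factor e (angle x - \<alpha>) powr (- (s / 2))) * fourier \<phi> x)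
     = of_real (riesz_const s * e powr (1 - s)) *
       (LINT \<xi>|lborel. of_real (norm \<xi> powr (- (2 - s)) * stretch_factor e (angle \<xi> + pi / 2 - \<alpha>) powr (- ((2 - s) / 2))) * \<phi> \<xi>)"
proof -
  let ?A = "stretch e \<alpha>" and ?C = "unstretch e \<alpha>" and ?B = "stretch (1 / e) \<alpha>" and ?D = "unstretch (1 / e) \<alpha>"
  have \<phi>: "integrable lborel \<phi>" and i1: "integrable lborel (\<lambda>x. of_real (norm x powr (- s)) * fourier \<phi> x)"
    and i2: "integrable lborel (\<lambda>\<xi>. of_real (norm \<xi> powr (- (2 - s))) * \<phi> \<xi>)"
    using adm by (auto simp: fourier_admissible_def)
  have [measurable]: "\<phi> \<in> borel_measurable borel" using \<phi> by (auto dest: borel_measurable_integrable)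
  have e': "1 / e > 0" using e by simp
  define \<phi>' where "\<phi>' \<xi> = \<phi> (?D \<xi>)" for \<xi>
  have [measurable]: "\<phi>' \<in> borel_measurable borel" unfolding \<phi>'_def by measurable
  have \<phi>'B: "\<phi>' (?B \<xi>) = \<phi> \<xi>" for \<xi> by (simp add: \<phi>'_def unstretch_stretch[OF e'])
  \<comment> \<open>Since \<open>A x \<bullet> B y = x \<bullet> y\<close>, substituting \<open>B\<close> in the integral moves \<open>A\<close> out of the wave.\<close>
  have dual: "fourier \<phi>' (?A x) = of_real (1 / e) * fourier \<phi> x" for x
  proof -
    have "fourier \<phi>' (?A x) = (1 / e) *\<^sub>R (LINT \<xi>|lborel. \<phi>' (?B \<xi>) * wave (?B \<xi> \<bullet> ?A x))"
      unfolding fourier_def by (rule lborel_integral_stretch(2)[OF e']) measurable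
    also have "\<dots> = (1 / e) *\<^sub>R fourier \<phi> x"
      unfolding fourier_def \<phi>'B by (simp only: inner_commute[of "?B _"] stretch_inner_dual[OF e(1)] inner_commute[of x])
    finally show ?thesis by (simp add: scaleR_conv_of_real)
  qed
  let ?b = "\<lambda>x. stretch_factor e (angle x - \<alpha>) powr (- (s / 2))" and ?b' = "\<lambda>\<xi>. stretch_factor e (angle \<xi> + pi / 2 - \<alpha>) powr (- ((2 - s) / 2))"
  have j1: "integrable lborel (\<lambda>x. of_real (norm x powr (- s) * ?b x) * fourier \<phi> x)"
    using integrable_bounded_mult[OF i1, of ?b "(e\<^sup>2) powr (- (s / 2))"] stretch_factor_powr_le[OF e, of "s / 2"] s by (simp add: mult_ac)
  have j2: "integrable lborel (\<lambda>\<xi>. of_real (norm \<xi> powr (- (2 - s)) * ?b' \<xi>) * \<phi> \<xi>)"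
    using integrable_bounded_mult[OF i2, of ?b' "(e\<^sup>2) powr (- ((2 - s) / 2))"] stretch_factor_powr_le[OF e, of "(2 - s) / 2"] s by (simp add: mult_ac)
  have xA: "of_real (norm (?A x) powr (- s)) * fourier \<phi>' (?A x) = of_real (1 / e) * (of_real (norm x powr (- s) * ?b x) * fourier \<phi> x)" for x
    unfolding dual norm_stretch_powr[OF e(1)] by (simp only: mult_ac)
  have xB: "of_real (norm (?B \<xi>) powr (- (2 - s))) * \<phi>' (?B \<xi>) = of_real (e powr (2 - s)) * (of_real (norm \<xi> powr (- (2 - s)) * ?b' \<xi>) * \<phi> \<xi>)" for \<xi>
    unfolding \<phi>'B norm_dual_stretch_powr[OF e(1)] of_real_mult by (simp only: mult_ac)
  have adm': "fourier_admissible s \<phi>'"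
    unfolding fourier_admissible_def
  proof (intro conjI)
    show "integrable lborel \<phi>'"
      using lborel_integral_stretch(1)[OF e', of \<phi>' \<alpha>] \<phi> by (simp add: \<phi>'B)
    have "integrable lborel (\<lambda>x. of_real (norm (?A x) powr (- s)) * fourier \<phi>' (?A x))"
      unfolding xA by (rule integrable_mult_right[OF j1])
    then show "integrable lborel (\<lambda>x. of_real (norm x powr (- s)) * fourier \<phi>' x)"
      by (subst (asm) lborel_integral_stretch(1)[OF e(1)]) measurable
    have "integrable lborel (\<lambda>\<xi>. of_real (norm (?B \<xi>) powr (- (2 - s))) * \<phi>' (?B \<xi>))"
      unfolding xB by (rule integrable_mult_right[OF j2])
    then show "integrable lborel (\<lambda>\<xi>. of_real (norm \<xi> powr (- (2 - s))) * \<phi>' \<xi>)"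
      by (subst (asm) lborel_integral_stretch(1)[OF e']) measurable
  qed
  have "(LINT x|lborel. of_real (norm x powr (- s)) * fourier \<phi>' x)
    = e *\<^sub>R (LINT x|lborel. of_real (norm (?A x) powr (- s)) * fourier \<phi>' (?A x))"
    by (rule lborel_integral_stretch(2)[OF e(1)]) measurable
  also have "\<dots> = (LINT x|lborel. of_real (norm x powr (- s) * ?b x) * fourier \<phi> x)"
    unfolding xA integral_mult_right_zero using e by (simp add: scaleR_conv_of_real)
  finally have L: "(LINT x|lborel. of_real (norm x powr (- s) * ?b x) * fourier \<phi> x) = (LINT x|lborel. of_real (norm x powr (- s)) * fourier \<phi>' x)" ..
  have "(LINT \<xi>|lborel. of_real (norm \<xi> powr (- (2 - s))) * \<phi>' \<xi>)
    = (1 / e) *\<^sub>R (LINT \<xi>|lborel. of_real (norm (?B \<xi>) powr (- (2 - s))) * \<phi>' (?B \<xi>))"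
    by (rule lborel_integral_stretch(2)[OF e']) measurable
  also have "\<dots> = of_real (1 / e * e powr (2 - s)) * (LINT \<xi>|lborel. of_real (norm \<xi> powr (- (2 - s)) * ?b' \<xi>) * \<phi> \<xi>)"
    unfolding xB integral_mult_right_zero by (simp add: scaleR_conv_of_real)
  also have "1 / e * e powr (2 - s) = e powr (1 - s)"
    using e powr_diff[of e "2 - s" 1] by (simp add: algebra_simps)
  finally have R: "(LINT \<xi>|lborel. of_real (norm \<xi> powr (- (2 - s))) * \<phi>' \<xi>)
    = of_real (e powr (1 - s)) * (LINT \<xi>|lborel. of_real (norm \<xi> powr (- (2 - s)) * ?b' \<xi>) * \<phi> \<xi>)" .
  show ?thesis unfolding L fourier_riesz[OF s adm'] R by (simp only: of_real_mult mult.assoc)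
qed

lemma direction_mean_continuous:
  fixes f :: "real \<Rightarrow> real"
  assumes e: "e > 0" and f: "continuous_on UNIV f"
  shows "continuous_on UNIV (direction_mean e a f)"
proof -
  have *: "continuous_on UNIV (\<lambda>\<theta>. integral (cbox 0 pi) (\<lambda>\<alpha>. f \<alpha> * stretch_factor e (\<theta> - \<alpha>) powr (- a)))"
  proof (rule integral_continuous_on_param)
    have "continuous_on (UNIV \<times> cbox 0 pi) (\<lambda>p. f (snd p) * stretch_factor e (fst p - snd p) powr (- a))"
      unfolding stretch_factor_def
      by (intro continuous_intros continuous_on_compose2[OF f] continuous_on_powr)
        (auto simp: stretch_factor_pos[OF e, unfolded stretch_factor_def, THEN less_imp_neq, symmetric])
    then show "continuous_on (UNIV \<times> cbox 0 pi) (\<lambda>(\<theta>, \<alpha>). f \<alpha> * stretch_factor e (\<theta> - \<alpha>) powr (- a))"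
      by (simp add: case_prod_beta')
  qed
  show ?thesis
  proof (cases "direction_mass e a = 0")
    case True then show ?thesis by (simp add: direction_mean_def[abs_def])
  next
    case False
    then show ?thesis unfolding direction_mean_def[abs_def] using * by (intro continuous_intros) (auto simp: cbox_interval)
  qed
qed

lemma direction_mean_measurable [measurable]: "e > 0 \<Longrightarrow> continuous_on UNIV f \<Longrightarrow> direction_mean e a f \<in> borel_measurable borel"
  by (intro borel_measurable_continuous_onI direction_mean_continuous)

lemma angular_average:
  fixes f :: "real \<Rightarrow> real" and \<psi> :: "real^2 \<Rightarrow> complex"
  assumes e: "0 < e" "e \<le> 1" and a: "a > 0" and f: "continuous_on UNIV f" "\<And>x. 0 < f x" "\<And>x. f x \<le> M"
    and int: "integrable lborel (\<lambda>x. of_real (norm x powr r) * \<psi> x)" and [measurable]: "\<psi> \<in> borel_measurable borel"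
  shows "(LINT \<alpha>|lborel. of_real (indicator {0..pi} \<alpha> * f \<alpha>) * (LINT x|lborel. of_real (norm x powr r * stretch_factor e (angle x + c - \<alpha>) powr (- a)) * \<psi> x))
    = of_real (direction_mass e a) * (LINT x|lborel. of_real (norm x powr r * direction_mean e a f (angle x + c)) * \<psi> x)"
proof -
  have N: "direction_mass e a > 0" using direction_mass_pos[OF e a] pi_gt_zero by linarith
  have fc: "continuous_on S f" for S using f(1) continuous_on_subset by blast
  have [measurable]: "f \<in> borel_measurable borel" by (rule borel_measurable_continuous_onI[OF f(1)])
  have [measurable]: "direction_mean e a f \<in> borel_measurable borel" by (rule direction_mean_measurable[OF e(1) f(1)])
  have A0: "0 \<le> direction_mean e a f \<theta>" for \<theta> using direction_mean_bounds(2)[OF e a f(1), of 0 \<theta>] f(2) less_imp_le by auto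
  have AM: "\<bar>direction_mean e a f \<theta>\<bar> \<le> M" for \<theta> using direction_mean_bounds(1)[OF e a f(1), of M \<theta>] A0[of \<theta>] f(3) by auto
  have "(LINT x|lborel. of_real (direction_mass e a * (norm x powr r * direction_mean e a f (angle x + c))) * \<psi> x)
    = (LINT \<alpha>|lborel. (LINT x|lborel. of_real (indicator {0..pi} \<alpha> * f \<alpha> * (norm x powr r * stretch_factor e (angle x + c - \<alpha>) powr (- a))) * \<psi> x))"
  proof (rule mixture_Fubini)
    fix x :: "real^2"
    have "((\<lambda>\<alpha>. norm x powr r * (f \<alpha> * stretch_factor e (angle x + c - \<alpha>) powr (- a))) has_integral
        norm x powr r * integral {0..pi} (\<lambda>\<alpha>. f \<alpha> * stretch_factor e (angle x + c - \<alpha>) powr (- a))) {0..pi}"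
      by (intro has_integral_mult_right integrable_integral integrable_continuous_real continuous_intros stretch_factor_powr_cont e fc)
    then have "(\<integral>\<^sup>+\<alpha>. ennreal (indicator {0..pi} \<alpha> * (norm x powr r * (f \<alpha> * stretch_factor e (angle x + c - \<alpha>) powr (- a)))) \<partial>lborel)
      = ennreal (norm x powr r * integral {0..pi} (\<lambda>\<alpha>. f \<alpha> * stretch_factor e (angle x + c - \<alpha>) powr (- a)))"
      by (rule nn_integral_has_integral_lebesgue[rotated]) (use f(2) in \<open>auto simp: less_imp_le\<close>)
    then show "(\<integral>\<^sup>+\<alpha>. ennreal (indicator {0..pi} \<alpha> * f \<alpha> * (norm x powr r * stretch_factor e (angle x + c - \<alpha>) powr (- a))) \<partial>lborel)
      = ennreal (direction_mass e a * (norm x powr r * direction_mean e a f (angle x + c)))"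
      using N by (simp add: direction_mean_def mult_ac)
  next
    show "integrable lborel (\<lambda>x. of_real (direction_mass e a * (norm x powr r * direction_mean e a f (angle x + c))) * \<psi> x)"
      using integrable_mult_right[OF integrable_bounded_mult[OF int, of "\<lambda>x. direction_mean e a f (angle x + c)" M], of "of_real (direction_mass e a)"] AM
      by (simp add: mult_ac)
  qed (use f(2) N A0 in \<open>auto intro!: mult_nonneg_nonneg simp: less_imp_le\<close>)
  then show ?thesis
    unfolding of_real_mult mult.assoc integral_mult_right_zero by simp
qed

text \<open>
  Integrate the identity for a single stretched kernel over \<open>\<alpha>\<close> with the weight \<open>f\<close>.
\<close>

lemma fourier_direction_mean_unnormalized:
  fixes f :: "real \<Rightarrow> real"
  assumes s: "0 < s" "s < 2" and e: "0 < e" "e \<le> 1" and adm: "fourier_admissible s \<phi>"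
    and f: "continuous_on UNIV f" "\<And>x. 0 < f x" "\<And>x. f x \<le> M"
  shows "of_real (direction_mass e (s / 2)) * (LINT x|lborel. of_real (norm x powr (- s) * direction_mean e (s / 2) f (angle x)) * fourier \<phi> x)
    = of_real (riesz_const s * e powr (1 - s) * direction_mass e ((2 - s) / 2)) *
      (LINT \<xi>|lborel. of_real (norm \<xi> powr (- (2 - s)) * direction_mean e ((2 - s) / 2) f (angle \<xi> + pi / 2)) * \<phi> \<xi>)"
proof -
  have \<phi>: "integrable lborel \<phi>" and i1: "integrable lborel (\<lambda>x. of_real (norm x powr (- s)) * fourier \<phi> x)"
    and i2: "integrable lborel (\<lambda>\<xi>. of_real (norm \<xi> powr (- (2 - s))) * \<phi> \<xi>)"
    using adm by (auto simp: fourier_admissible_def)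
  have m[measurable]: "\<phi> \<in> borel_measurable borel" using \<phi> by (auto dest: borel_measurable_integrable)
  have fm: "fourier \<phi> \<in> borel_measurable borel" by measurable
  have s2: "s / 2 > 0" "(2 - s) / 2 > 0" using s by auto
  have "of_real (direction_mass e (s / 2)) * (LINT x|lborel. of_real (norm x powr (- s) * direction_mean e (s / 2) f (angle x)) * fourier \<phi> x)
     = (LINT \<alpha>|lborel. of_real (indicator {0..pi} \<alpha> * f \<alpha>) * (LINT x|lborel. of_real (norm x powr (- s) * stretch_factor e (angle x - \<alpha>) powr (- (s / 2))) * fourier \<phi> x))"
    using angular_average[OF e s2(1) f i1 fm, of 0] by simp
  also have "\<dots> = of_real (riesz_const s * e powr (1 - s)) * (LINT \<alpha>|lborel. of_real (indicator {0..pi} \<alpha> * f \<alpha>) *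
      (LINT \<xi>|lborel. of_real (norm \<xi> powr (- (2 - s)) * stretch_factor e (angle \<xi> + pi / 2 - \<alpha>) powr (- ((2 - s) / 2))) * \<phi> \<xi>))"
    unfolding fourier_stretched_riesz[OF s e adm] integral_mult_right_zero[symmetric] by (simp only: mult_ac)
  also have "\<dots> = of_real (riesz_const s * e powr (1 - s)) * (of_real (direction_mass e ((2 - s) / 2)) * 
      (LINT \<xi>|lborel. of_real (norm \<xi> powr (- (2 - s)) * direction_mean e ((2 - s) / 2) f (angle \<xi> + pi / 2)) * \<phi> \<xi>))"
    unfolding angular_average[OF e s2(2) f i2 m, of "pi / 2"] ..
  finally show ?thesis by (simp add: mult.assoc)
qed

section \<open>Admissible functions, and the limit of the means\<close>

text \<open>
  A bound by a product of functions of one coordinate, so that integrability reduces to dimension one.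
\<close>

definition decay :: "real^2 \<Rightarrow> real" where
  "decay x = inverse (1 + (x $ 1)\<^sup>2) * inverse (1 + (x $ 2)\<^sup>2)"

lemma decay_measurable [measurable]: "decay \<in> borel_measurable borel"
  unfolding decay_def by measurable

lemma decay_nonneg: "0 \<le> decay x"
  by (simp add: decay_def)

lemma integrable_cauchy: "integrable lborel (\<lambda>x::real. inverse (1 + x\<^sup>2))"
  using integrable_inverse_1_plus_square by (simp add: set_integrable_def)

lemma integrable_decay: "integrable lborel decay"
  using integrable_real2_prod(1)[OF integrable_cauchy integrable_cauchy] by (simp add: decay_def[abs_def])

lemma integrable_powr_cauchy:
  fixes b :: real
  assumes b: "0 \<le> b" "b < 1"
  shows "integrable lborel (\<lambda>x::real. \<bar>x\<bar> powr (- b) * inverse (1 + x\<^sup>2))"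
proof -
  have 1: "integrable lborel (\<lambda>x::real. indicator {-1..1} x * \<bar>x\<bar> powr (- b))"
  proof (rule integrableI_nonneg)
    obtain I where "((\<lambda>x. \<bar>x\<bar> powr (- b)) has_integral I) {-1..1::real}"
      using abs_powr_integrable[of "- b" 1] b by (auto simp: integrable_on_def)
    then have "(\<integral>\<^sup>+x. ennreal (indicator {-1..1} x * \<bar>x\<bar> powr (- b)) \<partial>lborel) = ennreal I"
      by (intro nn_integral_has_integral_lebesgue) auto
    then show "(\<integral>\<^sup>+x. ennreal (indicator {-1..1} x * \<bar>x\<bar> powr (- b)) \<partial>lborel) < \<infinity>" by simp
  qed auto
  show ?thesis
  proof (rule Bochner_Integration.integrable_bound[OF Bochner_Integration.integrable_add[OF 1 integrable_cauchy]])
    have "\<bar>x\<bar> powr (- b) * inverse (1 + x\<^sup>2) \<le> indicator {-1..1} x * \<bar>x\<bar> powr (- b) + inverse (1 + x\<^sup>2)" for x :: real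
    proof (cases "\<bar>x\<bar> \<le> 1")
      case True
      have "\<bar>x\<bar> powr (- b) * inverse (1 + x\<^sup>2) \<le> \<bar>x\<bar> powr (- b) * 1"
        by (intro mult_left_mono) (auto intro!: inverse_le_1_iff[THEN iffD2])
      moreover have "x \<in> {-1..1}" using True by auto
      ultimately show ?thesis by (simp add: add_increasing2)
    next
      case False
      have "\<bar>x\<bar> powr (- b) \<le> 1" using False b powr_mono[of "- b" 0 "\<bar>x\<bar>"] by (auto split: if_splits)
      then have "\<bar>x\<bar> powr (- b) * inverse (1 + x\<^sup>2) \<le> 1 * inverse (1 + x\<^sup>2)" by (intro mult_right_mono) auto
      then show ?thesis using False by (auto simp: indicator_def)
    qed
    then show "AE x in lborel. norm (\<bar>x\<bar> powr (- b) * inverse (1 + x\<^sup>2)) \<le> norm (indicator {-1..1} x * \<bar>x\<bar> powr (- b) + inverse (1 + x\<^sup>2) :: real)"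
      by (auto intro!: AE_I2 simp: abs_mult)
  qed measurable
qed

lemma AE_components_nonzero: "AE x::real^2 in lborel. x $ 1 \<noteq> 0 \<and> x $ 2 \<noteq> 0"
proof -
  have n: "AE x::real^2 in lborel. x $ k \<noteq> 0" for k
  proof (rule AE_I)
    show "emeasure lborel {x::real^2. x $ k = 0} = 0"
    proof -
      have "{x::real^2. x $ k = 0} \<in> null_sets lebesgue"
        using negligible_standard_hyperplane_cart[of k] by (simp add: negligible_iff_null_sets)
      moreover have "closed {x::real^2. x $ k = 0}" by (intro closed_Collect_eq continuous_intros)
      ultimately show ?thesis by (auto simp: null_sets_def)
    qed
  qed (auto intro!: borel_closed closed_Collect_eq continuous_intros)
  show ?thesis using n[of 1] n[of 2] by eventually_elim auto
qed

text \<open>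
  Off the coordinate axes \<open>|x|^{-s} \<le> |x\<^sub>1|^{-s/2} |x\<^sub>2|^{-s/2}\<close>, and \<open>s/2 < 1\<close>.
\<close>

lemma integrable_riesz_decay:
  assumes s: "0 \<le> s" "s < 2"
  shows "integrable lborel (\<lambda>x. norm x powr (- s) * decay x)"
proof -
  let ?f = "\<lambda>x::real. \<bar>x\<bar> powr (- (s / 2)) * inverse (1 + x\<^sup>2)"
  have i: "integrable lborel ?f" using s by (intro integrable_powr_cauchy) auto
  show ?thesis
  proof (rule Bochner_Integration.integrable_bound[OF integrable_real2_prod(1)[OF i i]])
    show "AE x in lborel. norm (norm x powr (- s) * decay x) \<le> norm (?f (x $ 1) * ?f (x $ 2))"
      using AE_components_nonzero
    proof eventually_elim
      fix x :: "real^2" assume x: "x $ 1 \<noteq> 0 \<and> x $ 2 \<noteq> 0"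
      then have x0: "x \<noteq> 0" by auto
      have pos: "0 < \<bar>x $ 1\<bar> * \<bar>x $ 2\<bar>" using x by simp
      have "2 * (\<bar>x $ 1\<bar> * \<bar>x $ 2\<bar>) \<le> (norm x)\<^sup>2"
        using sum_squares_bound[of "\<bar>x $ 1\<bar>" "\<bar>x $ 2\<bar>"] by (simp add: norm_real2_sq)
      then have "\<bar>x $ 1\<bar> * \<bar>x $ 2\<bar> \<le> (norm x)\<^sup>2" using pos by linarith
      then have "((norm x)\<^sup>2) powr (- (s / 2)) \<le> (\<bar>x $ 1\<bar> * \<bar>x $ 2\<bar>) powr (- (s / 2))"
        using s pos by (intro powr_mono2') auto
      also have "((norm x)\<^sup>2) powr (- (s / 2)) = norm x powr (- s)"
        using x0 by (simp add: powr_powr flip: powr_numeral)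
      also have "(\<bar>x $ 1\<bar> * \<bar>x $ 2\<bar>) powr (- (s / 2)) = \<bar>x $ 1\<bar> powr (- (s / 2)) * \<bar>x $ 2\<bar> powr (- (s / 2))"
        by (rule powr_mult)
      finally have "norm x powr (- s) * decay x \<le> (\<bar>x $ 1\<bar> powr (- (s / 2)) * \<bar>x $ 2\<bar> powr (- (s / 2))) * decay x"
        by (intro mult_right_mono decay_nonneg)
      then show "norm (norm x powr (- s) * decay x) \<le> norm (?f (x $ 1) * ?f (x $ 2))"
        by (simp add: abs_mult decay_nonneg) (simp add: decay_def mult_ac)
    qed
  qed measurable
qed

lemma fourier_admissibleI:
  assumes s: "0 < s" "s < 2" and [measurable]: "\<phi> \<in> borel_measurable borel"
    and \<phi>: "\<And>x. norm (\<phi> x) \<le> C * decay x" and F: "\<And>x. norm (fourier \<phi> x) \<le> C' * decay x"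
  shows "fourier_admissible s \<phi>"
proof -
  have dom: "integrable lborel (\<lambda>x. of_real (norm x powr (- r)) * \<psi> x)"
    if r: "0 \<le> r" "r < 2" and [measurable]: "\<psi> \<in> borel_measurable borel" and b: "\<And>x. norm (\<psi> x) \<le> B * decay x" for r B and \<psi> :: "real^2 \<Rightarrow> complex"
  proof (rule Bochner_Integration.integrable_bound[OF integrable_mult_right[OF integrable_riesz_decay[OF r], of B]])
    have "norm x powr (- r) * norm (\<psi> x) \<le> B * (norm x powr (- r) * decay x)" for x
      using mult_left_mono[OF b[of x], of "norm x powr (- r)"] by (simp add: mult_ac)
    then show "AE x in lborel. norm (of_real (norm x powr (- r)) * \<psi> x) \<le> norm (B * (norm x powr (- r) * decay x))"
      by (auto intro!: AE_I2 simp: norm_mult intro: order_trans[OF _ abs_ge_self])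
  qed measurable
  have "integrable lborel \<phi>"
  proof (rule Bochner_Integration.integrable_bound[OF integrable_mult_right[OF integrable_decay, of C]])
    show "AE x in lborel. norm (\<phi> x) \<le> norm (C * decay x)" using \<phi> by (auto intro!: AE_I2 intro: order_trans[OF _ abs_ge_self])
  qed measurable
  then show ?thesis unfolding fourier_admissible_def
    using dom[of s "fourier \<phi>" C'] dom[of "2 - s" \<phi> C] s \<phi> F by auto
qed

lemma gaussian_decay: "exp (- (pi * (norm x)\<^sup>2)) \<le> decay x"
proof -
  have e: "exp (- (pi * u\<^sup>2)) \<le> inverse (1 + u\<^sup>2)" for u :: real
  proof -
    have "1 * u\<^sup>2 \<le> pi * u\<^sup>2" using pi_gt3 by (intro mult_right_mono) auto
    then have "1 + u\<^sup>2 \<le> exp (pi * u\<^sup>2)" using exp_ge_add_one_self[of "pi * u\<^sup>2"] by linarith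
    moreover have "0 < 1 + u\<^sup>2" by (simp add: add_pos_nonneg)
    ultimately show ?thesis by (simp add: exp_minus le_imp_inverse_le)
  qed
  have "exp (- (pi * (norm x)\<^sup>2)) = exp (- (pi * (x $ 1)\<^sup>2)) * exp (- (pi * (x $ 2)\<^sup>2))"
    by (simp add: norm_real2_sq exp_add[symmetric] algebra_simps)
  also have "\<dots> \<le> decay x" unfolding decay_def by (intro mult_mono e) auto
  finally show ?thesis .
qed

lemma fourier_admissible_gaussian:
  assumes s: "0 < s" "s < 2"
  shows "fourier_admissible s (\<lambda>x. of_real (exp (- (pi * (norm x)\<^sup>2))))"
proof (rule fourier_admissibleI[OF s, of _ 1 1])
  have "fourier (\<lambda>x. of_real (exp (- (pi * (norm x)\<^sup>2)))) x = of_real (exp (- (pi * (norm x)\<^sup>2)))" for x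
    using fourier_gaussian[of pi x] by (simp add: power2_eq_square)
  then show "norm (fourier (\<lambda>x. of_real (exp (- (pi * (norm x)\<^sup>2)))) x) \<le> 1 * decay x" for x
    using gaussian_decay[of x] by simp
qed (use gaussian_decay in auto)

lemma direction_mean_one:
  assumes "0 < e" "e \<le> 1" "a > 0"
  shows "direction_mean e a (\<lambda>_. 1) \<theta> = 1"
  using direction_mean_bounds[OF assms, of "\<lambda>_. 1"] by (intro antisym) auto

text \<open>
  For \<open>\<Omega> = 1\<close> the averaged potential is a multiple of \<open>|x|^{-s}\<close>, whose transform is known. Comparing the
  two identities on the Gaussian \<open>exp (- \<pi> |x|\<^sup>2)\<close>, where the integral does not vanish, gives the relation
  of the masses without evaluating them.
\<close>

lemma direction_mass_duality:
  assumes s: "0 < s" "s < 2" and e: "0 < e" "e \<le> 1"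
  shows "direction_mass e (s / 2) = e powr (1 - s) * direction_mass e ((2 - s) / 2)"
proof -
  define \<phi> :: "real^2 \<Rightarrow> complex" where "\<phi> x = of_real (exp (- (pi * (norm x)\<^sup>2)))" for x
  have adm: "fourier_admissible s \<phi>" using fourier_admissible_gaussian[OF s] by (simp add: \<phi>_def[abs_def])
  define R where "R = (LINT \<xi>|lborel. of_real (norm \<xi> powr (- (2 - s))) * \<phi> \<xi>)"
  have R0: "R \<noteq> 0"
  proof
    assume "R = 0"
    have i: "integrable lborel (\<lambda>\<xi>::real^2. norm \<xi> powr (- (2 - s)) * exp (- (pi * (norm \<xi>)\<^sup>2)))"
    proof -
      have "integrable lborel (\<lambda>\<xi>. of_real (norm \<xi> powr (- (2 - s))) * \<phi> \<xi>)"
        using adm by (simp add: fourier_admissible_def)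
      then have "integrable lborel (\<lambda>\<xi>::real^2. complex_of_real (norm \<xi> powr (- (2 - s)) * exp (- (pi * (norm \<xi>)\<^sup>2))))"
        by (simp add: \<phi>_def)
      then show ?thesis by (simp only: complex_of_real_integrable_eq)
    qed
    have "R = of_real (LINT \<xi>|lborel. norm \<xi> powr (- (2 - s)) * exp (- (pi * (norm (\<xi>::real^2))\<^sup>2)))"
      unfolding R_def \<phi>_def by (simp flip: integral_complex_of_real)
    then have "(LINT \<xi>|lborel. norm \<xi> powr (- (2 - s)) * exp (- (pi * (norm (\<xi>::real^2))\<^sup>2))) = 0" using \<open>R = 0\<close> by simp
    then have "AE \<xi>::real^2 in lborel. norm \<xi> powr (- (2 - s)) * exp (- (pi * (norm \<xi>)\<^sup>2)) = 0"
      by (subst (asm) integral_nonneg_eq_0_iff_AE[OF i]) auto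
    then have "AE \<xi>::real^2 in lborel. False"
      using AE_lborel_singleton[of 0] by eventually_elim auto
    then have "(\<exists>N::(real^2) set. N \<in> null_sets lborel \<and> UNIV \<subseteq> N)" by (auto simp: eventually_ae_filter)
    then show False by (auto simp: top.extremum_unique)
  qed
  have s2: "s / 2 > 0" "(2 - s) / 2 > 0" using s by auto
  have "of_real (direction_mass e (s / 2)) * (of_real (riesz_const s) * R)
     = of_real (riesz_const s * e powr (1 - s) * direction_mass e ((2 - s) / 2)) * R"
    using fourier_direction_mean_unnormalized[OF s e adm, of "\<lambda>_. 1" 1] fourier_riesz[OF s adm]
    by (simp add: direction_mean_one[OF e s2(1)] direction_mean_one[OF e s2(2)] R_def)
  then have "of_real (direction_mass e (s / 2) * riesz_const s) * R = of_real (riesz_const s * e powr (1 - s) * direction_mass e ((2 - s) / 2)) * R"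
    by (simp only: of_real_mult mult.assoc)
  then have "direction_mass e (s / 2) * riesz_const s = riesz_const s * e powr (1 - s) * direction_mass e ((2 - s) / 2)"
    using R0 by (simp only: mult_cancel_right of_real_eq_iff) simp
  then show ?thesis using riesz_const_pos[OF s] by simp
qed

lemma fourier_direction_mean:
  fixes f :: "real \<Rightarrow> real"
  assumes s: "0 < s" "s < 2" and e: "0 < e" "e \<le> 1" and adm: "fourier_admissible s \<phi>"
    and f: "continuous_on UNIV f" "\<And>x. 0 < f x" "\<And>x. f x \<le> M"
  shows "(LINT x|lborel. of_real (norm x powr (- s) * direction_mean e (s / 2) f (angle x)) * fourier \<phi> x)
    = of_real (riesz_const s) *
      (LINT \<xi>|lborel. of_real (norm \<xi> powr (- (2 - s)) * direction_mean e ((2 - s) / 2) f (angle \<xi> + pi / 2)) * \<phi> \<xi>)"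
proof -
  have "direction_mass e (s / 2) \<ge> pi" using s by (intro direction_mass_pos[OF e]) auto
  then have N: "direction_mass e (s / 2) > 0" using pi_gt_zero by linarith
  have "of_real (direction_mass e (s / 2)) * (LINT x|lborel. of_real (norm x powr (- s) * direction_mean e (s / 2) f (angle x)) * fourier \<phi> x)
    = of_real (direction_mass e (s / 2)) * (of_real (riesz_const s) *
      (LINT \<xi>|lborel. of_real (norm \<xi> powr (- (2 - s)) * direction_mean e ((2 - s) / 2) f (angle \<xi> + pi / 2)) * \<phi> \<xi>))"
  proof -
    have "riesz_const s * e powr (1 - s) * direction_mass e ((2 - s) / 2) = direction_mass e (s / 2) * riesz_const s"
      by (simp add: direction_mass_duality[OF s e])
    then show ?thesis
      unfolding fourier_direction_mean_unnormalized[OF s e adm f] by (simp only: of_real_mult mult.assoc)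
  qed
  then show ?thesis using N by simp
qed

text \<open>
  The limit \<open>e \<rightarrow> 0\<close> in the identity for the means. All means lie between the bounds of \<open>f\<close>, so dominated
  convergence applies on both sides, and the limit profile inherits the positive lower bound.
\<close>

lemma fourier_angular:
  fixes f :: "real \<Rightarrow> real"
  assumes s: "1 \<le> s" "s < 2" and f: "continuous_on UNIV f" "\<And>x. 0 < f x" "\<And>x. f (x + pi) = f x"
  shows "\<exists>\<Psi>. continuous_on UNIV \<Psi> \<and> (\<forall>\<theta>. \<Psi> (\<theta> + pi) = \<Psi> \<theta>) \<and> (\<forall>\<theta>. 0 < \<Psi> \<theta>) \<and>
    (\<forall>\<phi>. fourier_admissible s \<phi> \<longrightarrow>
      integrable lborel (\<lambda>x. of_real (norm x powr (- s) * f (angle x)) * fourier \<phi> x) \<and>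
      integrable lborel (\<lambda>\<xi>. of_real (norm \<xi> powr (- (2 - s)) * \<Psi> (angle \<xi>)) * \<phi> \<xi>) \<and>
      (LINT x|lborel. of_real (norm x powr (- s) * f (angle x)) * fourier \<phi> x)
       = (LINT \<xi>|lborel. of_real (norm \<xi> powr (- (2 - s)) * \<Psi> (angle \<xi>)) * \<phi> \<xi>))"
proof -
  have s0: "0 < s" "s < 2" using s by auto
  obtain M where M: "\<And>x. \<bar>f x\<bar> \<le> M" using periodic_bounded_uniformly_continuous(1)[OF f(1,3)] by auto
  have fM: "f x \<le> M" for x using M[of x] by linarith
  obtain m where m: "m > 0" "\<And>\<theta>. m \<le> f \<theta>"
    using periodic_bounded_uniformly_continuous(3)[OF f(1,3,2)] by auto
  define a where "a = (2 - s) / 2"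
  have a: "a > 0" using s by (simp add: a_def)
  obtain \<Psi> where \<Psi>: "continuous_on UNIV \<Psi>" "\<And>\<theta>. \<Psi> (\<theta> + pi) = \<Psi> \<theta>"
     "\<And>\<theta>. (\<lambda>n. direction_mean (1 / (real n + 2)) a f \<theta>) \<longlonglongrightarrow> \<Psi> \<theta>"
    using direction_mean_limit[OF a f(1,3)] by blast
  define e where "e n = 1 / (real n + 2)" for n :: nat
  have e: "0 < e n" "e n \<le> 1" for n by (auto simp: e_def)
  have \<Psi>_lim: "(\<lambda>n. direction_mean (e n) a f \<theta>) \<longlonglongrightarrow> \<Psi> \<theta>" for \<theta> using \<Psi>(3) by (simp add: e_def)
  have f_lim: "(\<lambda>n. direction_mean (e n) (s / 2) f \<theta>) \<longlonglongrightarrow> f \<theta>" for \<theta>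
    using direction_mean_tendsto[OF _ f(1,3), of "s / 2"] s by (simp add: e_def)
  have b: "m \<le> direction_mean (e n) r f \<theta>" "direction_mean (e n) r f \<theta> \<le> M" if "r > 0" for n r \<theta>
    using direction_mean_bounds[OF e that f(1)] m(2) fM by auto
  have \<Psi>m: "m \<le> \<Psi> \<theta>" and \<Psi>M: "\<Psi> \<theta> \<le> M" for \<theta>
    using LIMSEQ_le_const[OF \<Psi>_lim, of m] LIMSEQ_le_const2[OF \<Psi>_lim, of _ M] b[OF a] by blast+
  define c where "c = riesz_const s"
  have c: "c > 0" unfolding c_def by (rule riesz_const_pos[OF s0])
  define \<Psi>' where "\<Psi>' \<theta> = c * \<Psi> (\<theta> + pi / 2)" for \<theta>
  have \<Psi>'_cont: "continuous_on UNIV \<Psi>'" unfolding \<Psi>'_def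
    by (intro continuous_intros continuous_on_compose2[OF \<Psi>(1)]) auto
  have \<Psi>'_per: "\<Psi>' (\<theta> + pi) = \<Psi>' \<theta>" for \<theta>
    using \<Psi>(2)[of "\<theta> + pi / 2"] by (simp add: \<Psi>'_def add_ac)
  have \<Psi>'_pos: "0 < \<Psi>' \<theta>" for \<theta> using c m(1) \<Psi>m[of "\<theta> + pi / 2"] by (simp add: \<Psi>'_def)
  have fm[measurable]: "f \<in> borel_measurable borel" and \<Psi>m'[measurable]: "\<Psi> \<in> borel_measurable borel" "\<Psi>' \<in> borel_measurable borel"
    using f(1) \<Psi>(1) \<Psi>'_cont by (auto intro: borel_measurable_continuous_onI)
  have "integrable lborel (\<lambda>x. of_real (norm x powr (- s) * f (angle x)) * fourier \<phi> x) \<and>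
      integrable lborel (\<lambda>\<xi>. of_real (norm \<xi> powr (- (2 - s)) * \<Psi>' (angle \<xi>)) * \<phi> \<xi>) \<and>
      (LINT x|lborel. of_real (norm x powr (- s) * f (angle x)) * fourier \<phi> x)
       = (LINT \<xi>|lborel. of_real (norm \<xi> powr (- (2 - s)) * \<Psi>' (angle \<xi>)) * \<phi> \<xi>)"
    if adm: "fourier_admissible s \<phi>" for \<phi>
  proof -
    have \<phi>: "integrable lborel \<phi>" and i1: "integrable lborel (\<lambda>x. of_real (norm x powr (- s)) * fourier \<phi> x)"
      and i2: "integrable lborel (\<lambda>\<xi>. of_real (norm \<xi> powr (- (2 - s))) * \<phi> \<xi>)"
      using adm by (auto simp: fourier_admissible_def)
    have [measurable]: "\<phi> \<in> borel_measurable borel" using \<phi> by (auto dest: borel_measurable_integrable)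
    have conv: "(\<lambda>n. LINT x|lborel. of_real (norm x powr r * g n x) * \<psi> x) \<longlonglongrightarrow> (LINT x|lborel. of_real (norm x powr r * h x) * \<psi> x)"
      if i: "integrable lborel (\<lambda>x. of_real (norm x powr r) * \<psi> x)" and [measurable]: "\<psi> \<in> borel_measurable borel" "h \<in> borel_measurable borel"
        "\<And>n. g n \<in> borel_measurable borel" and l: "\<And>x. (\<lambda>n. g n x) \<longlonglongrightarrow> h x" and g: "\<And>n x. \<bar>g n x\<bar> \<le> M"
      for r and \<psi> :: "real^2 \<Rightarrow> complex" and g :: "nat \<Rightarrow> real^2 \<Rightarrow> real" and h :: "real^2 \<Rightarrow> real"
    proof (rule integral_dominated_convergence[where w="\<lambda>x. M * norm (of_real (norm x powr r) * \<psi> x)"])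
      show "integrable lborel (\<lambda>x. M * norm (of_real (norm x powr r) * \<psi> x))"
        by (intro integrable_mult_right integrable_norm i)
      show "AE x in lborel. (\<lambda>n. of_real (norm x powr r * g n x) * \<psi> x) \<longlonglongrightarrow> of_real (norm x powr r * h x) * \<psi> x"
        by (intro AE_I2 tendsto_intros l)
      show "AE x in lborel. norm (of_real (norm x powr r * g n x) * \<psi> x) \<le> M * norm (of_real (norm x powr r) * \<psi> x)" for n
      proof (intro AE_I2)
        fix x
        have "\<bar>g n x\<bar> * (norm x powr r * norm (\<psi> x)) \<le> M * (norm x powr r * norm (\<psi> x))"
          by (intro mult_right_mono g) auto
        then show "norm (of_real (norm x powr r * g n x) * \<psi> x) \<le> M * norm (of_real (norm x powr r) * \<psi> x)"
          by (simp add: norm_mult abs_mult mult_ac)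
      qed
    qed measurable
    have am[measurable]: "direction_mean (e n) r f \<in> borel_measurable borel" for n r by (rule direction_mean_measurable[OF e(1) f(1)])
    have bb: "\<bar>direction_mean (e n) r f \<theta>\<bar> \<le> M" if "r > 0" for n r \<theta> using b[OF that, of n \<theta>] m(1) by simp
    have L: "(\<lambda>n. LINT x|lborel. of_real (norm x powr (- s) * direction_mean (e n) (s / 2) f (angle x)) * fourier \<phi> x)
      \<longlonglongrightarrow> (LINT x|lborel. of_real (norm x powr (- s) * f (angle x)) * fourier \<phi> x)"
    proof (rule conv[OF i1])
      show "\<bar>direction_mean (e n) (s / 2) f (angle x)\<bar> \<le> M" for n x using bb[of "s / 2"] s by simp
    qed (measurable, rule f_lim)
    have R: "(\<lambda>n. LINT \<xi>|lborel. of_real (norm \<xi> powr (- (2 - s)) * direction_mean (e n) a f (angle \<xi> + pi / 2)) * \<phi> \<xi>)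
      \<longlonglongrightarrow> (LINT \<xi>|lborel. of_real (norm \<xi> powr (- (2 - s)) * \<Psi> (angle \<xi> + pi / 2)) * \<phi> \<xi>)"
    proof (rule conv[OF i2])
      show "\<bar>direction_mean (e n) a f (angle x + pi / 2)\<bar> \<le> M" for n x by (rule bb[OF a])
    qed (measurable, rule \<Psi>_lim)
    have eq: "(LINT x|lborel. of_real (norm x powr (- s) * direction_mean (e n) (s / 2) f (angle x)) * fourier \<phi> x)
      = of_real c * (LINT \<xi>|lborel. of_real (norm \<xi> powr (- (2 - s)) * direction_mean (e n) a f (angle \<xi> + pi / 2)) * \<phi> \<xi>)" for n
      unfolding c_def a_def by (rule fourier_direction_mean[OF s0 e adm f(1,2) fM])
    have "(LINT x|lborel. of_real (norm x powr (- s) * f (angle x)) * fourier \<phi> x)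
      = of_real c * (LINT \<xi>|lborel. of_real (norm \<xi> powr (- (2 - s)) * \<Psi> (angle \<xi> + pi / 2)) * \<phi> \<xi>)"
      using L unfolding eq by (rule LIMSEQ_unique) (intro tendsto_intros R)
    also have "\<dots> = (LINT \<xi>|lborel. of_real (norm \<xi> powr (- (2 - s)) * \<Psi>' (angle \<xi>)) * \<phi> \<xi>)"
      unfolding integral_mult_right_zero[symmetric] by (simp add: \<Psi>'_def mult_ac)
    finally have "(LINT x|lborel. of_real (norm x powr (- s) * f (angle x)) * fourier \<phi> x)
      = (LINT \<xi>|lborel. of_real (norm \<xi> powr (- (2 - s)) * \<Psi>' (angle \<xi>)) * \<phi> \<xi>)" .
    moreover have "integrable lborel (\<lambda>x. of_real (f (angle x)) * (of_real (norm x powr (- s)) * fourier \<phi> x))"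
      using M by (intro integrable_bounded_mult[OF i1]) auto
    moreover have "\<bar>\<Psi>' \<theta>\<bar> \<le> c * M" for \<theta> using \<Psi>'_pos[of \<theta>] \<Psi>M[of "\<theta> + pi / 2"] c by (simp add: \<Psi>'_def)
    then have "integrable lborel (\<lambda>\<xi>. of_real (\<Psi>' (angle \<xi>)) * (of_real (norm \<xi> powr (- (2 - s))) * \<phi> \<xi>))"
      by (intro integrable_bounded_mult[OF i2]) auto
    ultimately show ?thesis by (simp add: mult_ac)
  qed
  then show ?thesis using \<Psi>'_cont \<Psi>'_per \<Psi>'_pos by blast
qed

section \<open>Test functions\<close>

lemma iter_deriv_append: "iter_deriv bs (iter_deriv cs f) = iter_deriv (bs @ cs) f"
  by (induction bs) auto

lemma test_functionD:
  assumes "test_function_on U \<phi>"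
  shows "continuous_on UNIV \<phi>" "(\<phi> has_derivative frechet_derivative \<phi> (at x)) (at x)" "\<phi> \<in> borel_measurable borel"
proof -
  have "smooth \<phi>" using assms by (simp add: test_function_on_def)
  then have "iter_deriv [] \<phi> differentiable_on UNIV" unfolding smooth_def by (metis empty_set empty_subsetI)
  then have d: "\<phi> differentiable_on UNIV" by simp
  then show c: "continuous_on UNIV \<phi>" by (rule differentiable_imp_continuous_on)
  show "(\<phi> has_derivative frechet_derivative \<phi> (at x)) (at x)"
    using d by (auto simp: differentiable_on_def frechet_derivative_works)
  show "\<phi> \<in> borel_measurable borel" using c by (rule borel_measurable_continuous_onI)
qed

lemma test_function_deriv:
  assumes \<phi>: "test_function_on U \<phi>" and b: "b \<in> Basis"
  shows "test_function_on U (iter_deriv [b] \<phi>)"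
proof -
  obtain K where K: "compact K" "K \<subseteq> U" "\<And>x. x \<notin> K \<Longrightarrow> \<phi> x = 0" and sm: "smooth \<phi>"
    using \<phi> by (auto simp: test_function_on_def)
  have "smooth (iter_deriv [b] \<phi>)"
    unfolding smooth_def
  proof (intro allI impI)
    fix bs :: "(real^2) list" assume "set bs \<subseteq> Basis"
    then have "set (bs @ [b]) \<subseteq> Basis" using b by simp
    then show "iter_deriv bs (iter_deriv [b] \<phi>) differentiable_on UNIV"
      using sm unfolding smooth_def iter_deriv_append by blast
  qed
  moreover have "iter_deriv [b] \<phi> x = 0" if "x \<notin> K" for x
  proof -
    have "(\<phi> has_derivative (\<lambda>_. 0)) (at x)"
      by (rule has_derivative_transform_within_open[OF has_derivative_const[of 0], of "- K"])
        (use K that in \<open>auto intro: compact_imp_closed\<close>)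
    then have "frechet_derivative \<phi> (at x) = (\<lambda>_. 0)" by (rule frechet_derivative_at[symmetric])
    then show ?thesis by simp
  qed
  ultimately show ?thesis using K by (auto simp: test_function_on_def)
qed

lemma test_function_decay:
  assumes "test_function_on U \<phi>"
  shows "\<exists>C. \<forall>x. norm (\<phi> x) \<le> C * decay x"
proof -
  obtain K where K: "compact K" "\<And>x. x \<notin> K \<Longrightarrow> \<phi> x = 0"
    using assms by (auto simp: test_function_on_def)
  let ?g = "\<lambda>x. of_real ((1 + (x $ 1)\<^sup>2) * (1 + (x $ 2)\<^sup>2)) * \<phi> x"
  have "continuous_on K ?g"
    using continuous_on_subset[OF test_functionD(1)[OF assms]] by (intro continuous_intros) auto
  then have "bounded (?g ` K)" using K(1) by (intro compact_imp_bounded compact_continuous_image)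
  then obtain C where C: "\<And>x. x \<in> K \<Longrightarrow> norm (?g x) \<le> C" by (auto simp: bounded_iff)
  have "norm (\<phi> x) \<le> max C 0 * decay x" for x
  proof (cases "x \<in> K")
    case True
    have pos: "(1 + (x $ 1)\<^sup>2) * (1 + (x $ 2)\<^sup>2) > 0" by (simp add: add_pos_nonneg)
    have d: "decay x = 1 / ((1 + (x $ 1)\<^sup>2) * (1 + (x $ 2)\<^sup>2))" by (simp add: decay_def field_simps)
    have "(1 + (x $ 1)\<^sup>2) * (1 + (x $ 2)\<^sup>2) * norm (\<phi> x) \<le> max C 0"
      using C[OF True] unfolding norm_mult norm_of_real abs_of_pos[OF pos] by linarith
    then show ?thesis unfolding d using pos by (simp add: pos_le_divide_eq mult.commute)
  qed (simp add: K decay_nonneg)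
  then show ?thesis by blast
qed

lemma test_function_integrable:
  assumes "test_function_on U \<phi>"
  shows "integrable lborel \<phi>"
proof -
  obtain C where C: "\<And>x. norm (\<phi> x) \<le> C * decay x" using test_function_decay[OF assms] by blast
  note [measurable] = test_functionD(3)[OF assms]
  show ?thesis
  proof (rule Bochner_Integration.integrable_bound[OF integrable_mult_right[OF integrable_decay, of C]])
    show "AE x in lborel. norm (\<phi> x) \<le> norm (C * decay x)" using C by (auto intro!: AE_I2 intro: order_trans[OF _ abs_ge_self])
  qed measurable
qed

lemma fourier_translate:
  assumes [measurable]: "\<phi> \<in> borel_measurable borel"
  shows "fourier (\<lambda>x. \<phi> (x + v)) \<xi> = exp (2 * of_real pi * \<i> * of_real (v \<bullet> \<xi>)) * fourier \<phi> \<xi>"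
proof -
  let ?E = "\<lambda>x. wave (x \<bullet> \<xi>) :: complex"
  have e: "?E x = exp (2 * of_real pi * \<i> * of_real (v \<bullet> \<xi>)) * ?E (x + v)" for x
    by (simp add: exp_add[symmetric] inner_add_left algebra_simps)
  have "fourier (\<lambda>x. \<phi> (x + v)) \<xi> = (LINT x|lborel. exp (2 * of_real pi * \<i> * of_real (v \<bullet> \<xi>)) * (\<phi> (v + x) * ?E (v + x)))"
    unfolding fourier_def by (subst e) (simp add: mult_ac add.commute)
  also have "\<dots> = exp (2 * of_real pi * \<i> * of_real (v \<bullet> \<xi>)) * (LINT x|distr lborel borel ((+) v). \<phi> x * ?E x)"
    by (subst integral_distr) auto
  finally show ?thesis by (simp only: lborel_distr_plus fourier_def)
qed

lemma test_function_lipschitz: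
  assumes \<phi>: "test_function_on U \<phi>" and b: "b \<in> Basis"
  shows "\<exists>B\<ge>0. \<forall>x t. norm (\<phi> (x + t *\<^sub>R b) - \<phi> x) \<le> B * \<bar>t\<bar>"
proof -
  obtain C where C: "\<And>x. norm (iter_deriv [b] \<phi> x) \<le> C * decay x"
    using test_function_decay[OF test_function_deriv[OF \<phi> b]] by blast
  have d1: "decay x \<le> 1" for x unfolding decay_def
    by (intro mult_le_one) (auto intro!: inverse_le_1_iff[THEN iffD2])
  have C0: "\<bar>C\<bar> \<ge> 0" by simp
  have B: "norm (iter_deriv [b] \<phi> x) \<le> \<bar>C\<bar>" for x
  proof -
    have "C * decay x \<le> \<bar>C\<bar> * 1" using d1[of x] decay_nonneg[of x] by (intro mult_mono) auto
    then show ?thesis using C[of x] by linarith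
  qed
  have "norm (\<phi> (x + t *\<^sub>R b) - \<phi> x) \<le> \<bar>C\<bar> * \<bar>t\<bar>" for x t
  proof -
    let ?h = "\<lambda>r::real. \<phi> (x + r *\<^sub>R b)"
    have dh: "(?h has_derivative (\<lambda>u. u *\<^sub>R iter_deriv [b] \<phi> (x + r *\<^sub>R b))) (at r)" for r
    proof -
      let ?D = "frechet_derivative \<phi> (at (x + r *\<^sub>R b))"
      have D: "(\<phi> has_derivative ?D) (at (x + r *\<^sub>R b))" by (rule test_functionD(2)[OF \<phi>])
      have "((\<lambda>r. x + r *\<^sub>R b) has_derivative (\<lambda>u. u *\<^sub>R b)) (at r)"
        by (auto intro!: derivative_eq_intros)
      from has_derivative_compose[OF this D] have "(?h has_derivative (\<lambda>u. ?D (u *\<^sub>R b))) (at r)" .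
      moreover have "?D (u *\<^sub>R b) = u *\<^sub>R ?D b" for u
        using D by (simp add: has_derivative_def linear_simps bounded_linear.linear linear_scale)
      ultimately show ?thesis by simp
    qed
    have "norm (?h t - ?h 0) \<le> \<bar>C\<bar> * norm (t - 0)"
    proof (rule differentiable_bound[of UNIV])
      show "onorm (\<lambda>u. u *\<^sub>R iter_deriv [b] \<phi> (x + r *\<^sub>R b)) \<le> \<bar>C\<bar>" for r
      proof (rule onorm_bound[OF C0])
        fix u :: real
        have "\<bar>u\<bar> * norm (iter_deriv [b] \<phi> (x + r *\<^sub>R b)) \<le> \<bar>u\<bar> * \<bar>C\<bar>" by (intro mult_left_mono B) simp
        then show "norm (u *\<^sub>R iter_deriv [b] \<phi> (x + r *\<^sub>R b)) \<le> \<bar>C\<bar> * norm u"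
          by (simp add: mult.commute del: iter_deriv.simps)
      qed
    qed (use dh in auto)
    then show ?thesis by simp
  qed
  then show ?thesis by (intro exI[of _ "\<bar>C\<bar>"]) auto
qed

text \<open>
  Integration by parts through translations: the difference quotients of \<open>\<phi>\<close> in the direction \<open>b\<close> are
  bounded and have a common bounded support, and translation multiplies the transform by a wave.
\<close>

lemma fourier_deriv:
  assumes \<phi>: "test_function_on U \<phi>" and b: "b \<in> Basis"
  shows "fourier (iter_deriv [b] \<phi>) \<xi> = 2 * of_real pi * \<i> * of_real (b \<bullet> \<xi>) * fourier \<phi> \<xi>"
proof -
  define \<epsilon> where "\<epsilon> n = inverse (real (Suc n))" for n
  have \<epsilon>: "0 < \<epsilon> n" "\<epsilon> n \<le> 1" for n by (auto simp: \<epsilon>_def inverse_le_1_iff)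
  have \<epsilon>0: "\<epsilon> \<longlonglongrightarrow> 0" unfolding \<epsilon>_def by (rule LIMSEQ_inverse_real_of_nat)
  have nb: "norm b = 1" using b by simp
  define q where "q n x = of_real (inverse (\<epsilon> n)) * (\<phi> (x + \<epsilon> n *\<^sub>R b) - \<phi> x)" for n x
  note [measurable] = test_functionD(3)[OF \<phi>] test_functionD(3)[OF test_function_deriv[OF \<phi> b]]
  have q_lim: "(\<lambda>n. q n x) \<longlonglongrightarrow> iter_deriv [b] \<phi> x" for x
  proof -
    let ?D = "frechet_derivative \<phi> (at x)"
    have D: "(\<phi> has_derivative ?D) (at x)" by (rule test_functionD(2)[OF \<phi>])
    have lin: "?D (r *\<^sub>R b) = r *\<^sub>R ?D b" for r
      using D by (simp add: has_derivative_def linear_simps bounded_linear.linear linear_scale)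
    have "(\<lambda>h. norm (\<phi> (x + h) - \<phi> x - ?D h) / norm h) \<midarrow>0\<rightarrow> 0" using D by (simp add: has_derivative_at)
    moreover have "filterlim (\<lambda>n. \<epsilon> n *\<^sub>R b) (at 0) sequentially"
      unfolding filterlim_at
    proof
      have "(\<lambda>n. \<epsilon> n *\<^sub>R b) \<longlonglongrightarrow> 0 *\<^sub>R b" by (intro tendsto_intros \<epsilon>0)
      then show "(\<lambda>n. \<epsilon> n *\<^sub>R b) \<longlonglongrightarrow> 0" by simp
      have "\<epsilon> n *\<^sub>R b \<noteq> 0" for n using \<epsilon>(1)[of n] nb by auto
      then show "\<forall>\<^sub>F n in sequentially. \<epsilon> n *\<^sub>R b \<in> UNIV \<and> \<epsilon> n *\<^sub>R b \<noteq> 0" by simp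
    qed
    ultimately have "(\<lambda>n. norm (\<phi> (x + \<epsilon> n *\<^sub>R b) - \<phi> x - ?D (\<epsilon> n *\<^sub>R b)) / norm (\<epsilon> n *\<^sub>R b)) \<longlonglongrightarrow> 0"
      by (rule filterlim_compose)
    moreover have "norm (\<phi> (x + \<epsilon> n *\<^sub>R b) - \<phi> x - ?D (\<epsilon> n *\<^sub>R b)) / norm (\<epsilon> n *\<^sub>R b) = norm (q n x - ?D b)" for n
    proof -
      have "q n x - ?D b = of_real (inverse (\<epsilon> n)) * (\<phi> (x + \<epsilon> n *\<^sub>R b) - \<phi> x - ?D (\<epsilon> n *\<^sub>R b))"
        unfolding lin q_def using \<epsilon>(1)[of n] by (simp add: scaleR_conv_of_real right_diff_distrib)
      then have "norm (q n x - ?D b) = inverse (\<epsilon> n) * norm (\<phi> (x + \<epsilon> n *\<^sub>R b) - \<phi> x - ?D (\<epsilon> n *\<^sub>R b))"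
        using \<epsilon>(1)[of n] by (simp only: norm_mult norm_of_real abs_of_pos positive_imp_inverse_positive)
      then show ?thesis using \<epsilon>(1)[of n] nb by (simp add: divide_inverse mult.commute)
    qed
    ultimately have "(\<lambda>n. norm (q n x - ?D b)) \<longlonglongrightarrow> 0" by simp
    then have "(\<lambda>n. q n x) \<longlonglongrightarrow> ?D b" using tendsto_norm_zero_iff LIM_zero_iff by blast
    then show ?thesis by simp
  qed
  obtain B where B: "B \<ge> 0" "\<And>x t. norm (\<phi> (x + t *\<^sub>R b) - \<phi> x) \<le> B * \<bar>t\<bar>"
    using test_function_lipschitz[OF \<phi> b] by blast
  obtain K where K: "compact K" "\<And>x. x \<notin> K \<Longrightarrow> \<phi> x = 0"
    using \<phi> by (auto simp: test_function_on_def)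
  obtain R where R: "\<And>x. x \<in> K \<Longrightarrow> norm x \<le> R" using compact_imp_bounded[OF K(1)] by (auto simp: bounded_iff)
  \<comment> \<open>The translations have length at most 1, so the supports of the quotients lie in a ball of radius \<open>R + 1\<close>.\<close>
  have q_bound: "norm (q n x) \<le> B * indicator (cball 0 (R + 1)) x" for n x
  proof (cases "x \<in> cball 0 (R + 1)")
    case True
    have "norm (q n x) \<le> inverse (\<epsilon> n) * (B * \<bar>\<epsilon> n\<bar>)"
      unfolding q_def norm_mult norm_of_real using B(2)[of x "\<epsilon> n"] \<epsilon>(1)[of n] by (simp add: mult_left_mono)
    then show ?thesis using True \<epsilon>(1)[of n] by (simp add: field_simps)
  next
    case False
    then have "norm x > R + 1" by simp
    moreover have "norm (x + \<epsilon> n *\<^sub>R b) \<ge> norm x - norm (\<epsilon> n *\<^sub>R b)" by (rule norm_diff_ineq)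
    moreover have "norm (\<epsilon> n *\<^sub>R b) \<le> 1" using \<epsilon>[of n] nb by simp
    ultimately have "x \<notin> K" "x + \<epsilon> n *\<^sub>R b \<notin> K" using R[of x] R[of "x + \<epsilon> n *\<^sub>R b"] by auto
    then show ?thesis using K(2) B(1) by (simp add: q_def)
  qed
  have [measurable]: "q n \<in> borel_measurable borel" for n unfolding q_def by measurable
  have "(\<lambda>n. fourier (q n) \<xi>) \<longlonglongrightarrow> fourier (iter_deriv [b] \<phi>) \<xi>"
    unfolding fourier_def
  proof (rule integral_dominated_convergence[where w="\<lambda>x. B * indicator (cball 0 (R + 1)) x"])
    show "integrable lborel (\<lambda>x::real^2. B * indicator (cball 0 (R + 1)) x)"
      using emeasure_bounded_finite[OF bounded_cball, of "0 :: real^2" "R + 1"]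
      by (intro integrable_mult_right integrable_real_indicator) auto
    show "AE x in lborel. (\<lambda>n. q n x * wave (x \<bullet> \<xi>)) \<longlonglongrightarrow> iter_deriv [b] \<phi> x * wave (x \<bullet> \<xi>)"
      by (intro AE_I2 tendsto_mult tendsto_const q_lim)
    show "AE x in lborel. norm (q n x * wave (x \<bullet> \<xi>)) \<le> B * indicator (cball 0 (R + 1)) x" for n
      using q_bound by (auto simp: norm_mult fourier_kernel_norm)
  qed (measurable; fail)+
  moreover have "fourier (q n) \<xi> = (exp (of_real (\<epsilon> n) * (2 * of_real pi * \<i> * of_real (b \<bullet> \<xi>))) - 1) / of_real (\<epsilon> n) * fourier \<phi> \<xi>" for n
  proof -
    have int: "integrable lborel (\<lambda>x. \<phi> x * wave (x \<bullet> \<xi>))" 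
      if "integrable lborel \<phi>" for \<phi> :: "real^2 \<Rightarrow> complex"
      by (rule Bochner_Integration.integrable_bound[OF that])
        (use borel_measurable_integrable[OF that] in \<open>auto simp: norm_mult fourier_kernel_norm\<close>)
    have i0: "integrable lborel \<phi>" by (rule test_function_integrable[OF \<phi>])
    have "integrable (distr lborel borel ((+) (\<epsilon> n *\<^sub>R b))) \<phi>" using i0 by (simp only: lborel_distr_plus)
    then have i1: "integrable lborel (\<lambda>x. \<phi> (x + \<epsilon> n *\<^sub>R b))" by (subst (asm) integrable_distr_eq) (auto simp: add.commute)
    have "fourier (q n) \<xi> = of_real (inverse (\<epsilon> n)) * (fourier (\<lambda>x. \<phi> (x + \<epsilon> n *\<^sub>R b)) \<xi> - fourier \<phi> \<xi>)"
      unfolding fourier_def q_def Bochner_Integration.integral_diff[OF int[OF i1] int[OF i0], symmetric] integral_mult_right_zero[symmetric]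
      by (simp add: algebra_simps)
    also have "fourier (\<lambda>x. \<phi> (x + \<epsilon> n *\<^sub>R b)) \<xi> = exp (of_real (\<epsilon> n) * (2 * of_real pi * \<i> * of_real (b \<bullet> \<xi>))) * fourier \<phi> \<xi>"
      by (subst fourier_translate) (auto simp: mult_ac)
    finally show ?thesis by (simp add: divide_inverse algebra_simps)
  qed
  moreover have "(\<lambda>n. (exp (of_real (\<epsilon> n) * (2 * of_real pi * \<i> * of_real (b \<bullet> \<xi>))) - 1) / of_real (\<epsilon> n) * fourier \<phi> \<xi>)
    \<longlonglongrightarrow> 2 * of_real pi * \<i> * of_real (b \<bullet> \<xi>) * fourier \<phi> \<xi>"
  proof (intro tendsto_mult tendsto_const)
    let ?z = "2 * of_real pi * \<i> * of_real (b \<bullet> \<xi>) :: complex"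
    have "((\<lambda>h. exp (h * ?z)) has_field_derivative ?z) (at 0)"
      by (auto intro!: derivative_eq_intros)
    then have "(\<lambda>h. (exp (h * ?z) - 1) / h) \<midarrow>0\<rightarrow> ?z" by (simp add: DERIV_def)
    moreover have "filterlim (\<lambda>n. complex_of_real (\<epsilon> n)) (at 0) sequentially"
      unfolding filterlim_at
    proof
      have "(\<lambda>n. complex_of_real (\<epsilon> n)) \<longlonglongrightarrow> of_real 0" by (intro tendsto_of_real \<epsilon>0)
      then show "(\<lambda>n. complex_of_real (\<epsilon> n)) \<longlonglongrightarrow> 0" by simp
      show "\<forall>\<^sub>F n in sequentially. complex_of_real (\<epsilon> n) \<in> UNIV \<and> complex_of_real (\<epsilon> n) \<noteq> 0"
        using \<epsilon>(1) by (simp add: less_imp_neq[symmetric])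
    qed
    ultimately show "(\<lambda>n. (exp (of_real (\<epsilon> n) * ?z) - 1) / of_real (\<epsilon> n)) \<longlonglongrightarrow> ?z"
      by (rule filterlim_compose)
  qed
  ultimately show ?thesis using LIMSEQ_unique by fastforce
qed

lemma fourier_second_deriv:
  assumes \<phi>: "test_function_on U \<phi>" and b: "b \<in> Basis"
  shows "of_real ((b \<bullet> \<xi>)\<^sup>2) * fourier \<phi> \<xi> = of_real (- (1 / (4 * pi\<^sup>2))) * fourier (iter_deriv [b] (iter_deriv [b] \<phi>)) \<xi>"
  unfolding fourier_deriv[OF test_function_deriv[OF \<phi> b] b] fourier_deriv[OF \<phi> b]
  by (simp add: power2_eq_square field_simps)

text \<open>
  Apply the bound to \<open>\<phi>\<close> and to its second derivative in the direction \<open>b\<close>, whose transform is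
  \<open>- 4 \<pi>\<^sup>2 (b \<bullet> \<xi>)\<^sup>2\<close> times that of \<open>\<phi>\<close>.
\<close>

lemma fourier_weight_step:
  assumes b: "b \<in> Basis" and w: "\<And>x. 0 \<le> w x"
    and bound: "\<And>\<phi>. test_function_on U \<phi> \<Longrightarrow> \<exists>C. \<forall>\<xi>. w \<xi> * norm (fourier \<phi> \<xi>) \<le> C"
    and \<phi>: "test_function_on U \<phi>"
  shows "\<exists>C. \<forall>\<xi>. w \<xi> * (1 + (b \<bullet> \<xi>)\<^sup>2) * norm (fourier \<phi> \<xi>) \<le> C"
proof -
  let ?\<psi> = "iter_deriv [b] (iter_deriv [b] \<phi>)"
  have \<psi>: "test_function_on U ?\<psi>" by (intro test_function_deriv \<phi> b)
  obtain C where C: "\<And>\<xi>. w \<xi> * norm (fourier \<phi> \<xi>) \<le> C" using bound[OF \<phi>] by blast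
  obtain D where D: "\<And>\<xi>. w \<xi> * norm (fourier ?\<psi> \<xi>) \<le> D" using bound[OF \<psi>] by blast
  have "w \<xi> * (1 + (b \<bullet> \<xi>)\<^sup>2) * norm (fourier \<phi> \<xi>) \<le> C + 1 / (4 * pi\<^sup>2) * D" for \<xi>
  proof -
    have "norm (of_real ((b \<bullet> \<xi>)\<^sup>2) * fourier \<phi> \<xi>) = norm (of_real (- (1 / (4 * pi\<^sup>2))) * fourier ?\<psi> \<xi>)"
      by (rule arg_cong[where f=norm, OF fourier_second_deriv[OF \<phi> b]])
    then have n: "(b \<bullet> \<xi>)\<^sup>2 * norm (fourier \<phi> \<xi>) = 1 / (4 * pi\<^sup>2) * norm (fourier ?\<psi> \<xi>)"
      by (simp add: norm_mult norm_divide norm_power del: iter_deriv.simps)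
    have "w \<xi> * (1 + (b \<bullet> \<xi>)\<^sup>2) * norm (fourier \<phi> \<xi>) = w \<xi> * norm (fourier \<phi> \<xi>) + w \<xi> * ((b \<bullet> \<xi>)\<^sup>2 * norm (fourier \<phi> \<xi>))"
      by (simp add: algebra_simps)
    also have "\<dots> = w \<xi> * norm (fourier \<phi> \<xi>) + 1 / (4 * pi\<^sup>2) * (w \<xi> * norm (fourier ?\<psi> \<xi>))"
      unfolding n by simp
    also have "\<dots> \<le> C + 1 / (4 * pi\<^sup>2) * D" by (intro add_mono mult_left_mono C D) auto
    finally show ?thesis .
  qed
  then show ?thesis by blast
qed

text \<open>
  Two steps in each coordinate bound the transform by the square of \<open>decay\<close>; one factor absorbs \<open>|x|\<^sup>2\<close>.
\<close>

lemma fourier_test_function_decay: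
  assumes \<phi>: "test_function_on U \<phi>"
  shows "\<exists>C\<ge>0. \<forall>x. norm (fourier \<phi> x) \<le> C * decay x \<and> (norm x)\<^sup>2 * norm (fourier \<phi> x) \<le> C * decay x"
proof -
  have b: "axis 1 1 \<in> (Basis :: (real^2) set)" "axis 2 1 \<in> (Basis :: (real^2) set)" by (auto simp: Basis_real2)
  let ?p = "\<lambda>x::real^2. 1 + (axis 1 1 \<bullet> x)\<^sup>2" and ?r = "\<lambda>x::real^2. 1 + (axis 2 1 \<bullet> x)\<^sup>2"
  have s0: "\<exists>C. \<forall>\<xi>. 1 * norm (fourier \<phi> \<xi>) \<le> C" if "test_function_on U \<phi>" for \<phi>
    using fourier_norm_le[OF test_function_integrable[OF that]] by auto
  have s1: "\<exists>C. \<forall>\<xi>. 1 * ?p \<xi> * norm (fourier \<phi> \<xi>) \<le> C" if "test_function_on U \<phi>" for \<phi>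
    by (rule fourier_weight_step[OF b(1) _ s0 that]) auto
  have s2: "\<exists>C. \<forall>\<xi>. 1 * ?p \<xi> * ?p \<xi> * norm (fourier \<phi> \<xi>) \<le> C" if "test_function_on U \<phi>" for \<phi>
    by (rule fourier_weight_step[OF b(1) _ s1 that]) auto
  have s3: "\<exists>C. \<forall>\<xi>. 1 * ?p \<xi> * ?p \<xi> * ?r \<xi> * norm (fourier \<phi> \<xi>) \<le> C" if "test_function_on U \<phi>" for \<phi>
    by (rule fourier_weight_step[OF b(2) _ s2 that]) auto
  have "\<exists>C. \<forall>\<xi>. 1 * ?p \<xi> * ?p \<xi> * ?r \<xi> * ?r \<xi> * norm (fourier \<phi> \<xi>) \<le> C"
    by (rule fourier_weight_step[OF b(2) _ s3 \<phi>]) auto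
  then obtain C where C: "\<And>x. ?p x * ?p x * ?r x * ?r x * norm (fourier \<phi> x) \<le> C"
    by auto
  have "norm (fourier \<phi> x) \<le> \<bar>C\<bar> * decay x \<and> (norm x)\<^sup>2 * norm (fourier \<phi> x) \<le> \<bar>C\<bar> * decay x" for x
  proof -
    \<comment> \<open>\<open>W\<close> is the reciprocal of \<open>decay x\<close> and dominates both 1 and \<open>|x|\<^sup>2\<close>.\<close>
    define W where "W = (1 + (x $ 1)\<^sup>2) * (1 + (x $ 2)\<^sup>2)"
    have exp: "W = 1 + (norm x)\<^sup>2 + (x $ 1)\<^sup>2 * (x $ 2)\<^sup>2"
      unfolding W_def norm_real2_sq by (simp add: algebra_simps)
    have W1: "1 \<le> W" "(norm x)\<^sup>2 \<le> W" unfolding exp by auto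
    have d: "decay x = 1 / W" by (simp add: decay_def W_def field_simps)
    have ax: "axis 1 1 \<bullet> x = x $ 1" "axis 2 1 \<bullet> x = x $ 2" by (simp_all add: inner_axis' )
    have CW: "W * W * norm (fourier \<phi> x) \<le> \<bar>C\<bar>"
    proof -
      have "W * W * norm (fourier \<phi> x) = ?p x * ?p x * ?r x * ?r x * norm (fourier \<phi> x)" unfolding ax W_def by (simp add: mult_ac)
      then show ?thesis using C[of x] by linarith
    qed
    have le: "u * norm (fourier \<phi> x) \<le> \<bar>C\<bar> * decay x" if "0 \<le> u" "u \<le> W" for u
    proof -
      have "W * (u * norm (fourier \<phi> x)) \<le> W * (W * norm (fourier \<phi> x))"
        using that W1 by (intro mult_left_mono mult_right_mono) auto
      also have "\<dots> \<le> \<bar>C\<bar>" using CW by (simp add: mult.assoc)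
      finally show ?thesis unfolding d using W1 by (simp add: pos_le_divide_eq mult.commute)
    qed
    show ?thesis using le[of 1] le[of "(norm x)\<^sup>2"] W1 by auto
  qed
  then show ?thesis by (intro exI[of _ "\<bar>C\<bar>"]) auto
qed

lemma fourier_admissible_test_function:
  assumes "0 < s" "s < 2" and \<phi>: "test_function_on U \<phi>"
  shows "fourier_admissible s \<phi>"
proof -
  obtain C where "\<And>x. norm (\<phi> x) \<le> C * decay x" using test_function_decay[OF \<phi>] by blast
  moreover obtain C' where "\<And>x. norm (fourier \<phi> x) \<le> C' * decay x" using fourier_test_function_decay[OF \<phi>] by blast
  ultimately show ?thesis using fourier_admissibleI[OF assms(1,2) test_functionD(3)[OF \<phi>]] by blast
qed

lemma integrable_fourier_test_function:
  assumes \<phi>: "test_function_on U \<phi>"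
  shows "integrable lborel (fourier \<phi>)" "integrable lborel (\<lambda>x. of_real ((norm x)\<^sup>2) * fourier \<phi> x)"
proof -
  obtain C where C: "C \<ge> 0" "\<And>x. norm (fourier \<phi> x) \<le> C * decay x" "\<And>x. (norm x)\<^sup>2 * norm (fourier \<phi> x) \<le> C * decay x"
    using fourier_test_function_decay[OF \<phi>] by blast
  note [measurable] = test_functionD(3)[OF \<phi>]
  note i = integrable_mult_right[OF integrable_decay, of C]
  show "integrable lborel (fourier \<phi>)"
    by (rule Bochner_Integration.integrable_bound[OF i]) (use C decay_nonneg in \<open>auto simp: abs_mult\<close>)
  show "integrable lborel (\<lambda>x. of_real ((norm x)\<^sup>2) * fourier \<phi> x)"
    by (rule Bochner_Integration.integrable_bound[OF i]) (use C decay_nonneg in \<open>auto simp: abs_mult norm_mult norm_power\<close>)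
qed

text \<open>
  The integral of the transform is \<open>\<phi> 0 = 0\<close>. With the convergence factor \<open>exp (- t |x|\<^sup>2)\<close> the integral
  becomes that of \<open>\<phi>\<close> against a Gaussian of width \<open>sqrt t\<close> around 0, which tends to 0 with \<open>t\<close> because \<open>\<phi>\<close>
  vanishes near 0.
\<close>

lemma integral_fourier_eq_0:
  assumes \<phi>: "test_function_on (- {0}) \<phi>"
  shows "(LINT x|lborel. fourier \<phi> x) = 0"
proof -
  obtain K where K: "compact K" "K \<subseteq> - {0}" "\<And>x. x \<notin> K \<Longrightarrow> \<phi> x = 0"
    using \<phi> by (auto simp: test_function_on_def)
  have "open (- K)" "0 \<in> - K" using K by (auto simp: compact_imp_closed)
  then obtain r where r: "r > 0" "ball 0 r \<subseteq> - K" using openE by blast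
  have supp: "\<phi> \<xi> = 0" if "norm \<xi> < r" for \<xi>
  proof -
    have "\<xi> \<in> ball 0 r" using that by simp
    then show ?thesis using r(2) K(3) by blast
  qed
  define t where "t n = inverse (real (Suc n))" for n
  have t: "0 < t n" for n by (simp add: t_def)
  have t0: "t \<longlonglongrightarrow> 0" unfolding t_def by (rule LIMSEQ_inverse_real_of_nat)
  note [measurable] = test_functionD(3)[OF \<phi>]
  have i\<phi>: "integrable lborel \<phi>" by (rule test_function_integrable[OF \<phi>])
  have iF: "integrable lborel (fourier \<phi>)" by (rule integrable_fourier_test_function(1)[OF \<phi>])
  have "(\<lambda>n. LINT x|lborel. of_real (exp (- (t n * (norm x)\<^sup>2))) * fourier \<phi> x) \<longlonglongrightarrow> (LINT x|lborel. fourier \<phi> x)"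
  proof (rule integral_dominated_convergence[where w="\<lambda>x. norm (fourier \<phi> x)"])
    show "AE x in lborel. (\<lambda>n. of_real (exp (- (t n * (norm x)\<^sup>2))) * fourier \<phi> x) \<longlonglongrightarrow> fourier \<phi> x"
    proof (intro AE_I2)
      fix x :: "real^2"
      have "(\<lambda>n. of_real (exp (- (t n * (norm x)\<^sup>2))) * fourier \<phi> x) \<longlonglongrightarrow> of_real (exp (- (0 * (norm x)\<^sup>2))) * fourier \<phi> x"
        by (intro tendsto_intros t0)
      then show "(\<lambda>n. of_real (exp (- (t n * (norm x)\<^sup>2))) * fourier \<phi> x) \<longlonglongrightarrow> fourier \<phi> x" by simp
    qed
    show "AE x in lborel. norm (of_real (exp (- (t n * (norm x)\<^sup>2))) * fourier \<phi> x) \<le> norm (fourier \<phi> x)" for n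
      using t[of n] by (auto simp: norm_mult mult_left_le_one_le)
  qed (use iF in \<open>auto intro: integrable_norm\<close>)
  moreover have "(\<lambda>n. LINT x|lborel. of_real (exp (- (t n * (norm x)\<^sup>2))) * fourier \<phi> x) \<longlonglongrightarrow> 0"
  proof (rule Lim_null_comparison)
    show "\<forall>\<^sub>F n in sequentially. norm (LINT x|lborel. of_real (exp (- (t n * (norm x)\<^sup>2))) * fourier \<phi> x)
       \<le> pi / t n * exp (- (pi\<^sup>2 * r\<^sup>2 / t n)) * (LINT x|lborel. norm (\<phi> x))"
    proof (intro always_eventually allI)
      fix n
      have gi: "integrable lborel (\<lambda>x::real^2. complex_of_real (exp (- (t n * (norm x)\<^sup>2))))"
        using integrable_gaussian[OF t] by (simp only: complex_of_real_integrable_eq)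
      have b: "norm (of_real (pi / t n * exp (- (pi\<^sup>2 * (norm \<xi>)\<^sup>2 / t n))) * \<phi> \<xi>) \<le> pi / t n * exp (- (pi\<^sup>2 * r\<^sup>2 / t n)) * norm (\<phi> \<xi>)" for \<xi>
      proof (cases "norm \<xi> < r")
        case False
        then have "pi\<^sup>2 * r\<^sup>2 / t n \<le> pi\<^sup>2 * (norm \<xi>)\<^sup>2 / t n"
          using t[of n] r(1) by (intro divide_right_mono mult_left_mono power_mono) auto
        then have "pi / t n * exp (- (pi\<^sup>2 * (norm \<xi>)\<^sup>2 / t n)) \<le> pi / t n * exp (- (pi\<^sup>2 * r\<^sup>2 / t n))"
          using t[of n] by (intro mult_left_mono) auto
        moreover have "0 \<le> pi / t n * exp (- (pi\<^sup>2 * (norm \<xi>)\<^sup>2 / t n))" using t[of n] by simp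
        ultimately show ?thesis unfolding norm_mult norm_of_real by (intro mult_right_mono) auto
      qed (simp add: supp)
      have "norm (LINT x|lborel. of_real (exp (- (t n * (norm x)\<^sup>2))) * fourier \<phi> x)
        = norm (LINT \<xi>|lborel. of_real (pi / t n * exp (- (pi\<^sup>2 * (norm \<xi>)\<^sup>2 / t n))) * \<phi> \<xi>)"
        unfolding fourier_multiplication[OF gi i\<phi>] fourier_gaussian[OF t] ..
      also have "\<dots> \<le> (LINT \<xi>|lborel. pi / t n * exp (- (pi\<^sup>2 * r\<^sup>2 / t n)) * norm (\<phi> \<xi>))"
      proof (rule order_trans[OF integral_norm_bound integral_mono])
        show i: "integrable lborel (\<lambda>\<xi>. pi / t n * exp (- (pi\<^sup>2 * r\<^sup>2 / t n)) * norm (\<phi> \<xi>))"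
          by (intro integrable_mult_right integrable_norm i\<phi>)
        show "integrable lborel (\<lambda>\<xi>. norm (of_real (pi / t n * exp (- (pi\<^sup>2 * (norm \<xi>)\<^sup>2 / t n))) * \<phi> \<xi>))"
        proof (rule Bochner_Integration.integrable_bound[OF i], measurable, intro AE_I2)
          fix \<xi>
          show "norm (norm (of_real (pi / t n * exp (- (pi\<^sup>2 * (norm \<xi>)\<^sup>2 / t n))) * \<phi> \<xi>))
            \<le> norm (pi / t n * exp (- (pi\<^sup>2 * r\<^sup>2 / t n)) * norm (\<phi> \<xi>))"
            using b[of \<xi>] by (simp only: real_norm_def abs_norm_cancel)
        qed
      qed (rule b)
      finally show "norm (LINT x|lborel. of_real (exp (- (t n * (norm x)\<^sup>2))) * fourier \<phi> x)
        \<le> pi / t n * exp (- (pi\<^sup>2 * r\<^sup>2 / t n)) * (LINT x|lborel. norm (\<phi> x))" by simp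
    qed
    define c where "c = pi\<^sup>2 * r\<^sup>2"
    have c: "c > 0" using r(1) by (simp add: c_def)
    have "(\<lambda>n. pi / t n * exp (- (c / t n))) \<longlonglongrightarrow> 0"
      unfolding t_def using c by real_asymp
    then have "(\<lambda>n. pi / t n * exp (- (c / t n)) * (LINT x|lborel. norm (\<phi> x))) \<longlonglongrightarrow> 0 * (LINT x|lborel. norm (\<phi> x))"
      by (intro tendsto_intros)
    then show "(\<lambda>n. pi / t n * exp (- (pi\<^sup>2 * r\<^sup>2 / t n)) * (LINT x|lborel. norm (\<phi> x))) \<longlonglongrightarrow> 0"
      by (simp add: c_def)
  qed
  ultimately show ?thesis by (rule LIMSEQ_unique)
qed

lemma integral_norm_sq_fourier_eq_0:
  assumes \<phi>: "test_function_on (- {0}) \<phi>"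
  shows "(LINT x|lborel. of_real ((norm x)\<^sup>2) * fourier \<phi> x) = 0"
proof -
  have b: "axis 1 1 \<in> (Basis :: (real^2) set)" "axis 2 1 \<in> (Basis :: (real^2) set)" by (auto simp: Basis_real2)
  have ax: "axis 1 1 \<bullet> x = x $ 1" "axis 2 1 \<bullet> x = x $ 2" for x :: "real^2" by (simp_all add: inner_axis')
  let ?\<psi> = "\<lambda>b. iter_deriv [b] (iter_deriv [b] \<phi>)"
  have \<psi>: "test_function_on (- {0}) (?\<psi> (axis 1 1))" "test_function_on (- {0}) (?\<psi> (axis 2 1))"
    by (intro test_function_deriv \<phi> b)+
  have eq: "of_real ((norm x)\<^sup>2) * fourier \<phi> x = of_real (- (1 / (4 * pi\<^sup>2))) * (fourier (?\<psi> (axis 1 1)) x + fourier (?\<psi> (axis 2 1)) x)" for x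
    using fourier_second_deriv[OF \<phi> b(1), of x] fourier_second_deriv[OF \<phi> b(2), of x]
    unfolding ax norm_real2_sq of_real_add distrib_right distrib_left by (simp only:)
  show ?thesis
    unfolding eq integral_mult_right_zero
      Bochner_Integration.integral_add[OF integrable_fourier_test_function(1)[OF \<psi>(1)] integrable_fourier_test_function(1)[OF \<psi>(2)]]
      integral_fourier_eq_0[OF \<psi>(1)] integral_fourier_eq_0[OF \<psi>(2)]
    by simp
qed

section \<open>The theorem\<close>

theorem fourier_aniso_potential:
  fixes s :: real and \<Omega> :: "real \<Rightarrow> real"
  assumes s: "1 \<le> s" "s < 2" and \<Omega>: "continuous_on UNIV \<Omega>" "\<And>\<theta>. 0 < \<Omega> \<theta>" "\<And>\<theta>. \<Omega> (\<theta> + pi) = \<Omega> \<theta>"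
  shows "\<exists>What :: real^2 \<Rightarrow> real. has_fourier_off_origin (aniso_potential s \<Omega>) (\<lambda>\<xi>. of_real (What \<xi>)) \<and>
            (\<forall>\<xi>. \<xi> \<noteq> 0 \<longrightarrow> What \<xi> > 0)"
proof -
  obtain \<Psi> where \<Psi>: "continuous_on UNIV \<Psi>" "\<And>\<theta>. \<Psi> (\<theta> + pi) = \<Psi> \<theta>" "\<And>\<theta>. 0 < \<Psi> \<theta>"
    and I: "\<And>\<phi>. fourier_admissible s \<phi> \<Longrightarrow>
      integrable lborel (\<lambda>x. of_real (norm x powr (- s) * \<Omega> (angle x)) * fourier \<phi> x)"
      "\<And>\<phi>. fourier_admissible s \<phi> \<Longrightarrow> integrable lborel (\<lambda>\<xi>. of_real (norm \<xi> powr (- (2 - s)) * \<Psi> (angle \<xi>)) * \<phi> \<xi>)"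
      "\<And>\<phi>. fourier_admissible s \<phi> \<Longrightarrow> (LINT x|lborel. of_real (norm x powr (- s) * \<Omega> (angle x)) * fourier \<phi> x)
       = (LINT \<xi>|lborel. of_real (norm \<xi> powr (- (2 - s)) * \<Psi> (angle \<xi>)) * \<phi> \<xi>)"
    using fourier_angular[OF s \<Omega>] by blast
  define What where "What \<xi> = norm \<xi> powr (- (2 - s)) * \<Psi> (angle \<xi>)" for \<xi>
  have "continuous_on (- {0}) What"
    unfolding What_def by (intro continuous_intros continuous_on_angle \<Psi>) auto
  then have cont: "continuous_on (- {0}) (\<lambda>\<xi>. complex_of_real (What \<xi>))" by (intro continuous_intros)
  have "has_fourier_off_origin (aniso_potential s \<Omega>) (\<lambda>\<xi>. of_real (What \<xi>))"
    unfolding has_fourier_off_origin_def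
  proof (intro conjI allI impI cont)
    fix \<phi> assume \<phi>: "test_function_on (- {0}) \<phi>"
    have s0: "0 < s" using s by simp
    note adm = fourier_admissible_test_function[OF s0 s(2) \<phi>]
    note i2 = integrable_fourier_test_function(2)[OF \<phi>]
    \<comment> \<open>The second summand integrates to 0.\<close>
    have split: "of_real (aniso_potential s \<Omega> x) * fourier \<phi> x
      = of_real (norm x powr (- s) * \<Omega> (angle x)) * fourier \<phi> x + of_real ((norm x)\<^sup>2) * fourier \<phi> x" for x
      unfolding aniso_potential_def by (simp add: distrib_right)
    show "integrable lborel (\<lambda>x. of_real (aniso_potential s \<Omega> x) * fourier \<phi> x)"
      unfolding split by (intro Bochner_Integration.integrable_add I(1) adm i2)
    show "integrable lborel (\<lambda>\<xi>. of_real (What \<xi>) * \<phi> \<xi>)"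
      unfolding What_def by (rule I(2)[OF adm])
    show "(LINT x|lborel. of_real (aniso_potential s \<Omega> x) * fourier \<phi> x) = (LINT \<xi>|lborel. of_real (What \<xi>) * \<phi> \<xi>)"
      unfolding split Bochner_Integration.integral_add[OF I(1)[OF adm] i2] integral_norm_sq_fourier_eq_0[OF \<phi>] What_def I(3)[OF adm] by simp
  qed
  moreover have "What \<xi> > 0" if "\<xi> \<noteq> 0" for \<xi> using that \<Psi>(3) by (simp add: What_def)
  ultimately show ?thesis by blast
qed

theorem lemma8p1:
  fixes s :: real and \<Omega> :: "real \<Rightarrow> real"
  assumes "1 \<le> s" and "s < 2"
    and "smooth \<Omega>"
    and "\<forall>\<theta>. \<Omega> (\<theta> + 2 * pi) = \<Omega> \<theta>"
    and "\<forall>\<theta>. 0 < \<Omega> \<theta>"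
    and "\<forall>\<theta>. \<Omega> (\<theta> + pi) = \<Omega> \<theta>"
  shows "(\<exists>What :: real^2 \<Rightarrow> real.
            has_fourier_off_origin (aniso_potential s \<Omega>) (\<lambda>\<xi>. of_real (What \<xi>)) \<and>
            (\<forall>\<xi>. \<xi> \<noteq> 0 \<longrightarrow> What \<xi> > 0)) \<and>
         LIC (singular_kernel (aniso_potential s \<Omega>))"
proof -
  have "iter_deriv [] \<Omega> differentiable_on UNIV"
    using assms(3) unfolding smooth_def by (metis empty_set empty_subsetI)
  then have "continuous_on UNIV \<Omega>" by (simp add: differentiable_imp_continuous_on)
  then show ?thesis
    using fourier_aniso_potential[OF assms(1,2)] LIC_aniso_potential[OF assms(1)] assms(5,6) by blast
qed

end
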